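(* Let $k$ be an algebraically closed field. The one-to-one correspondence between quasi-hereditary algebras $A$ with a homological exact Borel subalgebra $B$ and directed $B$-corings $\mathcal{C}$, which sends $(A,B)$ to the right dual coring $\mathcal{C}=\mathrm{Hom}_{\text{-}B}(A,B)$, is compatible with the opposite of relative Hochschild cohomology and with Cartier cohomology as Gerstenhaber algebras: whenever $(A,B)$ corresponds to $\mathcal{C}$, there is an isomorphism of Gerstenhaber algebras $$H^*_{\mathrm{Ca}}(\mathcal{C})\cong HH^*(A|B)^{\mathrm{opp}}.$$
   Context: All algebras are finite-dimensional over $k$. An exact Borel subalgebra of a quasi-hereditary algebra $A$ (with ordered index set of simples and standard modules $\Delta(i)$) is a subalgebra $B\subseteq A$ whose simples $L_B(i)$ are indexed by the same ordered set, such that $B$ is quasi-hereditary with simple standard modules (i.e. directed), $A\otimes_B-$ is exact, and $A\otimes_BL_B(i)\cong\Delta(i)$ for all $i$. It is homological if the induced maps $\mathrm{Ext}^n_B(X,Y)\to\mathrm{Ext}^n_A(A\otimes_BX,A\otimes_BY)$ are surjective for $n\ge1$ and bijective for $n\ge2$, for all $B$-modules $X,Y$. A $B$-coring is a comonoid $(\mathcal{C},\Delta,\varepsilon)$ in $B$-bimodules; it is directed if $B$ is directed, $\varepsilon$ is surjective, and $\ker\varepsilon$ is a finite direct sum of bimodules $Be_j\otimes_ke_iB$ with $i<j$ ($e_i$ primitive idempotents). The existence of the one-to-one correspondence (up to the appropriate equivalence) is a known theorem. Right dual coring: since $A$ is finitely generated projective as a right $B$-module, $\mathcal{C}=\mathrm{Hom}_{\text{-}B}(A,B)$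 (right $B$-linear maps), with $(b_1fb_2)(x)=b_1f(b_2x)$, is a $B$-coring with $\varepsilon(f)=f(1)$ and $\Delta(f)=\sum f_1\otimes_Bf_2$ determined by $f(aa')=\sum f_1(f_2(a)a')$ for $a,a'\in A$. Gerstenhaber structures: for a non-symmetric operad $\mathcal{O}=(\mathcal{O}(n))_{n\ge0}$ of $k$-vector spaces set $f\{g_1,\dots,g_p\}=\sum(-1)^{\epsilon}\gamma(f;\mathrm{id},\dots,g_1,\dots,g_p,\dots,\mathrm{id})$, summing over all order-preserving graftings, $\epsilon=\sum_l(\deg g_l-1)i_l$, $\deg g=n$ for $g\in\mathcal{O}(n)$, $i_l$ the number of inputs to the left of $g_l$. Given $\mu\in\mathcal{O}(2)$ with $\mu\{\mu\}=0$, the cohomology of $\bigoplus_n\mathcal{O}(n)$ with respect to $[\mu,-]$, where $[f,g]=f\{g\}-(-1)^{(\deg f-1)(\deg g-1)}g\{f\}$, is a Gerstenhaber algebra with product $f\smile g=(-1)^{\deg f}\mu\{f,g\}$ and bracket $[-,-]$. $H^*_{\mathrm{Ca}}(\mathcal{C})$ is this for $\mathcal{O}(n)=\mathrm{Hom}_{B\text{-}B}(\mathcal{C},\mathcal{C}^{\otimes_Bn})$, $f\circ_ig=(\mathrm{id}^{\otimes(m-i-1)}\otimes g\otimes\mathrm{id}^{\otimes i})\circ f$ for $f$ of arity $m$, multiplication $\Delta$. $HH^*(A|B)$ is this for $\mathcal{O}(n)=\mathrm{Hom}_{B\text{-}B}(A^{\otimes_Bn},A)$, $f\circ_ig=f\circ(\mathrm{id}^{\otimes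 i}\otimes g\otimes\mathrm{id}^{\otimes(m-i-1)})$, multiplication $\mu_A$. The zeroth tensor power is $B$. $H^{\mathrm{opp}}$ has the same product and bracket $-[f,g]$. *)

theory Defs
  imports "HOL-Library.Function_Algebras" "HOL-Computational_Algebra.Polynomial"
begin

text \<open>
  The ground field is a type \<open>'k\<close> of class \<open>alg_closed_field\<close>.  The algebra \<open>A\<close> is a whole
  type \<open>'a\<close> with a scalar multiplication \<open>s\<close>; its sort is \<open>{ring, monoid_mult}\<close> instead of
  \<open>ring_1\<close> only so that the zero algebra is not excluded.  Subalgebras are subsets \<open>R\<close> of \<open>'a\<close>,
  and \<open>A\<close> itself is the subalgebra \<open>UNIV\<close>.

  Modules are subsets of types of class \<open>ab_group_add\<close> with an action of \<open>'a\<close>, of which only the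
  part belonging to \<open>R\<close> matters.  The field acts through \<open>s r 1\<close>.
  Every finite-dimensional module is isomorphic to one carried by a subset of \<open>nat \<Rightarrow> 'k\<close>; this
  type serves as universe whenever a definition quantifies over modules.

  A homomorphism is required to vanish off the carrier of its source, so that equality of functions
  is equality of homomorphisms.
\<close>

section \<open>Algebras and modules\<close>

definition fd_algebra :: "('k::field \<Rightarrow> 'a::{ring,monoid_mult} \<Rightarrow> 'a) \<Rightarrow> bool" where
  "fd_algebra s \<longleftrightarrow> vector_space s \<and>
     (\<forall>r x y. s r (x * y) = s r x * y) \<and> (\<forall>r x y. s r (x * y) = x * s r y) \<and>
     (\<exists>S. finite S \<and> module.span s S = UNIV)"

definition subalgebra :: "('k::field \<Rightarrow> 'a::{ring,monoid_mult} \<Rightarrow> 'a) \<Rightarrow> 'a set \<Rightarrow> bool" where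
  "subalgebra s R \<longleftrightarrow> 1 \<in> R \<and> (\<forall>x\<in>R. \<forall>y\<in>R. x + y \<in> R) \<and> (\<forall>x\<in>R. \<forall>y\<in>R. x * y \<in> R) \<and>
     (\<forall>r. \<forall>x\<in>R. s r x \<in> R)"

record ('a, 'm) lmod =
  mcar :: "'m set"
  lact :: "'a \<Rightarrow> 'm \<Rightarrow> 'm"

record ('a, 'm) bimod = "('a, 'm) lmod" +
  ract :: "'m \<Rightarrow> 'a \<Rightarrow> 'm"

definition add_subgroup :: "'m::ab_group_add set \<Rightarrow> bool" where
  "add_subgroup N \<longleftrightarrow> 0 \<in> N \<and> (\<forall>x\<in>N. \<forall>y\<in>N. x + y \<in> N) \<and> (\<forall>x\<in>N. - x \<in> N)"

definition left_module ::
    "'a::{ring,monoid_mult} set \<Rightarrow> ('a, 'm::ab_group_add, 'z) lmod_scheme \<Rightarrow> bool" where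
  "left_module R M \<longleftrightarrow> add_subgroup (mcar M) \<and>
     (\<forall>a\<in>R. \<forall>x\<in>mcar M. lact M a x \<in> mcar M) \<and>
     (\<forall>a\<in>R. \<forall>x\<in>mcar M. \<forall>y\<in>mcar M. lact M a (x + y) = lact M a x + lact M a y) \<and>
     (\<forall>a\<in>R. \<forall>b\<in>R. \<forall>x\<in>mcar M. lact M (a + b) x = lact M a x + lact M b x) \<and>
     (\<forall>a\<in>R. \<forall>b\<in>R. \<forall>x\<in>mcar M. lact M (a * b) x = lact M a (lact M b x)) \<and>
     (\<forall>x\<in>mcar M. lact M 1 x = x)"

definition fd_module ::
    "('k::field \<Rightarrow> 'a::{ring,monoid_mult} \<Rightarrow> 'a) \<Rightarrow> 'a set \<Rightarrow> ('a, 'm::ab_group_add, 'z) lmod_scheme \<Rightarrow> bool"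
  where
  "fd_module s R M \<longleftrightarrow> left_module R M \<and>
     (\<exists>S. finite S \<and> S \<subseteq> mcar M \<and>
        (\<forall>x\<in>mcar M. \<exists>c. x = (\<Sum>v\<in>S. lact M (s (c v) 1) v)))"

definition lmod_hom ::
    "'a::{ring,monoid_mult} set \<Rightarrow> ('a, 'm::ab_group_add, 'y) lmod_scheme \<Rightarrow>
     ('a, 'n::ab_group_add, 'z) lmod_scheme \<Rightarrow> ('m \<Rightarrow> 'n) set" where
  "lmod_hom R M N = {f.
     (\<forall>x\<in>mcar M. f x \<in> mcar N) \<and> (\<forall>x. x \<notin> mcar M \<longrightarrow> f x = 0) \<and>
     (\<forall>x\<in>mcar M. \<forall>y\<in>mcar M. f (x + y) = f x + f y) \<and>
     (\<forall>a\<in>R. \<forall>x\<in>mcar M. f (lact M a x) = lact N a (f x))}"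

definition hker :: "('a, 'm, 'z) lmod_scheme \<Rightarrow> ('m \<Rightarrow> 'n::zero) \<Rightarrow> 'm set" where
  "hker M f = {x \<in> mcar M. f x = 0}"

definition lmod_iso ::
    "'a::{ring,monoid_mult} set \<Rightarrow> ('a, 'm::ab_group_add, 'y) lmod_scheme \<Rightarrow>
     ('a, 'n::ab_group_add, 'z) lmod_scheme \<Rightarrow> bool" where
  "lmod_iso R M N \<longleftrightarrow> (\<exists>f\<in>lmod_hom R M N. bij_betw f (mcar M) (mcar N))"

definition submodule ::
    "'a::{ring,monoid_mult} set \<Rightarrow> ('a, 'm::ab_group_add, 'z) lmod_scheme \<Rightarrow> 'm set \<Rightarrow> bool" where
  "submodule R M N \<longleftrightarrow> N \<subseteq> mcar M \<and> add_subgroup N \<and> (\<forall>a\<in>R. \<forall>x\<in>N. lact M a x \<in> N)"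

definition simple_module ::
    "'a::{ring,monoid_mult} set \<Rightarrow> ('a, 'm::ab_group_add, 'z) lmod_scheme \<Rightarrow> bool" where
  "simple_module R M \<longleftrightarrow> left_module R M \<and> mcar M \<noteq> {0} \<and>
     (\<forall>N. submodule R M N \<longrightarrow> N = {0} \<or> N = mcar M)"

definition short_exact ::
    "'a::{ring,monoid_mult} set \<Rightarrow> ('a, 'x::ab_group_add) lmod \<Rightarrow> ('x \<Rightarrow> 'y) \<Rightarrow>
     ('a, 'y::ab_group_add) lmod \<Rightarrow> ('y \<Rightarrow> 'z) \<Rightarrow> ('a, 'z::ab_group_add) lmod \<Rightarrow> bool" where
  "short_exact R X f Y g Z \<longleftrightarrow> f \<in> lmod_hom R X Y \<and> g \<in> lmod_hom R Y Z \<and>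
     inj_on f (mcar X) \<and> f ` mcar X = hker Y g \<and> g ` mcar Y = mcar Z"

definition projective ::
    "('k::field \<Rightarrow> 'a::{ring,monoid_mult} \<Rightarrow> 'a) \<Rightarrow> 'a set \<Rightarrow> ('a, 'p::ab_group_add) lmod \<Rightarrow> bool" where
  "projective s R P \<longleftrightarrow> fd_module s R P \<and>
     (\<forall>(M :: ('a, nat \<Rightarrow> 'k) lmod) (N :: ('a, nat \<Rightarrow> 'k) lmod) g h.
        fd_module s R M \<and> fd_module s R N \<and> g \<in> lmod_hom R M N \<and> g ` mcar M = mcar N \<and>
        h \<in> lmod_hom R P N \<longrightarrow> (\<exists>h'\<in>lmod_hom R P M. g \<circ> h' = h))"

definition projective_cover ::
    "('k::field \<Rightarrow> 'a::{ring,monoid_mult} \<Rightarrow> 'a) \<Rightarrow> 'a set \<Rightarrow> ('a, 'p::ab_group_add) lmod \<Rightarrow>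
     ('p \<Rightarrow> 'm) \<Rightarrow> ('a, 'm::ab_group_add) lmod \<Rightarrow> bool" where
  "projective_cover s R P p M \<longleftrightarrow> projective s R P \<and> p \<in> lmod_hom R P M \<and> p ` mcar P = mcar M \<and>
     (\<forall>U. submodule R P U \<and> p ` U = mcar M \<longrightarrow> U = mcar P)"

section \<open>Quasi-hereditary algebras\<close>

text \<open>
  \<open>filtered R F J M U N\<close>: there is a chain of submodules of \<open>M\<close> from \<open>U\<close> to \<open>N\<close> whose
  subquotients are isomorphic to modules \<open>F j\<close> with \<open>j \<in> J\<close>.
\<close>

inductive filtered ::
    "'a::{ring,monoid_mult} set \<Rightarrow> ('i \<Rightarrow> ('a, 'n::ab_group_add) lmod) \<Rightarrow> 'i set \<Rightarrow>
     ('a, 'm::ab_group_add) lmod \<Rightarrow> 'm set \<Rightarrow> 'm set \<Rightarrow> bool"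
  for R F J M U where
  start: "submodule R M U \<Longrightarrow> filtered R F J M U U"
| step: "filtered R F J M U N \<Longrightarrow> submodule R M N' \<Longrightarrow> N \<subseteq> N' \<Longrightarrow> j \<in> J \<Longrightarrow>
         g \<in> lmod_hom R (M\<lparr>mcar := N'\<rparr>) (F j) \<Longrightarrow> g ` N' = mcar (F j) \<Longrightarrow>
         {x \<in> N'. g x = 0} = N \<Longrightarrow> filtered R F J M U N'"

definition simples_indexed ::
    "('k::field \<Rightarrow> 'a::{ring,monoid_mult} \<Rightarrow> 'a) \<Rightarrow> 'a set \<Rightarrow> 'i set \<Rightarrow>
     ('i \<Rightarrow> ('a, nat \<Rightarrow> 'k) lmod) \<Rightarrow> bool" where
  "simples_indexed s R I L \<longleftrightarrow> finite I \<and>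
     (\<forall>i\<in>I. fd_module s R (L i) \<and> simple_module R (L i)) \<and>
     (\<forall>i\<in>I. \<forall>j\<in>I. lmod_iso R (L i) (L j) \<longrightarrow> i = j) \<and>
     (\<forall>M :: ('a, nat \<Rightarrow> 'k) lmod. fd_module s R M \<and> simple_module R M \<longrightarrow>
        (\<exists>i\<in>I. lmod_iso R M (L i)))"

text \<open>\<open>p\<close> exhibits \<open>D\<close> as the largest quotient of \<open>P\<close> all of whose composition factors are
  \<open>L j\<close> with \<open>j \<le> i\<close>.\<close>

definition standard_quotient ::
    "'a::{ring,monoid_mult} set \<Rightarrow> 'i::order set \<Rightarrow> ('i \<Rightarrow> ('a, 'n::ab_group_add) lmod) \<Rightarrow> 'i \<Rightarrow>
     ('a, 'm::ab_group_add) lmod \<Rightarrow> ('m \<Rightarrow> 'd) \<Rightarrow> ('a, 'd::ab_group_add) lmod \<Rightarrow> bool" where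
  "standard_quotient R I L i P p D \<longleftrightarrow> p \<in> lmod_hom R P D \<and> p ` mcar P = mcar D \<and>
     filtered R L {j \<in> I. j \<le> i} P (hker P p) (mcar P) \<and>
     (\<forall>U. filtered R L {j \<in> I. j \<le> i} P U (mcar P) \<longrightarrow> hker P p \<subseteq> U)"

text \<open>The simple modules \<open>L i\<close> are indexed by the poset \<open>I\<close>, and \<open>D i\<close> is the standard module
  with top \<open>L i\<close>: it has \<open>L i\<close> as composition factor exactly once, and the kernel of
  \<open>P i \<rightarrow> D i\<close> has a filtration by standard modules \<open>D j\<close> with \<open>i < j\<close>.\<close>

definition quasi_hereditary ::
    "('k::field \<Rightarrow> 'a::{ring,monoid_mult} \<Rightarrow> 'a) \<Rightarrow> 'a set \<Rightarrow> 'i::order set \<Rightarrow>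
     ('i \<Rightarrow> ('a, nat \<Rightarrow> 'k) lmod) \<Rightarrow> ('i \<Rightarrow> ('a, nat \<Rightarrow> 'k) lmod) \<Rightarrow> bool" where
  "quasi_hereditary s R I L D \<longleftrightarrow> simples_indexed s R I L \<and>
     (\<forall>i\<in>I. fd_module s R (D i) \<and>
        (\<exists>q\<in>lmod_hom R (D i) (L i). q ` mcar (D i) = mcar (L i) \<and>
           filtered R L {j \<in> I. j < i} (D i) {0} (hker (D i) q)) \<and>
        (\<exists>(P :: ('a, nat \<Rightarrow> 'k) lmod) c p. projective_cover s R P c (L i) \<and>
           standard_quotient R I L i P p (D i) \<and>
           filtered R D {j \<in> I. i < j} P {0} (hker P p)))"

definition directed_algebra ::
    "('k::field \<Rightarrow> 'a::{ring,monoid_mult} \<Rightarrow> 'a) \<Rightarrow> 'a set \<Rightarrow> 'i::order set \<Rightarrow>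
     ('i \<Rightarrow> ('a, nat \<Rightarrow> 'k) lmod) \<Rightarrow> bool" where
  "directed_algebra s R I L \<longleftrightarrow>
     (\<exists>D. quasi_hereditary s R I L D \<and> (\<forall>i\<in>I. simple_module R (D i)))"

section \<open>Tensor products\<close>

text \<open>
  Let \<open>\<Omega>\<close> be the space of scalar-valued functions on \<open>X\<close> that satisfy some set of linear relations.
  The vector space generated by \<open>X\<close> subject to these relations has \<open>\<Omega>\<close> as its dual space, and over
  a field it embeds into its double dual.  It is therefore realised as the span of the evaluations
  at points of \<open>X\<close>.  (Multiples of generators will again be generators, so sums suffice.)
  Advantage over a quotient of a free module: addition is the pointwise addition of functions.
\<close>

definition ev :: "('x \<Rightarrow> 'k::field) set \<Rightarrow> 'x \<Rightarrow> ('x \<Rightarrow> 'k) \<Rightarrow> 'k" where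
  "ev \<Omega> x = (\<lambda>\<omega>. if \<omega> \<in> \<Omega> then \<omega> x else 0)"

definition ev_span :: "('x \<Rightarrow> 'k::field) set \<Rightarrow> 'x set \<Rightarrow> (('x \<Rightarrow> 'k) \<Rightarrow> 'k) set" where
  "ev_span \<Omega> X = {t. \<exists>xs. set xs \<subseteq> X \<and> t = (\<Sum>x\<leftarrow>xs. ev \<Omega> x)}"

text \<open>The linear extension of a map \<open>\<phi>\<close> from generators to such a space, provided \<open>\<phi>\<close> respects the
  relations.\<close>

definition lin_ext ::
    "('x \<Rightarrow> ('y \<Rightarrow> 'k) \<Rightarrow> 'k) \<Rightarrow> (('x \<Rightarrow> 'k) \<Rightarrow> 'k) \<Rightarrow> ('y \<Rightarrow> 'k) \<Rightarrow> 'k" where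
  "lin_ext \<phi> t = (\<lambda>\<eta>. t (\<lambda>x. \<phi> x \<eta>))"

lemma sum_list_fun_apply: "(\<Sum>x\<leftarrow>xs. f x) \<eta> = (\<Sum>x\<leftarrow>xs. (f x \<eta> :: 'b::comm_monoid_add))"
  by (induction xs) auto

lemma lin_ext_sum_ev:
  assumes "\<And>\<eta>. (\<lambda>x. \<phi> x \<eta>) \<in> \<Omega>"
  shows "lin_ext \<phi> (\<Sum>x\<leftarrow>xs. ev \<Omega> x) = (\<Sum>x\<leftarrow>xs. \<phi> x)"
  using assms by (simp add: fun_eq_iff lin_ext_def sum_list_fun_apply ev_def)

text \<open>Universal property: a map into an arbitrary vector space that respects the relations (tested
  by linear functionals) is well defined on sums of generators.\<close>

lemma ev_universal:
  fixes sc :: "'k::field \<Rightarrow> 'v::ab_group_add \<Rightarrow> 'v" and \<phi> :: "'x \<Rightarrow> 'v"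
  assumes "vector_space sc"
    and rel: "\<And>l. Vector_Spaces.linear sc (*) l \<Longrightarrow> (\<lambda>x. l (\<phi> x)) \<in> \<Omega>"
    and eq: "(\<Sum>x\<leftarrow>xs. ev \<Omega> x) = (\<Sum>y\<leftarrow>ys. ev \<Omega> y)"
  shows "(\<Sum>x\<leftarrow>xs. \<phi> x) = (\<Sum>y\<leftarrow>ys. \<phi> y)"
proof (rule ccontr)
  interpret V: vector_space sc by fact
  interpret VK: vector_space_pair sc "(*) :: 'k \<Rightarrow> 'k \<Rightarrow> 'k"
    by unfold_locales (auto simp: algebra_simps)
  let ?v = "(\<Sum>x\<leftarrow>xs. \<phi> x) - (\<Sum>y\<leftarrow>ys. \<phi> y)"
  assume "(\<Sum>x\<leftarrow>xs. \<phi> x) \<noteq> (\<Sum>y\<leftarrow>ys. \<phi> y)"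
  then have "V.independent {?v}" by simp
  then obtain l where l: "Vector_Spaces.linear sc (*) l" "l ?v = 1"
    using VK.linear_independent_extend[of "{?v}" "\<lambda>_. 1"] by auto
  interpret l: Vector_Spaces.linear sc "(*)" l by (fact l(1))
  have sum: "l (\<Sum>x\<leftarrow>zs. \<phi> x) = (\<Sum>x\<leftarrow>zs. ev \<Omega> x) (\<lambda>x. l (\<phi> x))" for zs
    by (induction zs) (simp_all add: l.zero l.add ev_def rel l)
  have "l ?v = 0" by (simp only: l.diff sum eq) simp
  with l show False by simp
qed

text \<open>\<open>M \<otimes>\<^sub>S N\<close> for a right \<open>S\<close>-module \<open>M\<close> and a left \<open>S\<close>-module \<open>N\<close>.  The left action
  on \<open>M\<close> and the right action on \<open>N\<close>, where present, act on the tensor product.\<close>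

definition tensor_forms ::
    "('k::field \<Rightarrow> 'a::{ring,monoid_mult} \<Rightarrow> 'a) \<Rightarrow> 'a set \<Rightarrow> ('a, 'm::ab_group_add) bimod \<Rightarrow>
     ('a, 'n::ab_group_add, 'z) lmod_scheme \<Rightarrow> ('m \<times> 'n \<Rightarrow> 'k) set" where
  "tensor_forms s S M N = {\<beta>.
     (\<forall>x\<in>mcar M. \<forall>x'\<in>mcar M. \<forall>y\<in>mcar N. \<beta> (x + x', y) = \<beta> (x, y) + \<beta> (x', y)) \<and>
     (\<forall>x\<in>mcar M. \<forall>y\<in>mcar N. \<forall>y'\<in>mcar N. \<beta> (x, y + y') = \<beta> (x, y) + \<beta> (x, y')) \<and>
     (\<forall>r. \<forall>x\<in>mcar M. \<forall>y\<in>mcar N. \<beta> (ract M x (s r 1), y) = r * \<beta> (x, y)) \<and>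
     (\<forall>c\<in>S. \<forall>x\<in>mcar M. \<forall>y\<in>mcar N. \<beta> (ract M x c, y) = \<beta> (x, lact N c y))}"

abbreviation "tensor_gen s S M N \<equiv> ev (tensor_forms s S M N)"

definition tensor_lmod ::
    "('k::field \<Rightarrow> 'a::{ring,monoid_mult} \<Rightarrow> 'a) \<Rightarrow> 'a set \<Rightarrow> ('a, 'm::ab_group_add) bimod \<Rightarrow>
     ('a, 'n::ab_group_add, 'z) lmod_scheme \<Rightarrow> ('a, ('m \<times> 'n \<Rightarrow> 'k) \<Rightarrow> 'k) lmod" where
  "tensor_lmod s S M N =
     \<lparr>mcar = ev_span (tensor_forms s S M N) (mcar M \<times> mcar N),
      lact = \<lambda>a. lin_ext (\<lambda>(x, y). tensor_gen s S M N (lact M a x, y))\<rparr>"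

definition tensor_bimod ::
    "('k::field \<Rightarrow> 'a::{ring,monoid_mult} \<Rightarrow> 'a) \<Rightarrow> 'a set \<Rightarrow> ('a, 'm::ab_group_add) bimod \<Rightarrow>
     ('a, 'n::ab_group_add) bimod \<Rightarrow> ('a, ('m \<times> 'n \<Rightarrow> 'k) \<Rightarrow> 'k) bimod" where
  "tensor_bimod s S M N =
     \<lparr>mcar = ev_span (tensor_forms s S M N) (mcar M \<times> mcar N),
      lact = \<lambda>a. lin_ext (\<lambda>(x, y). tensor_gen s S M N (lact M a x, y)),
      ract = \<lambda>t a. lin_ext (\<lambda>(x, y). tensor_gen s S M N (x, ract N y a)) t\<rparr>"

definition mult_bimod :: "'a::times set \<Rightarrow> ('a, 'a) bimod" where
  "mult_bimod X = \<lparr>mcar = X, lact = (*), ract = (*)\<rparr>"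

section \<open>Homological exact Borel subalgebras\<close>

text \<open>The functor \<open>A \<otimes>\<^sub>B -\<close> on left \<open>B\<close>-modules and on their homomorphisms.\<close>

definition ind ::
    "('k::field \<Rightarrow> 'a::{ring,monoid_mult} \<Rightarrow> 'a) \<Rightarrow> 'a set \<Rightarrow> ('a, 'x::ab_group_add) lmod \<Rightarrow>
     ('a, ('a \<times> 'x \<Rightarrow> 'k) \<Rightarrow> 'k) lmod" where
  "ind s B X = tensor_lmod s B (mult_bimod UNIV) X"

definition ind_map ::
    "('k::field \<Rightarrow> 'a::{ring,monoid_mult} \<Rightarrow> 'a) \<Rightarrow> 'a set \<Rightarrow> ('a, 'x::ab_group_add) lmod \<Rightarrow>
     ('a, 'y::ab_group_add) lmod \<Rightarrow> ('x \<Rightarrow> 'y) \<Rightarrow>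
     (('a \<times> 'x \<Rightarrow> 'k) \<Rightarrow> 'k) \<Rightarrow> ('a \<times> 'y \<Rightarrow> 'k) \<Rightarrow> 'k" where
  "ind_map s B X Y f = (\<lambda>t. if t \<in> mcar (ind s B X)
     then lin_ext (\<lambda>(a, x). tensor_gen s B (mult_bimod UNIV) Y (a, f x)) t else 0)"

definition exact_borel ::
    "('k::field \<Rightarrow> 'a::{ring,monoid_mult} \<Rightarrow> 'a) \<Rightarrow> 'i::order set \<Rightarrow>
     ('i \<Rightarrow> ('a, nat \<Rightarrow> 'k) lmod) \<Rightarrow> 'a set \<Rightarrow> ('i \<Rightarrow> ('a, nat \<Rightarrow> 'k) lmod) \<Rightarrow> bool" where
  "exact_borel s I D B LB \<longleftrightarrow> subalgebra s B \<and> directed_algebra s B I LB \<and>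
     (\<forall>(X :: ('a, nat \<Rightarrow> 'k) lmod) f (Y :: ('a, nat \<Rightarrow> 'k) lmod) g (Z :: ('a, nat \<Rightarrow> 'k) lmod).
        fd_module s B X \<and> fd_module s B Y \<and> fd_module s B Z \<and> short_exact B X f Y g Z \<longrightarrow>
        short_exact UNIV (ind s B X) (ind_map s B X Y f) (ind s B Y) (ind_map s B Y Z g) (ind s B Z)) \<and>
     (\<forall>i\<in>I. lmod_iso UNIV (ind s B (LB i)) (D i))"

definition projective_resolution ::
    "('k::field \<Rightarrow> 'a::{ring,monoid_mult} \<Rightarrow> 'a) \<Rightarrow> 'a set \<Rightarrow> ('a, 'x::ab_group_add) lmod \<Rightarrow>
     (nat \<Rightarrow> ('a, 'p::ab_group_add) lmod) \<Rightarrow> (nat \<Rightarrow> 'p \<Rightarrow> 'p) \<Rightarrow> ('p \<Rightarrow> 'x) \<Rightarrow> bool" where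
  "projective_resolution s R X P d a \<longleftrightarrow>
     (\<forall>n. projective s R (P n) \<and> d n \<in> lmod_hom R (P (Suc n)) (P n)) \<and>
     a \<in> lmod_hom R (P 0) X \<and> a ` mcar (P 0) = mcar X \<and>
     d 0 ` mcar (P 1) = hker (P 0) a \<and>
     (\<forall>n. d (Suc n) ` mcar (P (Suc (Suc n))) = hker (P (Suc n)) (d n))"

text \<open>\<open>Ext\<^sup>n\<^sub>R(X, Y)\<close> as the cohomology of \<open>Hom\<^sub>R(P, Y)\<close>, for a projective resolution \<open>(P, d)\<close>
  of \<open>X\<close>.  Its elements are cosets.\<close>

definition ext_bnd ::
    "'a::{ring,monoid_mult} set \<Rightarrow> (nat \<Rightarrow> ('a, 'p::ab_group_add) lmod) \<Rightarrow> (nat \<Rightarrow> 'p \<Rightarrow> 'p) \<Rightarrow>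
     ('a, 'y::ab_group_add) lmod \<Rightarrow> nat \<Rightarrow> ('p \<Rightarrow> 'y) set" where
  "ext_bnd R P d Y n = (case n of 0 \<Rightarrow> {0} | Suc m \<Rightarrow> (\<lambda>h. h \<circ> d m) ` lmod_hom R (P m) Y)"

definition ext_class ::
    "'a::{ring,monoid_mult} set \<Rightarrow> (nat \<Rightarrow> ('a, 'p::ab_group_add) lmod) \<Rightarrow> (nat \<Rightarrow> 'p \<Rightarrow> 'p) \<Rightarrow>
     ('a, 'y::ab_group_add) lmod \<Rightarrow> nat \<Rightarrow> ('p \<Rightarrow> 'y) \<Rightarrow> ('p \<Rightarrow> 'y) set" where
  "ext_class R P d Y n h = {h + b | b. b \<in> ext_bnd R P d Y n}"

definition Ext ::
    "'a::{ring,monoid_mult} set \<Rightarrow> (nat \<Rightarrow> ('a, 'p::ab_group_add) lmod) \<Rightarrow> (nat \<Rightarrow> 'p \<Rightarrow> 'p) \<Rightarrow>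
     ('a, 'y::ab_group_add) lmod \<Rightarrow> nat \<Rightarrow> ('p \<Rightarrow> 'y) set set" where
  "Ext R P d Y n = ext_class R P d Y n ` {h \<in> lmod_hom R (P n) Y. h \<circ> d n = 0}"

text \<open>When \<open>A \<otimes>\<^sub>B -\<close> is exact, it sends a projective resolution \<open>P\<close> of \<open>X\<close> to a projective
  resolution of \<open>A \<otimes>\<^sub>B X\<close>, which is the one used here to compute Ext over \<open>A\<close>.\<close>

definition ind_res ::
    "('k::field \<Rightarrow> 'a::{ring,monoid_mult} \<Rightarrow> 'a) \<Rightarrow> 'a set \<Rightarrow> (nat \<Rightarrow> ('a, 'p::ab_group_add) lmod) \<Rightarrow>
     nat \<Rightarrow> ('a, ('a \<times> 'p \<Rightarrow> 'k) \<Rightarrow> 'k) lmod" where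
  "ind_res s B P = (\<lambda>n. ind s B (P n))"

definition ind_diff ::
    "('k::field \<Rightarrow> 'a::{ring,monoid_mult} \<Rightarrow> 'a) \<Rightarrow> 'a set \<Rightarrow> (nat \<Rightarrow> ('a, 'p::ab_group_add) lmod) \<Rightarrow>
     (nat \<Rightarrow> 'p \<Rightarrow> 'p) \<Rightarrow> nat \<Rightarrow> (('a \<times> 'p \<Rightarrow> 'k) \<Rightarrow> 'k) \<Rightarrow> ('a \<times> 'p \<Rightarrow> 'k) \<Rightarrow> 'k" where
  "ind_diff s B P d = (\<lambda>n. ind_map s B (P (Suc n)) (P n) (d n))"

definition ext_ind ::
    "('k::field \<Rightarrow> 'a::{ring,monoid_mult} \<Rightarrow> 'a) \<Rightarrow> 'a set \<Rightarrow> (nat \<Rightarrow> ('a, 'p::ab_group_add) lmod) \<Rightarrow>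
     (nat \<Rightarrow> 'p \<Rightarrow> 'p) \<Rightarrow> ('a, 'y::ab_group_add) lmod \<Rightarrow> nat \<Rightarrow> ('p \<Rightarrow> 'y) set \<Rightarrow>
     ((('a \<times> 'p \<Rightarrow> 'k) \<Rightarrow> 'k) \<Rightarrow> ('a \<times> 'y \<Rightarrow> 'k) \<Rightarrow> 'k) set" where
  "ext_ind s B P d Y n K =
     (\<Union>h\<in>K. ext_class UNIV (ind_res s B P) (ind_diff s B P d) (ind s B Y) n (ind_map s B (P n) Y h))"

definition homological ::
    "('k::field \<Rightarrow> 'a::{ring,monoid_mult} \<Rightarrow> 'a) \<Rightarrow> 'a set \<Rightarrow> bool" where
  "homological s B \<longleftrightarrow>
     (\<forall>(X :: ('a, nat \<Rightarrow> 'k) lmod) (Y :: ('a, nat \<Rightarrow> 'k) lmod)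
        (P :: nat \<Rightarrow> ('a, nat \<Rightarrow> 'k) lmod) d a.
        fd_module s B X \<and> fd_module s B Y \<and> projective_resolution s B X P d a \<longrightarrow>
        (\<forall>n\<ge>1. ext_ind s B P d Y n ` Ext B P d Y n =
                 Ext UNIV (ind_res s B P) (ind_diff s B P d) (ind s B Y) n) \<and>
        (\<forall>n\<ge>2. bij_betw (ext_ind s B P d Y n) (Ext B P d Y n)
                 (Ext UNIV (ind_res s B P) (ind_diff s B P d) (ind s B Y) n)))"

section \<open>Bimodules and tensor powers\<close>

definition bimodule ::
    "('k::field \<Rightarrow> 'a::{ring,monoid_mult} \<Rightarrow> 'a) \<Rightarrow> 'a set \<Rightarrow>
     ('a, 'm::ab_group_add, 'z) bimod_scheme \<Rightarrow> bool" where
  "bimodule s B M \<longleftrightarrow> left_module B M \<and>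
     (\<forall>b\<in>B. \<forall>x\<in>mcar M. ract M x b \<in> mcar M) \<and>
     (\<forall>b\<in>B. \<forall>x\<in>mcar M. \<forall>y\<in>mcar M. ract M (x + y) b = ract M x b + ract M y b) \<and>
     (\<forall>b\<in>B. \<forall>c\<in>B. \<forall>x\<in>mcar M. ract M x (b + c) = ract M x b + ract M x c) \<and>
     (\<forall>b\<in>B. \<forall>c\<in>B. \<forall>x\<in>mcar M. ract M x (b * c) = ract M (ract M x b) c) \<and>
     (\<forall>x\<in>mcar M. ract M x 1 = x) \<and>
     (\<forall>b\<in>B. \<forall>c\<in>B. \<forall>x\<in>mcar M. ract M (lact M b x) c = lact M b (ract M x c)) \<and>
     (\<forall>r. \<forall>x\<in>mcar M. lact M (s r 1) x = ract M x (s r 1))"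

definition bimod_hom ::
    "'a::{ring,monoid_mult} set \<Rightarrow> ('a, 'm::ab_group_add, 'y) bimod_scheme \<Rightarrow>
     ('a, 'n::ab_group_add, 'z) bimod_scheme \<Rightarrow> ('m \<Rightarrow> 'n) set" where
  "bimod_hom B M N =
     {f \<in> lmod_hom B M N. \<forall>b\<in>B. \<forall>x\<in>mcar M. f (ract M x b) = ract N (f x) b}"

text \<open>
  The tensor power \<open>M \<otimes>\<^sub>B \<dots> \<otimes>\<^sub>B M\<close> with \<open>n\<close> factors is constructed as
  \<open>B \<otimes>\<^sub>B M \<otimes>\<^sub>B \<dots> \<otimes>\<^sub>B M\<close>, which treats all \<open>n \<ge> 0\<close> uniformly and gives \<open>B\<close> for \<open>n = 0\<close>.
  The generator \<open>(b, [x\<^sub>1, \<dots>, x\<^sub>n])\<close> stands for \<open>b x\<^sub>1 \<otimes> \<dots> \<otimes> x\<^sub>n\<close>.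
\<close>

definition tpow_forms ::
    "('k::field \<Rightarrow> 'a::{ring,monoid_mult} \<Rightarrow> 'a) \<Rightarrow> 'a set \<Rightarrow>
     ('a, 'm::ab_group_add, 'z) bimod_scheme \<Rightarrow> nat \<Rightarrow> ('a \<times> 'm list \<Rightarrow> 'k) set" where
  "tpow_forms s B M n = {\<omega>.
     (\<forall>b\<in>B. \<forall>b'\<in>B. \<forall>xs\<in>lists (mcar M). length xs = n \<longrightarrow>
        \<omega> (b + b', xs) = \<omega> (b, xs) + \<omega> (b', xs)) \<and>
     (\<forall>r. \<forall>b\<in>B. \<forall>xs\<in>lists (mcar M). length xs = n \<longrightarrow> \<omega> (s r b, xs) = r * \<omega> (b, xs)) \<and>
     (\<forall>b\<in>B. \<forall>xs\<in>lists (mcar M). \<forall>x\<in>mcar M. \<forall>x'\<in>mcar M. \<forall>ys\<in>lists (mcar M).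
        length (xs @ x # ys) = n \<longrightarrow>
        \<omega> (b, xs @ (x + x') # ys) = \<omega> (b, xs @ x # ys) + \<omega> (b, xs @ x' # ys)) \<and>
     (\<forall>b\<in>B. \<forall>c\<in>B. \<forall>x\<in>mcar M. \<forall>ys\<in>lists (mcar M).
        length (x # ys) = n \<longrightarrow> \<omega> (b * c, x # ys) = \<omega> (b, lact M c x # ys)) \<and>
     (\<forall>b\<in>B. \<forall>c\<in>B. \<forall>xs\<in>lists (mcar M). \<forall>x\<in>mcar M. \<forall>y\<in>mcar M. \<forall>ys\<in>lists (mcar M).
        length (xs @ x # y # ys) = n \<longrightarrow>
        \<omega> (b, xs @ ract M x c # y # ys) = \<omega> (b, xs @ x # lact M c y # ys))}"

definition tpow_gen ::
    "('k::field \<Rightarrow> 'a::{ring,monoid_mult} \<Rightarrow> 'a) \<Rightarrow> 'a set \<Rightarrow>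
     ('a, 'm::ab_group_add, 'z) bimod_scheme \<Rightarrow> 'a \<times> 'm list \<Rightarrow> ('a \<times> 'm list \<Rightarrow> 'k) \<Rightarrow> 'k" where
  "tpow_gen s B M g = ev (tpow_forms s B M (length (snd g))) g"

fun gen_ract :: "('a::times, 'm, 'z) bimod_scheme \<Rightarrow> 'a \<times> 'm list \<Rightarrow> 'a \<Rightarrow> 'a \<times> 'm list" where
  "gen_ract M (b, []) c = (b * c, [])"
| "gen_ract M (b, x # xs) c = (b, butlast (x # xs) @ [ract M (last (x # xs)) c])"

definition tpow ::
    "('k::field \<Rightarrow> 'a::{ring,monoid_mult} \<Rightarrow> 'a) \<Rightarrow> 'a set \<Rightarrow>
     ('a, 'm::ab_group_add, 'z) bimod_scheme \<Rightarrow> nat \<Rightarrow>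
     ('a, ('a \<times> 'm list \<Rightarrow> 'k) \<Rightarrow> 'k) bimod" where
  "tpow s B M n =
     \<lparr>mcar = ev_span (tpow_forms s B M n) (B \<times> {xs \<in> lists (mcar M). length xs = n}),
      lact = \<lambda>c. lin_ext (\<lambda>(b, xs). tpow_gen s B M (c * b, xs)),
      ract = \<lambda>t c. lin_ext (\<lambda>g. tpow_gen s B M (gen_ract M g c)) t\<rparr>"

text \<open>Concatenation \<open>M\<^sup>\<otimes>\<^sup>m \<times> M\<^sup>\<otimes>\<^sup>n \<rightarrow> M\<^sup>\<otimes>\<^sup>(\<^sup>m\<^sup>+\<^sup>n\<^sup>)\<close> (the multiplication of the tensor algebra).\<close>

definition gen_cat ::
    "('a::times, 'm, 'z) bimod_scheme \<Rightarrow> 'a \<times> 'm list \<Rightarrow> 'a \<times> 'm list \<Rightarrow> 'a \<times> 'm list" where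
  "gen_cat M g h = (fst (gen_ract M g (fst h)), snd (gen_ract M g (fst h)) @ snd h)"

definition tcat ::
    "('k::field \<Rightarrow> 'a::{ring,monoid_mult} \<Rightarrow> 'a) \<Rightarrow> 'a set \<Rightarrow>
     ('a, 'm::ab_group_add, 'z) bimod_scheme \<Rightarrow> (('a \<times> 'm list \<Rightarrow> 'k) \<Rightarrow> 'k) \<Rightarrow>
     (('a \<times> 'm list \<Rightarrow> 'k) \<Rightarrow> 'k) \<Rightarrow> ('a \<times> 'm list \<Rightarrow> 'k) \<Rightarrow> 'k" where
  "tcat s B M t u = lin_ext (\<lambda>g. lin_ext (\<lambda>h. tpow_gen s B M (gen_cat M g h)) u) t"

text \<open>\<open>id\<^sup>\<otimes>\<^sup>p \<otimes> g \<otimes> id\<^sup>\<otimes>\<^sup>q\<close> on tensors with \<open>p + 1 + q\<close> factors, for \<open>g\<close> from \<open>M\<close> to a tensor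
  power of \<open>M\<close>.\<close>

definition apply_at ::
    "('k::field \<Rightarrow> 'a::{ring,monoid_mult} \<Rightarrow> 'a) \<Rightarrow> 'a set \<Rightarrow>
     ('a, 'm::ab_group_add, 'z) bimod_scheme \<Rightarrow> nat \<Rightarrow> ('m \<Rightarrow> ('a \<times> 'm list \<Rightarrow> 'k) \<Rightarrow> 'k) \<Rightarrow>
     (('a \<times> 'm list \<Rightarrow> 'k) \<Rightarrow> 'k) \<Rightarrow> ('a \<times> 'm list \<Rightarrow> 'k) \<Rightarrow> 'k" where
  "apply_at s B M p g = lin_ext (\<lambda>(b, xs).
     tcat s B M (tcat s B M (tpow_gen s B M (b, take p xs)) (g (xs ! p)))
       (tpow_gen s B M (1, drop (Suc p) xs)))"

text \<open>\<open>id\<^sup>\<otimes>\<^sup>p \<otimes> g \<otimes> id\<^sup>\<otimes>\<^sup>q\<close> on tensors with \<open>p + n + q\<close> factors, for \<open>g\<close> from the \<open>n\<close>-th tensor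
  power of \<open>M\<close> to \<open>M\<close>.\<close>

definition coapply_at ::
    "('k::field \<Rightarrow> 'a::{ring,monoid_mult} \<Rightarrow> 'a) \<Rightarrow> 'a set \<Rightarrow>
     ('a, 'm::ab_group_add, 'z) bimod_scheme \<Rightarrow> nat \<Rightarrow> nat \<Rightarrow> ((('a \<times> 'm list \<Rightarrow> 'k) \<Rightarrow> 'k) \<Rightarrow> 'm) \<Rightarrow>
     (('a \<times> 'm list \<Rightarrow> 'k) \<Rightarrow> 'k) \<Rightarrow> ('a \<times> 'm list \<Rightarrow> 'k) \<Rightarrow> 'k" where
  "coapply_at s B M p n g = lin_ext (\<lambda>(b, xs). tpow_gen s B M
     (b, take p xs @ g (tpow_gen s B M (1, take n (drop p xs))) # drop (p + n) xs))"

section \<open>Corings\<close>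

record ('k, 'a, 'c) coring = "('a, 'c) bimod" +
  comult :: "'c \<Rightarrow> ('a \<times> 'c list \<Rightarrow> 'k) \<Rightarrow> 'k"
  counit :: "'c \<Rightarrow> 'a"

text \<open>The counit axioms are stated after identifying \<open>C\<close> with its first tensor power.\<close>

definition is_coring ::
    "('k::field \<Rightarrow> 'a::{ring,monoid_mult} \<Rightarrow> 'a) \<Rightarrow> 'a set \<Rightarrow> ('k, 'a, 'c::ab_group_add) coring \<Rightarrow> bool"
  where
  "is_coring s B C \<longleftrightarrow> bimodule s B C \<and>
     comult C \<in> bimod_hom B C (tpow s B C 2) \<and> counit C \<in> bimod_hom B C (mult_bimod B) \<and>
     (\<forall>c\<in>mcar C. apply_at s B C 0 (comult C) (comult C c) = apply_at s B C 1 (comult C) (comult C c)) \<and>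
     (\<forall>c\<in>mcar C. apply_at s B C 0 (\<lambda>x. tpow_gen s B C (counit C x, [])) (comult C c)
                   = tpow_gen s B C (1, [c])) \<and>
     (\<forall>c\<in>mcar C. apply_at s B C 1 (\<lambda>x. tpow_gen s B C (counit C x, [])) (comult C c)
                   = tpow_gen s B C (1, [c]))"

definition coring_iso ::
    "('k::field \<Rightarrow> 'a::{ring,monoid_mult} \<Rightarrow> 'a) \<Rightarrow> 'a set \<Rightarrow> ('k, 'a, 'c::ab_group_add) coring \<Rightarrow>
     ('k, 'a, 'd::ab_group_add) coring \<Rightarrow> bool" where
  "coring_iso s B C D \<longleftrightarrow> (\<exists>f\<in>bimod_hom B C D. bij_betw f (mcar C) (mcar D) \<and>
     (\<forall>c\<in>mcar C. counit D (f c) = counit C c \<and>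
        comult D (f c) = lin_ext (\<lambda>(b, xs). tpow_gen s B D (b, map f xs)) (comult C c)))"

definition primitive_idempotent :: "'a::{ring,monoid_mult} set \<Rightarrow> 'a \<Rightarrow> bool" where
  "primitive_idempotent B e \<longleftrightarrow> e \<in> B \<and> e * e = e \<and> e \<noteq> 0 \<and>
     (\<forall>f\<in>B. f * f = f \<and> e * f = f \<and> f * e = f \<longrightarrow> f = 0 \<or> f = e)"

definition direct_sum :: "('a, 'm::ab_group_add) bimod list \<Rightarrow> ('a, nat \<Rightarrow> 'm) bimod" where
  "direct_sum Ms =
     \<lparr>mcar = {v. (\<forall>n<length Ms. v n \<in> mcar (Ms ! n)) \<and> (\<forall>n\<ge>length Ms. v n = 0)},
      lact = \<lambda>a v n. if n < length Ms then lact (Ms ! n) a (v n) else 0,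
      ract = \<lambda>v a n. if n < length Ms then ract (Ms ! n) (v n) a else 0\<rparr>"

text \<open>Here \<open>B e\<^sub>j \<otimes>\<^sub>k e\<^sub>i B\<close> is the tensor product over the subalgebra \<open>k 1\<close>, and \<open>e\<^sub>i\<close> is a primitive
  idempotent belonging to \<open>i\<close>, that is, \<open>B e\<^sub>i\<close> is a projective cover of \<open>L\<^sub>B(i)\<close>.\<close>

definition directed_coring ::
    "('k::field \<Rightarrow> 'a::{ring,monoid_mult} \<Rightarrow> 'a) \<Rightarrow> 'a set \<Rightarrow> 'i::order set \<Rightarrow>
     ('i \<Rightarrow> ('a, nat \<Rightarrow> 'k) lmod) \<Rightarrow> ('k, 'a, 'c::ab_group_add) coring \<Rightarrow> bool" where
  "directed_coring s B I LB C \<longleftrightarrow> is_coring s B C \<and> directed_algebra s B I LB \<and>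
     counit C ` mcar C = B \<and>
     (\<exists>e ps. (\<forall>i\<in>I. primitive_idempotent B (e i) \<and> (\<exists>x\<in>mcar (LB i). lact (LB i) (e i) x \<noteq> 0)) \<and>
        (\<forall>(i, j)\<in>set ps. i \<in> I \<and> j \<in> I \<and> i < j) \<and>
        (\<exists>f\<in>bimod_hom B (C\<lparr>mcar := hker C (counit C)\<rparr>)
               (direct_sum (map (\<lambda>(i, j). tensor_bimod s (range (\<lambda>r. s r 1))
                  (mult_bimod ((\<lambda>b. b * e j) ` B)) (mult_bimod ((\<lambda>b. e i * b) ` B))) ps)).
           bij_betw f (hker C (counit C))
             (mcar (direct_sum (map (\<lambda>(i, j). tensor_bimod s (range (\<lambda>r. s r 1))
                  (mult_bimod ((\<lambda>b. b * e j) ` B)) (mult_bimod ((\<lambda>b. e i * b) ` B))) ps)))))"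

text \<open>The right dual coring \<open>Hom\<^sub>-\<^sub>B(A, B)\<close>.\<close>

definition dual_bimod :: "'a::{ring,monoid_mult} set \<Rightarrow> ('a, 'a \<Rightarrow> 'a) bimod" where
  "dual_bimod B =
     \<lparr>mcar = {f. (\<forall>x. f x \<in> B) \<and> (\<forall>x y. f (x + y) = f x + f y) \<and> (\<forall>x. \<forall>b\<in>B. f (x * b) = f x * b)},
      lact = \<lambda>b f x. b * f x,
      ract = \<lambda>f b x. f (b * x)\<rparr>"

definition right_dual_coring ::
    "('k::field \<Rightarrow> 'a::{ring,monoid_mult} \<Rightarrow> 'a) \<Rightarrow> 'a set \<Rightarrow> ('k, 'a, 'a \<Rightarrow> 'a) coring" where
  "right_dual_coring s B =
     \<lparr>mcar = mcar (dual_bimod B), lact = lact (dual_bimod B), ract = ract (dual_bimod B),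
      comult = (\<lambda>f. if f \<in> mcar (dual_bimod B)
        then THE t. \<exists>fs. set fs \<subseteq> mcar (dual_bimod B) \<times> mcar (dual_bimod B) \<and>
               t = (\<Sum>(f1, f2)\<leftarrow>fs. tpow_gen s B (dual_bimod B) (1, [f1, f2])) \<and>
               (\<forall>a a'. f (a * a') = (\<Sum>(f1, f2)\<leftarrow>fs. f1 (f2 a * a')))
        else 0),
      counit = (\<lambda>f. if f \<in> mcar (dual_bimod B) then f 1 else 0)\<rparr>"

section \<open>Gerstenhaber structures from operads with multiplication\<close>

text \<open>Non-symmetric operads of vector spaces, presented by partial compositions:
  \<open>ocomp \<O> m n i f g\<close> is \<open>f \<circ>\<^sub>i g\<close> for \<open>f\<close> of arity \<open>m\<close>, \<open>g\<close> of arity \<open>n\<close> and \<open>i < m\<close>.\<close>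

record ('k, 'f) operad =
  ocar :: "nat \<Rightarrow> 'f set"
  oscale :: "'k \<Rightarrow> 'f \<Rightarrow> 'f"
  ocomp :: "nat \<Rightarrow> nat \<Rightarrow> nat \<Rightarrow> 'f \<Rightarrow> 'f \<Rightarrow> 'f"

definition signed :: "int \<Rightarrow> 'f::ab_group_add \<Rightarrow> 'f" where
  "signed e x = (if even e then x else - x)"

text \<open>\<open>\<gamma>(f; id, \<dots>, g\<^sub>1, \<dots>, g\<^sub>p, \<dots>, id)\<close> with \<open>g\<^sub>l\<close> of arity \<open>n\<^sub>l\<close> in position \<open>i\<^sub>l\<close>, for a list of
  triples \<open>(i\<^sub>l, n\<^sub>l, g\<^sub>l)\<close> with increasing positions.  Grafting the last one first keeps the remaining
  positions unchanged.\<close>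

definition graft :: "('k, 'f) operad \<Rightarrow> nat \<Rightarrow> 'f \<Rightarrow> (nat \<times> nat \<times> 'f) list \<Rightarrow> 'f" where
  "graft \<O> m f gs = snd (foldr (\<lambda>(i, n, g) (a, h). (a + n - 1, ocomp \<O> a n i h g)) gs (m, f))"

text \<open>The brace \<open>f{g\<^sub>1, \<dots>, g\<^sub>p}\<close>.  If \<open>g\<^sub>l\<close> is grafted at position \<open>i\<close> of \<open>f\<close>, then the number of
  inputs of the composite to its left is \<open>i\<close> plus the sum of \<open>n\<^sub>q - 1\<close> over all \<open>q < l\<close>.\<close>

definition brace :: "('k, 'f::ab_group_add) operad \<Rightarrow> nat \<Rightarrow> 'f \<Rightarrow> (nat \<times> 'f) list \<Rightarrow> 'f" where
  "brace \<O> m f gs = (\<Sum>K | K \<subseteq> {..<m} \<and> card K = length gs.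
     signed (\<Sum>l<length gs. (int (fst (gs ! l)) - 1) *
               (int (sorted_list_of_set K ! l) + (\<Sum>q<l. int (fst (gs ! q)) - 1)))
       (graft \<O> m f (zip (sorted_list_of_set K) gs)))"

text \<open>In the bracket of two elements of arity \<open>0\<close> both braces are empty sums, so the truncated degree
  \<open>0 + 0 - 1 = 0\<close> below only ever carries the zero element.\<close>

definition obracket :: "('k, 'f::ab_group_add) operad \<Rightarrow> nat \<Rightarrow> nat \<Rightarrow> 'f \<Rightarrow> 'f \<Rightarrow> 'f" where
  "obracket \<O> m n f g =
     brace \<O> m f [(n, g)] - signed ((int m - 1) * (int n - 1)) (brace \<O> n g [(m, f)])"

definition oproduct :: "('k, 'f::ab_group_add) operad \<Rightarrow> 'f \<Rightarrow> nat \<Rightarrow> nat \<Rightarrow> 'f \<Rightarrow> 'f \<Rightarrow> 'f" where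
  "oproduct \<O> \<mu> m n f g = signed (int m) (brace \<O> 2 \<mu> [(m, f), (n, g)])"

definition odiff :: "('k, 'f::ab_group_add) operad \<Rightarrow> 'f \<Rightarrow> nat \<Rightarrow> 'f \<Rightarrow> 'f" where
  "odiff \<O> \<mu> n f = obracket \<O> 2 n \<mu> f"

definition obnd :: "('k, 'f::ab_group_add) operad \<Rightarrow> 'f \<Rightarrow> nat \<Rightarrow> 'f set" where
  "obnd \<O> \<mu> n = (case n of 0 \<Rightarrow> {0} | Suc m \<Rightarrow> odiff \<O> \<mu> m ` ocar \<O> m)"

definition oclass :: "('k, 'f::ab_group_add) operad \<Rightarrow> 'f \<Rightarrow> nat \<Rightarrow> 'f \<Rightarrow> 'f set" where
  "oclass \<O> \<mu> n f = {f + b | b. b \<in> obnd \<O> \<mu> n}"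

record ('k, 'h) gerstenhaber =
  gcar :: "nat \<Rightarrow> 'h set"
  gadd :: "nat \<Rightarrow> 'h \<Rightarrow> 'h \<Rightarrow> 'h"
  gscale :: "nat \<Rightarrow> 'k \<Rightarrow> 'h \<Rightarrow> 'h"
  gprod :: "nat \<Rightarrow> nat \<Rightarrow> 'h \<Rightarrow> 'h \<Rightarrow> 'h"
  gbracket :: "nat \<Rightarrow> nat \<Rightarrow> 'h \<Rightarrow> 'h \<Rightarrow> 'h"

text \<open>The cohomology with respect to \<open>[\<mu>, -]\<close>, with operations induced on cosets.\<close>

definition operad_cohomology ::
    "('k, 'f::ab_group_add) operad \<Rightarrow> 'f \<Rightarrow> ('k, 'f set) gerstenhaber" where
  "operad_cohomology \<O> \<mu> =
     \<lparr>gcar = \<lambda>n. oclass \<O> \<mu> n ` {f \<in> ocar \<O> n. odiff \<O> \<mu> n f = 0},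
      gadd = \<lambda>n F G. (\<Union>f\<in>F. \<Union>g\<in>G. oclass \<O> \<mu> n (f + g)),
      gscale = \<lambda>n r F. (\<Union>f\<in>F. oclass \<O> \<mu> n (oscale \<O> r f)),
      gprod = \<lambda>m n F G. (\<Union>f\<in>F. \<Union>g\<in>G. oclass \<O> \<mu> (m + n) (oproduct \<O> \<mu> m n f g)),
      gbracket = \<lambda>m n F G. (\<Union>f\<in>F. \<Union>g\<in>G. oclass \<O> \<mu> (m + n - 1) (obracket \<O> m n f g))\<rparr>"

definition gerst_opp :: "('k::field, 'h) gerstenhaber \<Rightarrow> ('k, 'h) gerstenhaber" where
  "gerst_opp G = G\<lparr>gbracket := \<lambda>m n x y. gscale G (m + n - 1) (- 1) (gbracket G m n x y)\<rparr>"

definition gerst_iso :: "('k, 'g) gerstenhaber \<Rightarrow> ('k, 'h) gerstenhaber \<Rightarrow> bool" where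
  "gerst_iso G H \<longleftrightarrow> (\<exists>\<Phi>.
     (\<forall>n. bij_betw (\<Phi> n) (gcar G n) (gcar H n)) \<and>
     (\<forall>n. \<forall>x\<in>gcar G n. \<forall>y\<in>gcar G n. \<Phi> n (gadd G n x y) = gadd H n (\<Phi> n x) (\<Phi> n y)) \<and>
     (\<forall>n r. \<forall>x\<in>gcar G n. \<Phi> n (gscale G n r x) = gscale H n r (\<Phi> n x)) \<and>
     (\<forall>m n. \<forall>x\<in>gcar G m. \<forall>y\<in>gcar G n.
        \<Phi> (m + n) (gprod G m n x y) = gprod H m n (\<Phi> m x) (\<Phi> n y)) \<and>
     (\<forall>m n. \<forall>x\<in>gcar G m. \<forall>y\<in>gcar G n.
        \<Phi> (m + n - 1) (gbracket G m n x y) = gbracket H m n (\<Phi> m x) (\<Phi> n y)))"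

section \<open>Cartier cohomology and relative Hochschild cohomology\<close>

definition cartier_operad ::
    "('k::field \<Rightarrow> 'a::{ring,monoid_mult} \<Rightarrow> 'a) \<Rightarrow> 'a set \<Rightarrow> ('k, 'a, 'c::ab_group_add) coring \<Rightarrow>
     ('k, 'c \<Rightarrow> ('a \<times> 'c list \<Rightarrow> 'k) \<Rightarrow> 'k) operad" where
  "cartier_operad s B C =
     \<lparr>ocar = \<lambda>n. bimod_hom B C (tpow s B C n),
      oscale = \<lambda>r f c \<omega>. r * f c \<omega>,
      ocomp = \<lambda>m n i f g c. apply_at s B C (m - i - 1) g (f c)\<rparr>"

definition cartier_cohomology ::
    "('k::field \<Rightarrow> 'a::{ring,monoid_mult} \<Rightarrow> 'a) \<Rightarrow> 'a set \<Rightarrow> ('k, 'a, 'c::ab_group_add) coring \<Rightarrow>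
     ('k, ('c \<Rightarrow> ('a \<times> 'c list \<Rightarrow> 'k) \<Rightarrow> 'k) set) gerstenhaber" where
  "cartier_cohomology s B C = operad_cohomology (cartier_operad s B C) (comult C)"

definition hochschild_operad ::
    "('k::field \<Rightarrow> 'a::{ring,monoid_mult} \<Rightarrow> 'a) \<Rightarrow> 'a set \<Rightarrow>
     ('k, (('a \<times> 'a list \<Rightarrow> 'k) \<Rightarrow> 'k) \<Rightarrow> 'a) operad" where
  "hochschild_operad s B =
     \<lparr>ocar = \<lambda>n. bimod_hom B (tpow s B (mult_bimod UNIV) n) (mult_bimod UNIV),
      oscale = \<lambda>r f t. s r (f t),
      ocomp = \<lambda>m n i f g t. if t \<in> mcar (tpow s B (mult_bimod UNIV) (m + n - 1))
        then f (coapply_at s B (mult_bimod UNIV) i n g t) else 0\<rparr>"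

definition mult_cochain ::
    "('k::field \<Rightarrow> 'a::{ring,monoid_mult} \<Rightarrow> 'a) \<Rightarrow> 'a set \<Rightarrow> (('a \<times> 'a list \<Rightarrow> 'k) \<Rightarrow> 'k) \<Rightarrow> 'a" where
  "mult_cochain s B = (THE m. m \<in> bimod_hom B (tpow s B (mult_bimod UNIV) 2) (mult_bimod UNIV) \<and>
     (\<forall>x y. m (tpow_gen s B (mult_bimod UNIV) (1, [x, y])) = x * y))"

definition rel_hochschild_cohomology ::
    "('k::field \<Rightarrow> 'a::{ring,monoid_mult} \<Rightarrow> 'a) \<Rightarrow> 'a set \<Rightarrow>
     ('k, ((('a \<times> 'a list \<Rightarrow> 'k) \<Rightarrow> 'k) \<Rightarrow> 'a) set) gerstenhaber" where
  "rel_hochschild_cohomology s B = operad_cohomology (hochschild_operad s B) (mult_cochain s B)"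

end

theory Submission
  imports Defs "HOL-Library.Nat_Bijection"
begin

text \<open>
  The isomorphism is transposition. Write \<open>\<langle>c, a\<rangle>\<close> for the value at \<open>a \<in> A\<close> of an element \<open>c\<close> of
  the coring \<open>C = Hom\<^sub>-\<^sub>B(A, B)\<close>. Exactness of \<open>A \<otimes>\<^sub>B -\<close> makes \<open>A\<close> a flat right \<open>B\<close>-module, and a
  finite-dimensional flat module is projective. So there are finitely many \<open>d\<^sub>i \<in> A\<close> and \<open>c\<^sub>i \<in> C\<close>
  such that every \<open>a\<close> is the sum of the \<open>d\<^sub>i \<langle>c\<^sub>i, a\<rangle>\<close> (\<open>dual_basis_exists\<close>).

  Iterating the pairing, \<open>\<langle>c\<^sub>1 \<otimes> \<dots> \<otimes> c\<^sub>n, a\<^sub>1 \<otimes> \<dots> \<otimes> a\<^sub>n\<rangle> = \<langle>c\<^sub>1, \<langle>c\<^sub>2, \<dots> \<langle>c\<^sub>n, a\<^sub>1\<rangle> a\<^sub>2 \<dots>\<rangle> a\<^sub>n\<rangle>\<close>, identifies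
  the \<open>n\<close>-th tensor power of \<open>C\<close> with the right dual of the \<open>n\<close>-th tensor power of \<open>A\<close>: dual bases
  expand any tensor on either side in terms of its pairings (\<open>cpow_expansion\<close>, \<open>apow_expansion\<close>).
  Hence the rule \<open>\<langle>f c, t\<rangle> = \<langle>c, h t\<rangle>\<close> sets up a bijection between bimodule maps \<open>f\<close> from \<open>C\<close> to
  its \<open>n\<close>-th tensor power and bimodule maps \<open>h\<close> from the \<open>n\<close>-th tensor power of \<open>A\<close> to \<open>A\<close>
  (\<open>hochschild_of_bij\<close>).

  The pairing reverses the order of the factors. Therefore applying a cochain in the factor
  \<open>m - i - 1\<close> on the side of \<open>C\<close> is transposed to inserting its transpose at position \<open>i\<close> on the
  side of \<open>A\<close> (\<open>hochschild_of_comp\<close>), and the formula that defines the comultiplication says that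
  it is transposed to the multiplication of \<open>A\<close> (\<open>right_dual_comult\<close>, \<open>hochschild_of_comult\<close>). So
  the two operads with multiplication are isomorphic. The passage to the opposite Gerstenhaber
  algebra is absorbed by the sign \<open>(-1)\<^sup>n\<close> in degree \<open>n\<close>, which respects the product and reverses
  the bracket (\<open>cohomology_iso_opposite\<close>).

  Maps out of tensor powers are given on generators and have to respect the tensor relations.
  Since pairings separate tensors, the relations need only be checked after pairing
  (\<open>multibalanced_separated\<close>), where they are identities in \<open>A\<close>.
\<close>

section \<open>Operads with multiplication and the sign twist\<close>

lemma signed_0 [simp]: "signed e 0 = 0"
  by (simp add: signed_def)

lemma signed_add: "signed e (x + y) = signed e x + signed e y"
  by (simp add: signed_def)

lemma signed_sum: "signed e (\<Sum>i\<in>S. f i) = (\<Sum>i\<in>S. signed e (f i))"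
  by (simp add: signed_def sum_negf)

lemma signed_diff: "signed e (x - y) = signed e x - signed e y"
  by (simp add: signed_def)

lemma signed_signed: "signed d (signed e x) = signed (d + e) x"
  by (simp add: signed_def)

lemma signed_mem: "add_subgroup N \<Longrightarrow> x \<in> N \<Longrightarrow> signed e x \<in> N"
  by (simp add: signed_def add_subgroup_def)

lemma signed_image: "add_subgroup N \<Longrightarrow> signed e ` N = N"
proof -
  assume N: "add_subgroup N"
  have "x \<in> signed e ` N" if "x \<in> N" for x
    using that signed_mem[OF N that, of e]
    by (intro image_eqI[of _ _ "signed e x"]) (simp_all add: signed_def)
  with N show ?thesis by (auto simp: signed_mem)
qed

lemma add_subgroup_diff: "add_subgroup N \<Longrightarrow> x \<in> N \<Longrightarrow> y \<in> N \<Longrightarrow> x - y \<in> N"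
  unfolding add_subgroup_def by (metis add_uminus_conv_diff)

lemma add_subgroup_sum: "add_subgroup N \<Longrightarrow> (\<And>i. i \<in> S \<Longrightarrow> f i \<in> N) \<Longrightarrow> (\<Sum>i\<in>S. f i) \<in> N"
  by (induction S rule: infinite_finite_induct) (auto simp: add_subgroup_def)

text \<open>Only braces with one or two entries enter the bracket and the product; both are made
  explicit in terms of partial compositions.\<close>

lemma brace1:
  "brace \<O> m f [(n, g)] =
     (\<Sum>i<m. signed ((int n - 1) * int i) (ocomp \<O> m n i f g))"
proof -
  have "{K. K \<subseteq> {..<m} \<and> card K = Suc 0} = (\<lambda>i. {i}) ` {..<m}"
    by (auto simp: card_Suc_eq)
  then have "brace \<O> m f [(n, g)] = (\<Sum>K\<in>(\<lambda>i. {i}) ` {..<m}.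
      signed ((int n - 1) * int (sorted_list_of_set K ! 0))
        (graft \<O> m f (zip (sorted_list_of_set K) [(n, g)])))"
    by (simp add: brace_def)
  also have "\<dots> = (\<Sum>i<m. signed ((int n - 1) * int i) (ocomp \<O> m n i f g))"
    by (subst sum.reindex) (auto simp: graft_def)
  finally show ?thesis .
qed

lemma brace2:
  "brace \<O> 2 f [(m, g), (n, h)] =
     signed (int n - 1 + (int m - 1) * (int n - 1)) (ocomp \<O> (n + 1) m 0 (ocomp \<O> 2 n 1 f h) g)"
proof -
  have "K = {0, 1}" if "K \<subseteq> {..<2}" "card K = 2" for K :: "nat set"
    using that by (intro card_subset_eq[of "{0, 1}" K]) (auto simp: lessThan_nat_numeral)
  then have "{K. K \<subseteq> {..<2} \<and> card K = 2} = {{0, 1 :: nat}}"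
    by auto
  moreover have "sorted_list_of_set {0, 1 :: nat} = [0, 1]"
    by simp
  ultimately show ?thesis
    by (simp add: brace_def graft_def numeral_2_eq_2 algebra_simps)
qed

text \<open>The operations on cohomology are unions of cosets over all representatives. An isomorphism
  of operads therefore transports them representative by representative, once all representatives
  and all values stay inside the carriers; the assumptions below guarantee this.\<close>

locale operad_with_mult =
  fixes \<O> :: "('k::field, 'f::ab_group_add) operad" and \<mu> :: 'f
  assumes car: "add_subgroup (ocar \<O> n)"
    and scale_mem: "f \<in> ocar \<O> n \<Longrightarrow> oscale \<O> r f \<in> ocar \<O> n"
    and comp_mem: "f \<in> ocar \<O> m \<Longrightarrow> g \<in> ocar \<O> n \<Longrightarrow> i < m \<Longrightarrow>
        ocomp \<O> m n i f g \<in> ocar \<O> (m + n - 1)"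
    and comp_add_left: "f \<in> ocar \<O> m \<Longrightarrow> f' \<in> ocar \<O> m \<Longrightarrow> g \<in> ocar \<O> n \<Longrightarrow> i < m \<Longrightarrow>
        ocomp \<O> m n i (f + f') g = ocomp \<O> m n i f g + ocomp \<O> m n i f' g"
    and comp_add_right: "f \<in> ocar \<O> m \<Longrightarrow> g \<in> ocar \<O> n \<Longrightarrow> g' \<in> ocar \<O> n \<Longrightarrow> i < m \<Longrightarrow>
        ocomp \<O> m n i f (g + g') = ocomp \<O> m n i f g + ocomp \<O> m n i f g'"
    and mult_mem: "\<mu> \<in> ocar \<O> 2"
    and scale_neg: "f \<in> ocar \<O> n \<Longrightarrow> oscale \<O> r (- f) = - oscale \<O> r f"
    and scale_minus_one: "f \<in> ocar \<O> n \<Longrightarrow> oscale \<O> (- 1) f = - f"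
begin

lemma brace1_mem: "f \<in> ocar \<O> m \<Longrightarrow> g \<in> ocar \<O> n \<Longrightarrow> brace \<O> m f [(n, g)] \<in> ocar \<O> (m + n - 1)"
  unfolding brace1 using comp_mem[of f m g n] by (intro add_subgroup_sum signed_mem car) simp

lemma obracket_mem:
  "f \<in> ocar \<O> m \<Longrightarrow> g \<in> ocar \<O> n \<Longrightarrow> obracket \<O> m n f g \<in> ocar \<O> (m + n - 1)"
  unfolding obracket_def
  using brace1_mem[of f m g n] brace1_mem[of g n f m]
  by (intro add_subgroup_diff signed_mem car) (simp_all add: add.commute)

lemma odiff_mem: "f \<in> ocar \<O> n \<Longrightarrow> odiff \<O> \<mu> n f \<in> ocar \<O> (Suc n)"
  using obracket_mem[OF mult_mem, of f n] by (simp add: odiff_def)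

lemma odiff_add:
  "f \<in> ocar \<O> n \<Longrightarrow> g \<in> ocar \<O> n \<Longrightarrow> odiff \<O> \<mu> n (f + g) = odiff \<O> \<mu> n f + odiff \<O> \<mu> n g"
  by (simp add: odiff_def obracket_def brace1 comp_add_left comp_add_right mult_mem signed_add
      sum.distrib)

lemma oproduct_mem:
  assumes "f \<in> ocar \<O> m" "g \<in> ocar \<O> n"
  shows "oproduct \<O> \<mu> m n f g \<in> ocar \<O> (m + n)"
proof -
  have 1: "ocomp \<O> 2 n 1 \<mu> g \<in> ocar \<O> (n + 1)"
    using comp_mem[OF mult_mem assms(2), of 1] by simp
  have "ocomp \<O> (n + 1) m 0 (ocomp \<O> 2 n 1 \<mu> g) f \<in> ocar \<O> (m + n)"
    using comp_mem[OF 1 assms(1), of 0] by (simp add: add.commute)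
  then show ?thesis
    by (simp only: oproduct_def brace2 signed_signed signed_mem[OF car])
qed

lemma odiff_neg: "f \<in> ocar \<O> n \<Longrightarrow> odiff \<O> \<mu> n (- f) = - odiff \<O> \<mu> n f"
proof -
  assume f: "f \<in> ocar \<O> n"
  then have nf: "- f \<in> ocar \<O> n" using car[of n] by (simp add: add_subgroup_def)
  have 0: "0 \<in> ocar \<O> n" using car[of n] by (simp add: add_subgroup_def)
  have "odiff \<O> \<mu> n (0 + 0) = odiff \<O> \<mu> n 0 + odiff \<O> \<mu> n 0" using odiff_add[OF 0 0] .
  then have "odiff \<O> \<mu> n 0 = 0" by simp
  then show ?thesis using odiff_add[OF f nf] by (simp add: eq_neg_iff_add_eq_0 add.commute)
qed

lemma obnd_subset: "obnd \<O> \<mu> n \<subseteq> ocar \<O> n"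
  using car[of 0] by (auto simp: obnd_def add_subgroup_def odiff_mem split: nat.split)

lemma obnd_subgroup: "add_subgroup (obnd \<O> \<mu> n)"
proof (cases n)
  case 0
  then show ?thesis by (simp add: obnd_def add_subgroup_def)
next
  case (Suc m)
  have "add_subgroup (odiff \<O> \<mu> m ` ocar \<O> m)"
    unfolding add_subgroup_def
  proof (intro conjI ballI)
    have "odiff \<O> \<mu> m 0 = 0"
      using odiff_add[of 0 m 0] car[of m] by (simp add: add_subgroup_def)
    then show "0 \<in> odiff \<O> \<mu> m ` ocar \<O> m"
      using car[of m] by (metis add_subgroup_def image_eqI)
  next
    fix x y assume "x \<in> odiff \<O> \<mu> m ` ocar \<O> m" "y \<in> odiff \<O> \<mu> m ` ocar \<O> m"
    then obtain f g where f: "f \<in> ocar \<O> m" "x = odiff \<O> \<mu> m f" and g: "g \<in> ocar \<O> m"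
        "y = odiff \<O> \<mu> m g"
      by blast
    then have "x + y = odiff \<O> \<mu> m (f + g)" "f + g \<in> ocar \<O> m"
      using car[of m] by (simp_all add: odiff_add add_subgroup_def)
    then show "x + y \<in> odiff \<O> \<mu> m ` ocar \<O> m" by blast
  next
    fix x assume "x \<in> odiff \<O> \<mu> m ` ocar \<O> m"
    then obtain f where f: "f \<in> ocar \<O> m" "x = odiff \<O> \<mu> m f" by blast
    then have "- x = odiff \<O> \<mu> m (- f)" "- f \<in> ocar \<O> m"
      using car[of m] by (simp_all add: odiff_neg add_subgroup_def)
    then show "- x \<in> odiff \<O> \<mu> m ` ocar \<O> m" by blast
  qed
  with Suc show ?thesis by (simp add: obnd_def)
qed

lemma oclass_subset: "f \<in> ocar \<O> n \<Longrightarrow> oclass \<O> \<mu> n f \<subseteq> ocar \<O> n"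
  using obnd_subset[of n] car[of n] by (auto simp: oclass_def add_subgroup_def)

lemma cocycle_class_subset: "F \<in> gcar (operad_cohomology \<O> \<mu>) n \<Longrightarrow> F \<subseteq> ocar \<O> n"
  using oclass_subset by (auto simp: operad_cohomology_def)

lemma comp_signed_left:
  assumes "f \<in> ocar \<O> m" "g \<in> ocar \<O> n" "i < m"
  shows "ocomp \<O> m n i (signed e f) g = signed e (ocomp \<O> m n i f g)"
proof -
  have f: "0 \<in> ocar \<O> m" "- f \<in> ocar \<O> m"
    using car[of m] assms(1) by (simp_all add: add_subgroup_def)
  have "ocomp \<O> m n i 0 g = 0"
    using comp_add_left[OF f(1) f(1) assms(2,3)] by simp
  then have "ocomp \<O> m n i (- f) g = - ocomp \<O> m n i f g"
    using comp_add_left[OF assms(1) f(2) assms(2,3)] by (simp add: eq_neg_iff_add_eq_0 add.commute)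
  then show ?thesis by (simp add: signed_def)
qed

lemma comp_signed_right:
  assumes "f \<in> ocar \<O> m" "g \<in> ocar \<O> n" "i < m"
  shows "ocomp \<O> m n i f (signed e g) = signed e (ocomp \<O> m n i f g)"
proof -
  have g: "0 \<in> ocar \<O> n" "- g \<in> ocar \<O> n"
    using car[of n] assms(2) by (simp_all add: add_subgroup_def)
  have "ocomp \<O> m n i f 0 = 0"
    using comp_add_right[OF assms(1) g(1) g(1) assms(3)] by simp
  then have "ocomp \<O> m n i f (- g) = - ocomp \<O> m n i f g"
    using comp_add_right[OF assms(1) assms(2) g(2) assms(3)]
    by (simp add: eq_neg_iff_add_eq_0 add.commute)
  then show ?thesis by (simp add: signed_def)
qed

lemma brace1_signed:
  assumes "f \<in> ocar \<O> m" "g \<in> ocar \<O> n"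
  shows "brace \<O> m (signed d f) [(n, signed e g)] = signed (d + e) (brace \<O> m f [(n, g)])"
  unfolding brace1
  by (simp add: comp_signed_left comp_signed_right assms signed_mem[OF car] signed_sum
      signed_signed algebra_simps)

lemma obracket_signed:
  assumes "f \<in> ocar \<O> m" "g \<in> ocar \<O> n"
  shows "obracket \<O> m n (signed d f) (signed e g) = signed (d + e) (obracket \<O> m n f g)"
  using assms
  by (simp add: obracket_def brace1_signed signed_diff signed_signed algebra_simps)

lemma inner_mem: "g \<in> ocar \<O> n \<Longrightarrow> ocomp \<O> 2 n 1 \<mu> g \<in> ocar \<O> (n + 1)"
  using comp_mem[OF mult_mem, of g n 1] by simp

lemma oproduct_signed:
  assumes "f \<in> ocar \<O> m" "g \<in> ocar \<O> n"
  shows "oproduct \<O> \<mu> m n (signed d f) (signed e g) = signed (d + e) (oproduct \<O> \<mu> m n f g)"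
proof -
  note inner = inner_mem[OF assms(2)]
  show ?thesis
    unfolding oproduct_def brace2
    by (subst comp_signed_right[OF mult_mem assms(2)], simp,
        subst comp_signed_left[OF inner signed_mem[OF car assms(1)]], simp,
        subst comp_signed_right[OF inner assms(1)], simp)
      (simp add: signed_signed algebra_simps)
qed

end

text \<open>The closure properties of the target are carried over from the source along the isomorphism
  \<open>\<phi>\<close>.\<close>

locale operad_with_mult_iso = operad_with_mult \<O> \<mu>
  for \<O> :: "('k::field, 'f::ab_group_add) operad" and \<mu> +
  fixes \<P> :: "('k, 'g::ab_group_add) operad" and \<phi> :: "nat \<Rightarrow> 'f \<Rightarrow> 'g" and \<nu> :: 'g
  assumes bij: "bij_betw (\<phi> n) (ocar \<O> n) (ocar \<P> n)"
    and phi_add: "f \<in> ocar \<O> n \<Longrightarrow> g \<in> ocar \<O> n \<Longrightarrow> \<phi> n (f + g) = \<phi> n f + \<phi> n g"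
    and phi_scale: "f \<in> ocar \<O> n \<Longrightarrow> \<phi> n (oscale \<O> r f) = oscale \<P> r (\<phi> n f)"
    and phi_comp: "f \<in> ocar \<O> m \<Longrightarrow> g \<in> ocar \<O> n \<Longrightarrow> i < m \<Longrightarrow>
        \<phi> (m + n - 1) (ocomp \<O> m n i f g) = ocomp \<P> m n i (\<phi> m f) (\<phi> n g)"
    and phi_mult: "\<phi> 2 \<mu> = \<nu>"
begin

lemma phi_0: "\<phi> n 0 = 0"
  using phi_add[of 0 n 0] car[of n] by (simp add: add_subgroup_def)

lemma phi_neg: "f \<in> ocar \<O> n \<Longrightarrow> \<phi> n (- f) = - \<phi> n f"
  using phi_add[of f n "- f"] car[of n]
  by (simp add: add_subgroup_def phi_0 eq_neg_iff_add_eq_0 add.commute)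

lemma phi_signed: "f \<in> ocar \<O> n \<Longrightarrow> \<phi> n (signed e f) = signed e (\<phi> n f)"
  by (simp add: signed_def phi_neg)

lemma phi_sum:
  "(\<And>i. i \<in> S \<Longrightarrow> f i \<in> ocar \<O> n) \<Longrightarrow> \<phi> n (\<Sum>i\<in>S. f i) = (\<Sum>i\<in>S. \<phi> n (f i))"
  by (induction S rule: infinite_finite_induct)
    (simp_all add: phi_0 phi_add add_subgroup_sum[OF car])

lemma phi_diff: "f \<in> ocar \<O> n \<Longrightarrow> g \<in> ocar \<O> n \<Longrightarrow> \<phi> n (f - g) = \<phi> n f - \<phi> n g"
  using phi_add[of f n "- g"] car[of n] by (simp add: phi_neg add_subgroup_def)

lemma phi_brace1:
  assumes "f \<in> ocar \<O> m" "g \<in> ocar \<O> n"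
  shows "\<phi> (m + n - 1) (brace \<O> m f [(n, g)]) = brace \<P> m (\<phi> m f) [(n, \<phi> n g)]"
proof -
  have "signed ((int n - 1) * int i) (ocomp \<O> m n i f g) \<in> ocar \<O> (m + n - 1)" if "i < m" for i
    using that assms by (intro signed_mem car comp_mem)
  then show ?thesis
    using assms comp_mem[OF assms] phi_comp[OF assms] phi_signed
    unfolding brace1 by (subst phi_sum) (auto intro!: sum.cong)
qed

lemma phi_obracket:
  assumes f: "f \<in> ocar \<O> m" and g: "g \<in> ocar \<O> n"
  shows "\<phi> (m + n - 1) (obracket \<O> m n f g) = obracket \<P> m n (\<phi> m f) (\<phi> n g)"
proof -
  have eq: "n + m - 1 = m + n - 1" by simp
  note gf = brace1_mem[OF g f, unfolded eq]
  show ?thesis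
    unfolding obracket_def
    using phi_brace1[OF f g] phi_brace1[OF g f, unfolded eq]
    by (simp only: phi_diff[OF brace1_mem[OF f g] signed_mem[OF car gf]] phi_signed[OF gf])
qed

lemma phi_oproduct:
  assumes f: "f \<in> ocar \<O> m" and g: "g \<in> ocar \<O> n"
  shows "\<phi> (m + n) (oproduct \<O> \<mu> m n f g) = oproduct \<P> \<nu> m n (\<phi> m f) (\<phi> n g)"
proof -
  have "ocomp \<O> (n + 1) m 0 (ocomp \<O> 2 n 1 \<mu> g) f \<in> ocar \<O> (m + n)"
    using comp_mem[OF inner_mem[OF g] f, of 0] by (simp add: add.commute)
  moreover have "\<phi> (m + n) (ocomp \<O> (n + 1) m 0 (ocomp \<O> 2 n 1 \<mu> g) f)
      = ocomp \<P> (n + 1) m 0 (ocomp \<P> 2 n 1 \<nu> (\<phi> n g)) (\<phi> m f)"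
    using phi_comp[OF inner_mem[OF g] f, of 0] phi_comp[OF mult_mem g, of 1]
    by (simp add: add.commute phi_mult)
  ultimately show ?thesis
    unfolding oproduct_def brace2 by (simp add: phi_signed signed_signed)
qed

text \<open>The product adds degrees, so the sign \<open>(-1)\<^sup>n\<close> in degree \<open>n\<close> is compatible with it. The
  bracket lowers the total degree by one, so the same sign reverses the bracket. This is how an
  isomorphism of operads gives an isomorphism onto the opposite Gerstenhaber algebra.\<close>

definition twist :: "nat \<Rightarrow> 'f \<Rightarrow> 'g" where
  "twist n f = \<phi> n (signed (int n) f)"

lemma twist_bij: "bij_betw (twist n) (ocar \<O> n) (ocar \<P> n)"
proof -
  have "bij_betw (signed (int n)) (ocar \<O> n) (ocar \<O> n)"
    unfolding bij_betw_def signed_image[OF car]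
    by (auto simp: inj_on_def signed_def split: if_splits)
  from bij_betw_trans[OF this bij] show ?thesis
    by (simp add: twist_def[abs_def] comp_def)
qed

lemma twist_add: "f \<in> ocar \<O> n \<Longrightarrow> g \<in> ocar \<O> n \<Longrightarrow> twist n (f + g) = twist n f + twist n g"
  by (simp add: twist_def signed_add phi_add signed_mem[OF car])

lemma twist_neg: "f \<in> ocar \<O> n \<Longrightarrow> twist n (- f) = - twist n f"
  by (simp add: twist_def phi_signed phi_neg signed_mem[OF car] signed_def)

lemma twist_eq: "f \<in> ocar \<O> n \<Longrightarrow> twist n f = signed (int n) (\<phi> n f)"
  by (simp add: twist_def phi_signed)

lemma twist_scale: "f \<in> ocar \<O> n \<Longrightarrow> twist n (oscale \<O> r f) = oscale \<P> r (twist n f)"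
  using car[of n] scale_neg[of f n r] phi_scale[of "- f" n r] phi_scale[of f n r]
  by (simp add: twist_def signed_def add_subgroup_def)

lemma twist_oproduct:
  "f \<in> ocar \<O> m \<Longrightarrow> g \<in> ocar \<O> n \<Longrightarrow>
     twist (m + n) (oproduct \<O> \<mu> m n f g) = oproduct \<P> \<nu> m n (twist m f) (twist n g)"
  by (simp add: twist_def phi_oproduct[symmetric] signed_mem[OF car] oproduct_signed)

lemma twist_obracket:
  assumes f: "f \<in> ocar \<O> m" and g: "g \<in> ocar \<O> n"
  shows "twist (m + n - 1) (obracket \<O> m n f g) = - obracket \<P> m n (twist m f) (twist n g)"
proof (cases "m + n = 0")
  case True
  \<comment> \<open>In total degree \<open>0\<close> the degree of the bracket is truncated and its sign is wrong, but both
    sides are empty sums.\<close>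
  then show ?thesis by (simp add: obracket_def brace1 twist_def phi_0)
next
  case False
  have "signed (int (m + n - 1)) x = - signed (int m + int n) x" for x :: 'g
    using False by (cases "m + n") (simp_all add: signed_def flip: of_nat_add)
  then have "twist (m + n - 1) (obracket \<O> m n f g)
      = - \<phi> (m + n - 1) (signed (int m + int n) (obracket \<O> m n f g))"
    using obracket_mem[OF f g] by (simp only: twist_eq phi_signed)
  also have "\<dots> = - obracket \<P> m n (twist m f) (twist n g)"
    unfolding obracket_signed[OF f g, symmetric] twist_def
      phi_obracket[OF signed_mem[OF car f] signed_mem[OF car g]] ..
  finally show ?thesis .
qed

lemma twist_mult: "twist 2 \<mu> = \<nu>"
  by (simp add: twist_def signed_def phi_mult)

lemma twist_odiff: "f \<in> ocar \<O> n \<Longrightarrow> twist (Suc n) (odiff \<O> \<mu> n f) = - odiff \<P> \<nu> n (twist n f)"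
  using twist_obracket[OF mult_mem, of f n] by (simp add: odiff_def twist_mult)

lemma twist_0: "twist n 0 = 0"
  by (simp add: twist_def phi_0)

lemma twist_obnd: "twist n ` obnd \<O> \<mu> n = obnd \<P> \<nu> n"
proof (cases n)
  case 0
  then show ?thesis by (simp add: obnd_def twist_0)
next
  case (Suc m)
  have "twist n ` odiff \<O> \<mu> m ` ocar \<O> m = twist n ` odiff \<O> \<mu> m ` uminus ` ocar \<O> m"
    using signed_image[OF car, of 1 m] by (simp add: signed_def image_image)
  also have "\<dots> = (\<lambda>f. odiff \<P> \<nu> m (twist m f)) ` ocar \<O> m"
    using Suc car[of m]
    by (auto simp: image_image odiff_neg twist_neg odiff_mem twist_odiff intro!: image_cong)
  also have "\<dots> = odiff \<P> \<nu> m ` ocar \<P> m"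
    using bij_betw_imp_surj_on[OF twist_bij, of m] by (metis image_image)
  finally show ?thesis using Suc by (simp add: obnd_def)
qed

lemma twist_oclass:
  assumes "f \<in> ocar \<O> n"
  shows "twist n ` oclass \<O> \<mu> n f = oclass \<P> \<nu> n (twist n f)"
proof -
  have "twist n ` oclass \<O> \<mu> n f = (\<lambda>b. twist n (f + b)) ` obnd \<O> \<mu> n"
    by (auto simp: oclass_def)
  also have "\<dots> = (\<lambda>b. twist n f + b) ` twist n ` obnd \<O> \<mu> n"
    using obnd_subset[THEN subsetD] assms by (auto simp: image_image twist_add intro!: image_cong)
  finally show ?thesis by (auto simp: twist_obnd oclass_def)
qed

text \<open>The opposite bracket scales every element of a union of cosets by \<open>-1\<close> and takes the cosets
  of the results. Boundaries form a subgroup, so this merely negates each representative of the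
  bracket.\<close>

lemma opposite_bracket_class:
  assumes F: "F \<subseteq> ocar \<O> m" and G: "G \<subseteq> ocar \<O> n"
  shows "gbracket (gerst_opp (operad_cohomology \<P> \<nu>)) m n (twist m ` F) (twist n ` G) =
     (\<Union>f\<in>F. \<Union>g\<in>G. oclass \<P> \<nu> (m + n - 1) (- obracket \<P> m n (twist m f) (twist n g)))"
proof -
  let ?n = "m + n - 1"
  have "(\<Union>h\<in>oclass \<P> \<nu> ?n (obracket \<P> m n (twist m f) (twist n g)). oclass \<P> \<nu> ?n (oscale \<P> (- 1) h))
      = oclass \<P> \<nu> ?n (- obracket \<P> m n (twist m f) (twist n g))"
    (is "?l = ?r") if f: "f \<in> F" and g: "g \<in> G" for f g
  proof -
    define c where "c = obracket \<O> m n f g"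
    have fg: "f \<in> ocar \<O> m" "g \<in> ocar \<O> n" using f g F G by auto
    have c: "c \<in> ocar \<O> ?n"
      unfolding c_def using fg by (rule obracket_mem)
    then have nc: "- c \<in> ocar \<O> ?n" using car[of ?n] by (simp add: add_subgroup_def)
    have br: "obracket \<P> m n (twist m f) (twist n g) = twist ?n (- c)"
      using twist_obracket[OF fg] c by (simp add: twist_neg c_def)
    have "?l = (\<Union>h\<in>twist ?n ` oclass \<O> \<mu> ?n (- c). oclass \<P> \<nu> ?n (oscale \<P> (- 1) h))"
      unfolding br twist_oclass[OF nc] ..
    also have "\<dots> = (\<Union>h\<in>oclass \<O> \<mu> ?n (- c). twist ?n ` oclass \<O> \<mu> ?n (- h))"
    proof -
      have "oclass \<P> \<nu> ?n (oscale \<P> (- 1) (twist ?n h)) = twist ?n ` oclass \<O> \<mu> ?n (- h)"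
        if "h \<in> oclass \<O> \<mu> ?n (- c)" for h
      proof -
        have h: "h \<in> ocar \<O> ?n" using that oclass_subset[OF nc] by blast
        then have nh: "- h \<in> ocar \<O> ?n" using car[of ?n] by (simp add: add_subgroup_def)
        show ?thesis
          unfolding twist_oclass[OF nh] twist_scale[OF h, symmetric] scale_minus_one[OF h] ..
      qed
      then show ?thesis by simp
    qed
    also have "\<dots> = twist ?n ` oclass \<O> \<mu> ?n c"
    proof -
      have B: "b \<in> obnd \<O> \<mu> ?n \<Longrightarrow> b' \<in> obnd \<O> \<mu> ?n \<Longrightarrow> b - b' \<in> obnd \<O> \<mu> ?n"
        "0 \<in> obnd \<O> \<mu> ?n" for b b'
        using obnd_subgroup[of ?n] add_subgroup_diff by (auto simp: add_subgroup_def)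
      have "(\<Union>h\<in>oclass \<O> \<mu> ?n (- c). oclass \<O> \<mu> ?n (- h)) = oclass \<O> \<mu> ?n c"
      proof (intro equalityI subsetI)
        fix x assume "x \<in> (\<Union>h\<in>oclass \<O> \<mu> ?n (- c). oclass \<O> \<mu> ?n (- h))"
        then obtain b b' where "b \<in> obnd \<O> \<mu> ?n" "b' \<in> obnd \<O> \<mu> ?n" "x = - (- c + b) + b'"
          by (auto simp: oclass_def)
        then show "x \<in> oclass \<O> \<mu> ?n c"
          using B(1)[of b' b] by (auto simp: oclass_def algebra_simps intro!: exI[of _ "b' - b"])
      next
        fix x assume "x \<in> oclass \<O> \<mu> ?n c"
        then have "x \<in> oclass \<O> \<mu> ?n (- (- c))" by simp
        moreover have "- c \<in> oclass \<O> \<mu> ?n (- c)"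
          using B(2) by (auto simp: oclass_def intro!: exI[of _ 0])
        ultimately show "x \<in> (\<Union>h\<in>oclass \<O> \<mu> ?n (- c). oclass \<O> \<mu> ?n (- h))" by blast
      qed
      then show ?thesis by (metis image_UN)
    qed
    also have "\<dots> = ?r"
      unfolding br twist_neg[OF c] twist_oclass[OF c] by simp
    finally show ?thesis .
  qed
  then show ?thesis
    by (simp add: gerst_opp_def operad_cohomology_def)
qed

lemma cohomology_iso_opposite:
  "gerst_iso (operad_cohomology \<O> \<mu>) (gerst_opp (operad_cohomology \<P> \<nu>))"
  unfolding gerst_iso_def
proof (rule exI[of _ "\<lambda>n. image (twist n)"], intro conjI allI ballI)
  let ?G = "operad_cohomology \<O> \<mu>"
  let ?H = "operad_cohomology \<P> \<nu>"
  note sub = cocycle_class_subset[THEN subsetD]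
  have inj: "inj_on (twist n) (ocar \<O> n)" for n
    using twist_bij by (rule bij_betw_imp_inj_on)
  have zero_iff: "twist n x = 0 \<longleftrightarrow> x = 0" if "x \<in> ocar \<O> n" for n x
    using inj_onD[OF inj, of n x 0] that car[of n] by (auto simp: twist_0 add_subgroup_def)
  fix n
  show "bij_betw (image (twist n)) (gcar ?G n) (gcar (gerst_opp ?H) n)"
    unfolding bij_betw_def
  proof
    show "inj_on (image (twist n)) (gcar ?G n)"
      using inj_on_subset[OF inj_on_image_Pow[OF inj[of n]]] cocycle_class_subset
      by (metis PowI subsetI)
    have "image (twist n) ` gcar ?G n =
        (\<lambda>f. oclass \<P> \<nu> n (twist n f)) ` {f \<in> ocar \<O> n. odiff \<O> \<mu> n f = 0}"
      by (auto simp: operad_cohomology_def image_image twist_oclass intro!: image_cong)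
    also have "\<dots> = oclass \<P> \<nu> n ` twist n ` {f \<in> ocar \<O> n. odiff \<P> \<nu> n (twist n f) = 0}"
    proof -
      have "odiff \<P> \<nu> n (twist n f) = 0 \<longleftrightarrow> odiff \<O> \<mu> n f = 0" if "f \<in> ocar \<O> n" for f
        using zero_iff[OF odiff_mem[OF that]] twist_odiff[OF that] by simp
      then have "{f \<in> ocar \<O> n. odiff \<P> \<nu> n (twist n f) = 0} = {f \<in> ocar \<O> n. odiff \<O> \<mu> n f = 0}"
        by blast
      then show ?thesis by (simp only: image_image)
    qed
    also have "twist n ` {f \<in> ocar \<O> n. odiff \<P> \<nu> n (twist n f) = 0}
        = {f \<in> ocar \<P> n. odiff \<P> \<nu> n f = 0}"
      unfolding bij_betw_imp_surj_on[OF twist_bij, of n, symmetric] by auto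
    finally show "image (twist n) ` gcar ?G n = gcar (gerst_opp ?H) n"
      by (simp add: operad_cohomology_def gerst_opp_def)
  qed
  show "twist n ` gadd ?G n F G = gadd (gerst_opp ?H) n (twist n ` F) (twist n ` G)"
    if "F \<in> gcar ?G n" "G \<in> gcar ?G n" for F G
    using sub[OF that(1)] sub[OF that(2)] car[of n]
    by (simp add: operad_cohomology_def gerst_opp_def image_UN twist_oclass add_subgroup_def
        twist_add)
  show "twist n ` gscale ?G n r F = gscale (gerst_opp ?H) n r (twist n ` F)"
    if "F \<in> gcar ?G n" for r F
    using sub[OF that]
    by (simp add: operad_cohomology_def gerst_opp_def image_UN twist_oclass scale_mem twist_scale)
  fix m
  show "twist (n + m) ` gprod ?G n m F G = gprod (gerst_opp ?H) n m (twist n ` F) (twist m ` G)"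
    if "F \<in> gcar ?G n" "G \<in> gcar ?G m" for F G
    using sub[OF that(1)] sub[OF that(2)]
    by (simp add: operad_cohomology_def gerst_opp_def image_UN twist_oclass oproduct_mem
        twist_oproduct)
  show "twist (n + m - 1) ` gbracket ?G n m F G
      = gbracket (gerst_opp ?H) n m (twist n ` F) (twist m ` G)"
    if "F \<in> gcar ?G n" "G \<in> gcar ?G m" for F G
    unfolding opposite_bracket_class[OF cocycle_class_subset[OF that(1)]
        cocycle_class_subset[OF that(2)]]
    using sub[OF that(1)] sub[OF that(2)]
    by (simp add: operad_cohomology_def image_UN twist_oclass obracket_mem twist_obracket
        del: One_nat_def)
qed

end

section \<open>Balanced maps on tensor powers\<close>

text \<open>The relations that define \<open>tpow_forms\<close>, for maps into an arbitrary vector space with scalar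
  multiplication \<open>sc\<close>. With values in another tensor power, which consists of functions, they are
  the condition for a map given on generators to extend by \<open>lin_ext\<close>.\<close>

definition multibalanced ::
    "('k::field \<Rightarrow> 'v::ab_group_add \<Rightarrow> 'v) \<Rightarrow> ('k \<Rightarrow> 'a::{ring,monoid_mult} \<Rightarrow> 'a) \<Rightarrow> 'a set \<Rightarrow>
     ('a, 'm::ab_group_add, 'z) bimod_scheme \<Rightarrow> nat \<Rightarrow> ('a \<times> 'm list \<Rightarrow> 'v) \<Rightarrow> bool" where
  "multibalanced sc s B M n \<phi> \<longleftrightarrow>
     (\<forall>b\<in>B. \<forall>b'\<in>B. \<forall>xs\<in>lists (mcar M). length xs = n \<longrightarrow>
        \<phi> (b + b', xs) = \<phi> (b, xs) + \<phi> (b', xs)) \<and>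
     (\<forall>r. \<forall>b\<in>B. \<forall>xs\<in>lists (mcar M). length xs = n \<longrightarrow> \<phi> (s r b, xs) = sc r (\<phi> (b, xs))) \<and>
     (\<forall>b\<in>B. \<forall>xs\<in>lists (mcar M). \<forall>x\<in>mcar M. \<forall>x'\<in>mcar M. \<forall>ys\<in>lists (mcar M).
        length (xs @ x # ys) = n \<longrightarrow>
        \<phi> (b, xs @ (x + x') # ys) = \<phi> (b, xs @ x # ys) + \<phi> (b, xs @ x' # ys)) \<and>
     (\<forall>b\<in>B. \<forall>c\<in>B. \<forall>x\<in>mcar M. \<forall>ys\<in>lists (mcar M).
        length (x # ys) = n \<longrightarrow> \<phi> (b * c, x # ys) = \<phi> (b, lact M c x # ys)) \<and>
     (\<forall>b\<in>B. \<forall>c\<in>B. \<forall>xs\<in>lists (mcar M). \<forall>x\<in>mcar M. \<forall>y\<in>mcar M. \<forall>ys\<in>lists (mcar M).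
        length (xs @ x # y # ys) = n \<longrightarrow>
        \<phi> (b, xs @ ract M x c # y # ys) = \<phi> (b, xs @ x # lact M c y # ys))"

lemma tpow_forms_iff: "\<omega> \<in> tpow_forms s B M n \<longleftrightarrow> multibalanced (*) s B M n \<omega>"
  by (simp add: tpow_forms_def multibalanced_def)

lemma multibalancedI:
  assumes "\<And>b b' xs. b \<in> B \<Longrightarrow> b' \<in> B \<Longrightarrow> xs \<in> lists (mcar M) \<Longrightarrow> length xs = n \<Longrightarrow>
      \<phi> (b + b', xs) = \<phi> (b, xs) + \<phi> (b', xs)"
    and "\<And>r b xs. b \<in> B \<Longrightarrow> xs \<in> lists (mcar M) \<Longrightarrow> length xs = n \<Longrightarrow>
      \<phi> (s r b, xs) = sc r (\<phi> (b, xs))"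
    and "\<And>b xs x x' ys. b \<in> B \<Longrightarrow> xs \<in> lists (mcar M) \<Longrightarrow> x \<in> mcar M \<Longrightarrow> x' \<in> mcar M \<Longrightarrow>
      ys \<in> lists (mcar M) \<Longrightarrow> length (xs @ x # ys) = n \<Longrightarrow>
      \<phi> (b, xs @ (x + x') # ys) = \<phi> (b, xs @ x # ys) + \<phi> (b, xs @ x' # ys)"
    and "\<And>b c x ys. b \<in> B \<Longrightarrow> c \<in> B \<Longrightarrow> x \<in> mcar M \<Longrightarrow> ys \<in> lists (mcar M) \<Longrightarrow>
      length (x # ys) = n \<Longrightarrow> \<phi> (b * c, x # ys) = \<phi> (b, lact M c x # ys)"
    and "\<And>b c xs x y ys. b \<in> B \<Longrightarrow> c \<in> B \<Longrightarrow> xs \<in> lists (mcar M) \<Longrightarrow> x \<in> mcar M \<Longrightarrow> y \<in> mcar M \<Longrightarrow>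
      ys \<in> lists (mcar M) \<Longrightarrow> length (xs @ x # y # ys) = n \<Longrightarrow>
      \<phi> (b, xs @ ract M x c # y # ys) = \<phi> (b, xs @ x # lact M c y # ys)"
  shows "multibalanced sc s B M n \<phi>"
  unfolding multibalanced_def by (intro conjI ballI allI impI; rule assms; assumption)

lemma multibalancedD:
  assumes "multibalanced sc s B M n \<phi>"
  shows "b \<in> B \<Longrightarrow> b' \<in> B \<Longrightarrow> xs \<in> lists (mcar M) \<Longrightarrow> length xs = n \<Longrightarrow>
      \<phi> (b + b', xs) = \<phi> (b, xs) + \<phi> (b', xs)"
    and "b \<in> B \<Longrightarrow> xs \<in> lists (mcar M) \<Longrightarrow> length xs = n \<Longrightarrow>
      \<phi> (s r b, xs) = sc r (\<phi> (b, xs))"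
    and "b \<in> B \<Longrightarrow> xs \<in> lists (mcar M) \<Longrightarrow> x \<in> mcar M \<Longrightarrow> x' \<in> mcar M \<Longrightarrow>
      ys \<in> lists (mcar M) \<Longrightarrow> length (xs @ x # ys) = n \<Longrightarrow>
      \<phi> (b, xs @ (x + x') # ys) = \<phi> (b, xs @ x # ys) + \<phi> (b, xs @ x' # ys)"
    and "b \<in> B \<Longrightarrow> c \<in> B \<Longrightarrow> x \<in> mcar M \<Longrightarrow> ys \<in> lists (mcar M) \<Longrightarrow>
      length (x # ys) = n \<Longrightarrow> \<phi> (b * c, x # ys) = \<phi> (b, lact M c x # ys)"
    and "b \<in> B \<Longrightarrow> c \<in> B \<Longrightarrow> xs \<in> lists (mcar M) \<Longrightarrow> x \<in> mcar M \<Longrightarrow> y \<in> mcar M \<Longrightarrow>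
      ys \<in> lists (mcar M) \<Longrightarrow> length (xs @ x # y # ys) = n \<Longrightarrow>
      \<phi> (b, xs @ ract M x c # y # ys) = \<phi> (b, xs @ x # lact M c y # ys)"
  using assms by (simp_all add: multibalanced_def)

lemma multibalanced_comp:
  assumes "multibalanced sc s B M n \<phi>"
    and "\<And>v w. l (v + w) = l v + l w" "\<And>r v. l (sc r v) = sc' r (l v)"
  shows "multibalanced sc' s B M n (\<lambda>g. l (\<phi> g))"
  using multibalancedD[OF assms(1)] assms(2,3) by (intro multibalancedI) simp_all

abbreviation pscale :: "'k::times \<Rightarrow> ('x \<Rightarrow> 'k) \<Rightarrow> 'x \<Rightarrow> 'k" where
  "pscale r t \<equiv> (\<lambda>\<omega>. r * t \<omega>)"

lemma multibalanced_apply: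
  assumes "multibalanced pscale s B M n \<phi>"
  shows "(\<lambda>g. \<phi> g \<eta>) \<in> tpow_forms s B M n"
  unfolding tpow_forms_iff using assms by (rule multibalanced_comp) simp_all

lemma multibalanced_pointwise:
  assumes "\<And>\<omega>. multibalanced (*) s B M n (\<lambda>g. \<phi> g \<omega>)"
  shows "multibalanced pscale s B M n \<phi>"
  using multibalancedD[OF assms] by (intro multibalancedI) (simp_all add: fun_eq_iff)

lemma multibalanced_gen: "multibalanced pscale s B M n (tpow_gen s B M)"
proof (rule multibalanced_pointwise)
  fix \<omega>
  show "multibalanced (*) s B M n (\<lambda>g. tpow_gen s B M g \<omega>)"
  proof (cases "multibalanced (*) s B M n \<omega>")
    case True
    then have "tpow_gen s B M (b, xs) \<omega> = \<omega> (b, xs)" if "length xs = n" for b xs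
      using that by (simp add: tpow_gen_def ev_def tpow_forms_iff)
    then show ?thesis
      using multibalancedD[OF True] by (intro multibalancedI) simp_all
  next
    case False
    then have "tpow_gen s B M (b, xs) \<omega> = 0" if "length xs = n" for b xs
      using that by (simp add: tpow_gen_def ev_def tpow_forms_iff)
    then show ?thesis
      by (intro multibalancedI) simp_all
  qed
qed

lemma lin_ext_add: "lin_ext \<phi> (t + u) = lin_ext \<phi> t + lin_ext \<phi> u"
  by (simp add: lin_ext_def fun_eq_iff)

lemma lin_ext_0: "lin_ext \<phi> 0 = 0"
  by (simp add: lin_ext_def fun_eq_iff)

lemma lin_ext_pscale: "lin_ext \<phi> (pscale r t) = pscale r (lin_ext \<phi> t)"
  by (simp add: lin_ext_def)

lemma lin_ext_gen:
  assumes "multibalanced pscale s B M n \<phi>" "length xs = n"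
  shows "lin_ext \<phi> (tpow_gen s B M (b, xs)) = \<phi> (b, xs)"
  using multibalanced_apply[OF assms(1)] assms(2)
  by (simp add: lin_ext_def tpow_gen_def ev_def fun_eq_iff)

lemma tpow_gen_mem:
  "b \<in> B \<Longrightarrow> xs \<in> lists (mcar M) \<Longrightarrow> length xs = n \<Longrightarrow>
     tpow_gen s B M (b, xs) \<in> mcar (tpow s B M n)"
  unfolding tpow_def ev_span_def tpow_gen_def
  by (auto intro!: exI[of _ "[(b, xs)]"])

lemma tpow_0_mem: "0 \<in> mcar (tpow s B M n)"
  unfolding tpow_def ev_span_def by (auto intro!: exI[of _ "[]"])

lemma tpow_add_mem:
  assumes "t \<in> mcar (tpow s B M n)" "u \<in> mcar (tpow s B M n)"
  shows "t + u \<in> mcar (tpow s B M n)"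
proof -
  obtain xs ys where "set xs \<subseteq> B \<times> {xs \<in> lists (mcar M). length xs = n}"
      "t = (\<Sum>x\<leftarrow>xs. ev (tpow_forms s B M n) x)"
      "set ys \<subseteq> B \<times> {xs \<in> lists (mcar M). length xs = n}"
      "u = (\<Sum>x\<leftarrow>ys. ev (tpow_forms s B M n) x)"
    using assms by (auto simp: tpow_def ev_span_def)
  then have "set (xs @ ys) \<subseteq> B \<times> {xs \<in> lists (mcar M). length xs = n}"
      "t + u = (\<Sum>x\<leftarrow>xs @ ys. ev (tpow_forms s B M n) x)"
    by simp_all
  then have "t + u \<in> ev_span (tpow_forms s B M n) (B \<times> {xs \<in> lists (mcar M). length xs = n})"
    unfolding ev_span_def by blast
  then show ?thesis by (simp add: tpow_def)
qed

lemma tpow_induct [consumes 1, case_names zero gen add]: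
  assumes "t \<in> mcar (tpow s B M n)"
    and "P 0"
    and "\<And>b xs. b \<in> B \<Longrightarrow> xs \<in> lists (mcar M) \<Longrightarrow> length xs = n \<Longrightarrow> P (tpow_gen s B M (b, xs))"
    and "\<And>t u. t \<in> mcar (tpow s B M n) \<Longrightarrow> u \<in> mcar (tpow s B M n) \<Longrightarrow> P t \<Longrightarrow> P u \<Longrightarrow> P (t + u)"
  shows "P t"
proof -
  obtain gs where gs: "set gs \<subseteq> B \<times> {xs \<in> lists (mcar M). length xs = n}"
      and t: "t = (\<Sum>g\<leftarrow>gs. ev (tpow_forms s B M n) g)"
    using assms(1) by (auto simp: tpow_def ev_span_def)
  from gs have "(\<Sum>g\<leftarrow>gs. ev (tpow_forms s B M n) g) \<in> mcar (tpow s B M n) \<and>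
      P (\<Sum>g\<leftarrow>gs. ev (tpow_forms s B M n) g)"
  proof (induction gs)
    case Nil
    show ?case unfolding list.map sum_list.Nil using assms(2) tpow_0_mem by blast
  next
    case (Cons g gs)
    obtain b xs where g: "g = (b, xs)" "b \<in> B" "xs \<in> lists (mcar M)" "length xs = n"
      using Cons.prems by (cases g) auto
    then have "ev (tpow_forms s B M n) g = tpow_gen s B M (b, xs)"
      by (simp add: tpow_gen_def)
    moreover have "set gs \<subseteq> B \<times> {xs \<in> lists (mcar M). length xs = n}"
      using Cons.prems by simp
    ultimately show ?case
      using assms(4)[OF tpow_gen_mem[OF g(2-4)] _ assms(3)[OF g(2-4)]] Cons.IH
        tpow_add_mem[OF tpow_gen_mem[OF g(2-4)]]
      unfolding g(1) list.map sum_list.Cons by (metis (no_types, lifting))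
  qed
  with t show ?thesis by simp
qed

lemma lmod_homD:
  assumes "f \<in> lmod_hom R M N"
  shows "x \<in> mcar M \<Longrightarrow> f x \<in> mcar N" "x \<notin> mcar M \<Longrightarrow> f x = 0"
    "x \<in> mcar M \<Longrightarrow> y \<in> mcar M \<Longrightarrow> f (x + y) = f x + f y"
    "a \<in> R \<Longrightarrow> x \<in> mcar M \<Longrightarrow> f (lact M a x) = lact N a (f x)"
  using assms by (auto simp: lmod_hom_def)

lemma bimod_homD:
  assumes "f \<in> bimod_hom R M N"
  shows "x \<in> mcar M \<Longrightarrow> f x \<in> mcar N" "x \<notin> mcar M \<Longrightarrow> f x = 0"
    "x \<in> mcar M \<Longrightarrow> y \<in> mcar M \<Longrightarrow> f (x + y) = f x + f y"
    "a \<in> R \<Longrightarrow> x \<in> mcar M \<Longrightarrow> f (lact M a x) = lact N a (f x)"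
    "a \<in> R \<Longrightarrow> x \<in> mcar M \<Longrightarrow> f (ract M x a) = ract N (f x) a"
  using assms by (auto simp: lmod_hom_def bimod_hom_def)

lemma bimod_homI:
  assumes "\<And>x. x \<in> mcar M \<Longrightarrow> f x \<in> mcar N" "\<And>x. x \<notin> mcar M \<Longrightarrow> f x = 0"
    "\<And>x y. x \<in> mcar M \<Longrightarrow> y \<in> mcar M \<Longrightarrow> f (x + y) = f x + f y"
    "\<And>a x. a \<in> R \<Longrightarrow> x \<in> mcar M \<Longrightarrow> f (lact M a x) = lact N a (f x)"
    "\<And>a x. a \<in> R \<Longrightarrow> x \<in> mcar M \<Longrightarrow> f (ract M x a) = ract N (f x) a"
  shows "f \<in> bimod_hom R M N"
  using assms by (auto simp: lmod_hom_def bimod_hom_def)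

lemma bimoduleD:
  assumes "bimodule s B M"
  shows "0 \<in> mcar M" "x \<in> mcar M \<Longrightarrow> y \<in> mcar M \<Longrightarrow> x + y \<in> mcar M"
    "x \<in> mcar M \<Longrightarrow> - x \<in> mcar M"
    "b \<in> B \<Longrightarrow> x \<in> mcar M \<Longrightarrow> lact M b x \<in> mcar M"
    "b \<in> B \<Longrightarrow> x \<in> mcar M \<Longrightarrow> ract M x b \<in> mcar M"
    "b \<in> B \<Longrightarrow> c \<in> B \<Longrightarrow> x \<in> mcar M \<Longrightarrow> ract M (ract M x b) c = ract M x (b * c)"
    "b \<in> B \<Longrightarrow> c \<in> B \<Longrightarrow> x \<in> mcar M \<Longrightarrow> ract M (lact M b x) c = lact M b (ract M x c)"
    "x \<in> mcar M \<Longrightarrow> ract M x 1 = x"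
    "x \<in> mcar M \<Longrightarrow> lact M 1 x = x"
    "x \<in> mcar M \<Longrightarrow> lact M (s r 1) x = ract M x (s r 1)"
  using assms by (simp_all add: bimodule_def left_module_def add_subgroup_def)

locale fd_algebra_with_subalgebra = finite_dimensional_vector_space s E
  for s :: "'k::field \<Rightarrow> 'a::{ring,monoid_mult} \<Rightarrow> 'a" and E :: "'a set" +
  fixes B :: "'a set"
  assumes scale_mult_left: "s r (x * y) = s r x * y"
    and scale_mult_right: "s r (x * y) = x * s r y"
    and subalg: "subalgebra s B"
begin

lemma B_mem: "1 \<in> B" "x \<in> B \<Longrightarrow> y \<in> B \<Longrightarrow> x + y \<in> B" "x \<in> B \<Longrightarrow> y \<in> B \<Longrightarrow> x * y \<in> B"
    "x \<in> B \<Longrightarrow> s r x \<in> B" "0 \<in> B" "x \<in> B \<Longrightarrow> - x \<in> B"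
proof -
  have B: "1 \<in> B" "\<And>x y. x \<in> B \<Longrightarrow> y \<in> B \<Longrightarrow> x + y \<in> B" "\<And>x y. x \<in> B \<Longrightarrow> y \<in> B \<Longrightarrow> x * y \<in> B"
      "\<And>r x. x \<in> B \<Longrightarrow> s r x \<in> B"
    using subalg by (auto simp: subalgebra_def)
  then show "1 \<in> B" "x \<in> B \<Longrightarrow> y \<in> B \<Longrightarrow> x + y \<in> B" "x \<in> B \<Longrightarrow> y \<in> B \<Longrightarrow> x * y \<in> B"
    "x \<in> B \<Longrightarrow> s r x \<in> B" by blast+
  show "0 \<in> B" using B(4)[OF B(1), of 0] by simp
  show "x \<in> B \<Longrightarrow> - x \<in> B" using B(4)[of x "- 1"] by simp
qed

lemma scale_one_mult: "s r 1 * x = s r x" "x * s r 1 = s r x"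
  using scale_mult_left[of r 1 x] scale_mult_right[of r x 1] by simp_all

lemma bimodule_mult: "bimodule s B (mult_bimod UNIV)"
  by (simp add: bimodule_def left_module_def mult_bimod_def add_subgroup_def algebra_simps
      scale_one_mult)

text \<open>The extension of an \<open>A\<close>-valued balanced map to a tensor power, computed in coordinates. In
  contrast to a definition through representations as sums of generators, the formula is visibly
  additive in \<open>t\<close>.\<close>

definition vext :: "('x \<Rightarrow> 'a) \<Rightarrow> (('x \<Rightarrow> 'k) \<Rightarrow> 'k) \<Rightarrow> 'a" where
  "vext \<phi> t = (\<Sum>e\<in>E. s (t (\<lambda>x. representation E (\<phi> x) e)) e)"

lemma vext_add: "vext \<phi> (t + u) = vext \<phi> t + vext \<phi> u"
  by (simp add: vext_def scale_left_distrib sum.distrib)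

lemma vext_0: "vext \<phi> 0 = 0"
  by (simp add: vext_def)

lemma vext_pscale: "vext \<phi> (pscale r t) = s r (vext \<phi> t)"
  by (simp add: vext_def scale_sum_right)

lemma vext_gen:
  assumes "multibalanced s s B M n \<phi>" "length xs = n"
  shows "vext \<phi> (tpow_gen s B M (b, xs)) = \<phi> (b, xs)"
proof -
  have "(\<lambda>g. representation E (\<phi> g) e) \<in> tpow_forms s B M n" for e
    unfolding tpow_forms_iff using assms(1)
    by (rule multibalanced_comp)
      (simp_all add: representation_add representation_scale independent_Basis span_Basis)
  then show ?thesis
    using assms(2) sum_representation_eq[OF independent_Basis _ finite_Basis order_refl,
        of "\<phi> (b, xs)"]
    by (simp add: vext_def tpow_gen_def ev_def span_Basis)
qed

lemma tpow_pscale_mem: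
  assumes "t \<in> mcar (tpow s B M n)"
  shows "pscale r t \<in> mcar (tpow s B M n)"
  using assms
proof (induction rule: tpow_induct)
  case zero
  show ?case using tpow_0_mem[of s B M n] by (simp add: zero_fun_def)
next
  case (gen b xs)
  then show ?case
    using multibalancedD(2)[OF multibalanced_gen gen, of s r] tpow_gen_mem[of "s r b" B xs M n s]
    by (simp add: B_mem)
next
  case (add t u)
  then show ?case
    using tpow_add_mem[OF add.IH] by (simp add: plus_fun_def algebra_simps)
qed

text \<open>The tool for well-definedness: a family of tensors satisfies the defining relations as soon
  as its images under a point-separating family of \<open>A\<close>-valued linear maps do. Below these images
  are explicit elements of \<open>A\<close>, for which the relations are short calculations.\<close>

lemma multibalanced_separated:
  assumes M: "bimodule s B M"
    and T: "\<And>b xs. b \<in> B \<Longrightarrow> xs \<in> lists (mcar M) \<Longrightarrow> length xs = n \<Longrightarrow> T (b, xs) \<in> P"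
    and P: "\<And>t u. t \<in> P \<Longrightarrow> u \<in> P \<Longrightarrow> t + u \<in> P" "\<And>r t. t \<in> P \<Longrightarrow> pscale r t \<in> P"
    and sep: "\<And>t u. t \<in> P \<Longrightarrow> u \<in> P \<Longrightarrow> (\<And>j. j \<in> J \<Longrightarrow> L j t = L j u) \<Longrightarrow> t = u"
    and L: "\<And>j t u. L j (t + u) = L j t + L j u" "\<And>j r t. L j (pscale r t) = s r (L j t)"
    and bal: "\<And>j. j \<in> J \<Longrightarrow> multibalanced s s B M n (\<lambda>g. L j (T g))"
  shows "multibalanced pscale s B M n T"
proof -
  note simps = multibalancedD[OF bal] L
  note mems = T P B_mem bimoduleD[OF M]
  show ?thesis
  proof (rule multibalancedI, goal_cases)
    case (1 b b' xs)
    then show ?case by (intro sep) (simp_all add: simps mems)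
  next
    case (2 r b xs)
    then show ?case by (intro sep) (simp_all add: simps mems)
  next
    case (3 b xs x x' ys)
    then show ?case by (intro sep) (simp_all add: simps mems)
  next
    case (4 b c x ys)
    then show ?case by (intro sep) (simp_all add: simps mems)
  next
    case (5 b c xs x y ys)
    then show ?case by (intro sep) (simp_all add: simps mems)
  qed
qed

end

lemma multibalanced_add:
  assumes "multibalanced sc s B M n \<phi>" "multibalanced sc s B M n \<psi>"
    and "\<And>r v w. sc r (v + w) = sc r v + sc r w"
  shows "multibalanced sc s B M n (\<lambda>g. \<phi> g + \<psi> g)"
  using multibalancedD[OF assms(1)] multibalancedD[OF assms(2)] assms(3)
  by (intro multibalancedI) (simp_all add: algebra_simps)

lemma multibalanced_zero:
  assumes "\<And>r. sc r 0 = 0"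
  shows "multibalanced sc s B M n (\<lambda>g. 0)"
  using assms by (intro multibalancedI) simp_all

section \<open>Iterated pairings\<close>

lemma gen_ract_snoc [simp]: "gen_ract M (b, xs @ [x]) c = (b, xs @ [ract M x c])"
  by (cases xs) auto

lemma gen_cat_Nil [simp]: "gen_cat M (b, []) (w, ys) = (b * w, ys)"
  by (simp add: gen_cat_def)

lemma gen_cat_snoc [simp]: "gen_cat M (b, xs @ [x]) (w, ys) = (b, xs @ ract M x w # ys)"
  by (simp add: gen_cat_def)

lemma gen_cat_empty: "gen_cat M g (w, []) = gen_ract M g w"
  by (simp add: gen_cat_def)

lemma gen_cat_one:
  "bimodule s B M \<Longrightarrow> xs \<in> lists (mcar M) \<Longrightarrow> gen_cat M (b, xs) (1, ys) = (b, xs @ ys)"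
  by (cases xs rule: rev_cases) (simp_all add: bimoduleD)

text \<open>By definition \<open>gen_cat\<close> lets \<open>u\<close> act on the last factor of \<open>xs\<close> from the right, or
  multiplies it to the coefficient if there is none. Balancing moves it to the next factor in both
  cases.\<close>

lemma gen_cat_lact:
  assumes "b \<in> B" "u \<in> B" "xs \<in> lists (mcar M)" "c \<in> mcar M" "ys \<in> lists (mcar M)"
  shows "tpow_gen s B M (gen_cat M (b, xs) (u, c # ys)) = tpow_gen s B M (b, xs @ lact M u c # ys)"
proof (cases xs rule: rev_cases)
  case Nil
  with assms multibalancedD(4)[OF multibalanced_gen assms(1,2,4,5) refl, of s] show ?thesis by simp
next
  case (snoc xs' x)
  with assms multibalancedD(5)[OF multibalanced_gen assms(1,2) _ _ assms(4,5) refl, of xs' x s]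
      show ?thesis
    by simp
qed

lemma gen_cat_mem:
  assumes "bimodule s B M" "b \<in> B" "w \<in> B" "b * w \<in> B" "xs \<in> lists (mcar M)" "ys \<in> lists (mcar M)"
    "length xs + length ys = n"
  shows "tpow_gen s B M (gen_cat M (b, xs) (w, ys)) \<in> mcar (tpow s B M n)"
proof (cases xs rule: rev_cases)
  case Nil
  with assms show ?thesis by (simp add: tpow_gen_mem)
next
  case (snoc xs' x)
  with assms bimoduleD(5)[OF assms(1,3), of x] show ?thesis
    by (simp add: tpow_gen_mem)
qed

lemma gen_zero_entry:
  assumes "bimodule s B M" "b \<in> B" "xs \<in> lists (mcar M)" "ys \<in> lists (mcar M)"
  shows "tpow_gen s B M (b, xs @ 0 # ys) = 0"
  using multibalancedD(3)[OF multibalanced_gen assms(2,3) bimoduleD(1)[OF assms(1)]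
      bimoduleD(1)[OF assms(1)] assms(4) refl]
  by simp

lemma gen_sum_entry:
  assumes "bimodule s B M" "b \<in> B" "xs \<in> lists (mcar M)" "ys \<in> lists (mcar M)"
    and "\<And>q. q \<in> set qs \<Longrightarrow> f q \<in> mcar M"
  shows "tpow_gen s B M (b, xs @ (\<Sum>q\<leftarrow>qs. f q) # ys) = (\<Sum>q\<leftarrow>qs. tpow_gen s B M (b, xs @ f q # ys))"
  using assms(5)
proof (induction qs)
  case Nil
  show ?case unfolding list.map sum_list.Nil by (rule gen_zero_entry[OF assms(1-4)])
next
  case (Cons q qs)
  have "(\<Sum>q\<leftarrow>qs. f q) \<in> mcar M"
    using Cons.prems by (induction qs) (auto intro: bimoduleD[OF assms(1)])
  then show ?case
    using Cons multibalancedD(3)[OF multibalanced_gen assms(2,3) _ _ assms(4) refl, of "f q" _ s]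
    by (simp del: plus_fun_apply)
qed

text \<open>The sum over all lists of \<open>n\<close> entries of \<open>D\<close>, nested in such a way that peeling off one
  tensor factor at a time yields the recursion.\<close>

fun nested_sum :: "'q list \<Rightarrow> nat \<Rightarrow> ('q list \<Rightarrow> 'v::monoid_add) \<Rightarrow> 'v" where
  "nested_sum D 0 F = F []"
| "nested_sum D (Suc n) F = (\<Sum>q\<leftarrow>D. nested_sum D n (\<lambda>qs. F (q # qs)))"

lemma nested_sum_cong:
  "(\<And>qs. set qs \<subseteq> set D \<Longrightarrow> length qs = n \<Longrightarrow> F qs = G qs) \<Longrightarrow> nested_sum D n F = nested_sum D n G"
proof (induction n arbitrary: F G)
  case (Suc n)
  have "nested_sum D n (\<lambda>qs. F (q # qs)) = nested_sum D n (\<lambda>qs. G (q # qs))" if "q \<in> set D" for q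
    using that by (intro Suc.IH Suc.prems) auto
  then show ?case by (simp cong: map_cong)
qed simp

lemma nested_sum_mem:
  assumes "0 \<in> P" "\<And>x y. x \<in> P \<Longrightarrow> y \<in> P \<Longrightarrow> x + y \<in> P"
    and "\<And>qs. set qs \<subseteq> set D \<Longrightarrow> length qs = n \<Longrightarrow> F qs \<in> P"
  shows "nested_sum D n F \<in> P"
  using assms(3)
proof (induction n arbitrary: F)
  case (Suc n)
  have "nested_sum D n (\<lambda>qs. F (q # qs)) \<in> P" if "q \<in> set D" for q
    using that by (intro Suc.IH Suc.prems) auto
  moreover have "(\<Sum>q\<leftarrow>Q. f q) \<in> P" if "\<And>q. q \<in> set Q \<Longrightarrow> f q \<in> P" for f and Q :: "'b list"
    using that by (induction Q) (simp_all add: assms(1,2))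
  ultimately show ?case by simp
qed simp

lemma nested_sum_hom:
  fixes h :: "'v::monoid_add \<Rightarrow> 'w::monoid_add"
  assumes h: "h 0 = 0" "\<And>x y. x \<in> P \<Longrightarrow> y \<in> P \<Longrightarrow> h (x + y) = h x + h y"
    and P: "0 \<in> P" "\<And>x y. x \<in> P \<Longrightarrow> y \<in> P \<Longrightarrow> x + y \<in> P"
    and F: "\<And>qs. set qs \<subseteq> set D \<Longrightarrow> length qs = n \<Longrightarrow> F qs \<in> P"
  shows "h (nested_sum D n F) = nested_sum D n (\<lambda>qs. h (F qs))"
  using F
proof (induction n arbitrary: F)
  case (Suc n)
  have IH: "h (nested_sum D n (\<lambda>qs. F (q # qs))) = nested_sum D n (\<lambda>qs. h (F (q # qs)))"
    and mem: "nested_sum D n (\<lambda>qs. F (q # qs)) \<in> P" if "q \<in> set D" for q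
    using that P by (intro Suc.IH nested_sum_mem Suc.prems; auto)+
  have sum: "(\<Sum>q\<leftarrow>Q. f q) \<in> P \<and> h (\<Sum>q\<leftarrow>Q. f q) = (\<Sum>q\<leftarrow>Q. h (f q))"
    if "\<And>q. q \<in> set Q \<Longrightarrow> f q \<in> P" for f and Q :: "'c list"
    using that by (induction Q) (simp_all add: h P)
  show ?case
    using sum[of D "\<lambda>q. nested_sum D n (\<lambda>qs. F (q # qs))"] mem IH by (simp cong: map_cong)
qed simp

lemma nested_sum_add:
  fixes F G :: "'q list \<Rightarrow> 'v::comm_monoid_add"
  shows "nested_sum D n (\<lambda>q. F q + G q) = nested_sum D n F + nested_sum D n G"
  by (induction n arbitrary: F G) (simp_all add: sum_list_addf)

lemma nested_sum_zero: "nested_sum D n (\<lambda>q. 0) = (0 :: 'v::monoid_add)"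
  by (induction n) (simp_all add: sum_list_0)

context fd_algebra_with_subalgebra
begin

abbreviation "AA \<equiv> (mult_bimod UNIV :: ('a, 'a) bimod)"
abbreviation "agen \<equiv> tpow_gen s B AA"
abbreviation "apow n \<equiv> mcar (tpow s B AA n)"
abbreviation "HH n \<equiv> bimod_hom B (tpow s B AA n) AA"

lemma AA_simps [simp]: "mcar AA = UNIV" "lact AA a x = a * x" "ract AA x a = x * a"
  by (simp_all add: mult_bimod_def)

lemma multibalanced_cong:
  assumes "multibalanced sc s B M n \<phi>" and M: "bimodule s B M"
    and "\<And>b xs. b \<in> B \<Longrightarrow> xs \<in> lists (mcar M) \<Longrightarrow> length xs = n \<Longrightarrow> \<psi> (b, xs) = \<phi> (b, xs)"
  shows "multibalanced sc s B M n \<psi>"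
  using multibalancedD[OF assms(1)] assms(3) bimoduleD[OF M] B_mem by (intro multibalancedI) simp_all

end

text \<open>\<open>C\<close> is paired with \<open>A\<close> like the right dual of \<open>A\<close>: \<open>p x\<close> is a right \<open>B\<close>-linear map from \<open>A\<close>
  to \<open>B\<close>, and the list \<open>D\<close> of pairs \<open>(d, c)\<close> is a dual basis of the right \<open>B\<close>-module \<open>A\<close>.\<close>

locale dual_pairing = fd_algebra_with_subalgebra s E B
  for s :: "'k::field \<Rightarrow> 'a::{ring,monoid_mult} \<Rightarrow> 'a" and E B +
  fixes C :: "('a, 'c::ab_group_add, 'z) bimod_scheme"
    and p :: "'c \<Rightarrow> 'a \<Rightarrow> 'a" and D :: "('a \<times> 'c) list"
  assumes bimodule: "bimodule s B C"
    and p_mem: "x \<in> mcar C \<Longrightarrow> p x a \<in> B"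
    and p_add_left: "x \<in> mcar C \<Longrightarrow> y \<in> mcar C \<Longrightarrow> p (x + y) a = p x a + p y a"
    and p_add_right: "x \<in> mcar C \<Longrightarrow> p x (a + a') = p x a + p x a'"
    and p_lact: "x \<in> mcar C \<Longrightarrow> b \<in> B \<Longrightarrow> p (lact C b x) a = b * p x a"
    and p_ract: "x \<in> mcar C \<Longrightarrow> b \<in> B \<Longrightarrow> p (ract C x b) a = p x (b * a)"
    and p_mult_right: "x \<in> mcar C \<Longrightarrow> b \<in> B \<Longrightarrow> p x (a * b) = p x a * b"
    and faithful: "x \<in> mcar C \<Longrightarrow> y \<in> mcar C \<Longrightarrow> (\<And>a. p x a = p y a) \<Longrightarrow> x = y"
    and dual_mem: "q \<in> set D \<Longrightarrow> snd q \<in> mcar C"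
    and dual_basis: "(\<Sum>(d, c)\<leftarrow>D. d * p c a) = a"
begin

abbreviation "cgen \<equiv> tpow_gen s B C"
abbreviation "cpow n \<equiv> mcar (tpow s B C n)"

lemmas C_mem = bimoduleD[OF bimodule]

lemma p_scale: "x \<in> mcar C \<Longrightarrow> p x (s r a) = s r (p x a)"
  using p_mult_right[of x "s r 1" a] B_mem by (simp add: scale_one_mult)

lemma p_sum_right: "x \<in> mcar C \<Longrightarrow> p x (\<Sum>q\<leftarrow>Q. f q) = (\<Sum>q\<leftarrow>Q. p x (f q))"
proof (induction Q)
  case Nil
  then show ?case using p_add_right[of x 0 0] by simp
qed (simp add: p_add_right)

lemma p_sum_left:
  "(\<And>q. q \<in> set Q \<Longrightarrow> f q \<in> mcar C) \<Longrightarrow>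
     (\<Sum>q\<leftarrow>Q. f q) \<in> mcar C \<and> p (\<Sum>q\<leftarrow>Q. f q) a = (\<Sum>q\<leftarrow>Q. p (f q) a)"
proof (induction Q)
  case Nil
  then show ?case using p_add_left[of 0 0 a] C_mem(1) by simp
qed (simp add: p_add_left C_mem)

text \<open>Elements of \<open>C\<close> are determined by their values, and both sides have the same value at each
  \<open>a\<close> because \<open>p x\<close> is right linear and \<open>D\<close> is a dual basis.\<close>

lemma dual_expansion:
  assumes "x \<in> mcar C"
  shows "(\<Sum>(d, c)\<leftarrow>D. lact C (p x d) c) = x"
proof -
  have mem: "(case q of (d, c) \<Rightarrow> lact C (p x d) c) \<in> mcar C" if "q \<in> set D" for q
    using that dual_mem[OF that] p_mem[OF assms] C_mem by (auto simp: case_prod_beta)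
  show ?thesis
  proof (rule faithful)
    show "(\<Sum>(d, c)\<leftarrow>D. lact C (p x d) c) \<in> mcar C" using p_sum_left mem by blast
    show "p (\<Sum>(d, c)\<leftarrow>D. lact C (p x d) c) a = p x a" for a
    proof -
      have "p (\<Sum>(d, c)\<leftarrow>D. lact C (p x d) c) a = (\<Sum>q\<leftarrow>D. p (case q of (d, c) \<Rightarrow> lact C (p x d) c) a)"
        using p_sum_left mem by blast
      also have "\<dots> = (\<Sum>q\<leftarrow>D. p x (case q of (d, c) \<Rightarrow> d * p c a))"
        using dual_mem p_mem[OF assms]
        by (intro arg_cong[where f = sum_list] map_cong refl)
          (auto simp: p_lact p_mult_right[OF assms p_mem] split: prod.splits)
      also have "\<dots> = p x a"
        by (simp only: p_sum_right[OF assms, symmetric] dual_basis)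
      finally show ?thesis .
    qed
  qed fact
qed

text \<open>With \<open>xs = [x\<^sub>1, \<dots>, x\<^sub>n]\<close> and \<open>as = [a\<^sub>1, \<dots>, a\<^sub>n]\<close> this is \<open>p x\<^sub>1 (p x\<^sub>2 (\<dots> p x\<^sub>n (z a\<^sub>1) \<dots>) a\<^sub>n)\<close>:
  the last factor of \<open>xs\<close> meets the first argument, which is why the first list is reversed.\<close>

definition nest :: "'c list \<Rightarrow> 'a \<Rightarrow> 'a list \<Rightarrow> 'a" where
  "nest xs z as = foldl (\<lambda>z (y, a). p y (z * a)) z (zip (rev xs) as)"

lemma nest_Nil [simp]: "nest [] z as = z"
  by (simp add: nest_def)

lemma nest_snoc [simp]: "nest (xs @ [x]) z (a # as) = nest xs (p x (z * a)) as"
  by (simp add: nest_def)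

lemma nest_append:
  "length xs = length as \<Longrightarrow> nest (ys @ xs) z (as @ bs) = nest ys (nest xs z as) bs"
proof (induction as arbitrary: xs z)
  case (Cons a as)
  then obtain xs' x where "xs = xs' @ [x]" "length xs' = length as"
    by (cases xs rule: rev_cases) auto
  with Cons.IH[of xs' "p x (z * a)"] show ?case
    using nest_snoc[of "ys @ xs'" x] by simp
qed simp

lemma nest_Cons:
  "length xs = length as \<Longrightarrow> nest (x # xs) z (as @ [a]) = p x (nest xs z as * a)"
  using nest_append[of xs as "[x]" z "[a]"] nest_snoc[of "[]" x _ a "[]"] by simp

lemma nest_middle:
  "length xs = length as \<Longrightarrow>
     nest (ys @ x # xs) z (as @ a # bs) = nest ys (p x (nest xs z as * a)) bs"
  using nest_append[of xs as "ys @ [x]" z "a # bs"] by simp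

lemma nest_mem: "z \<in> B \<Longrightarrow> xs \<in> lists (mcar C) \<Longrightarrow> nest xs z as \<in> B"
proof (induction xs arbitrary: z as rule: rev_induct)
  case (snoc x xs)
  then show ?case by (cases as) (auto simp: p_mem nest_def[of _ _ "[]"])
qed simp

lemma nest_add: "xs \<in> lists (mcar C) \<Longrightarrow> length xs = length as \<Longrightarrow>
    nest xs (z + z') as = nest xs z as + nest xs z' as"
proof (induction xs arbitrary: z z' as rule: rev_induct)
  case (snoc x xs)
  then show ?case by (cases as) (auto simp: p_add_right distrib_right)
qed simp

lemma nest_scale: "xs \<in> lists (mcar C) \<Longrightarrow> length xs = length as \<Longrightarrow>
    nest xs (s r z) as = s r (nest xs z as)"
proof (induction xs arbitrary: z as rule: rev_induct)
  case (snoc x xs)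
  then show ?case by (cases as) (auto simp: p_scale scale_mult_left[symmetric])
qed simp

lemma split_reversed:
  assumes "length as = length (ys @ x # xs)"
  obtains as1 a as2 where "as = as1 @ a # as2" "length xs = length as1" "length as2 = length ys"
proof
  show "as = take (length xs) as @ as ! length xs # drop (Suc (length xs)) as"
    using assms by (intro id_take_nth_drop) simp
qed (use assms in simp_all)

text \<open>A relation on the \<open>C\<close>-side concerns one or two consecutive steps of the nest. Moving a
  scalar \<open>c\<close> across a tensor sign is harmless because \<open>p (x c) a = p x (c a)\<close> and
  \<open>c p y a = p (c y) a\<close>.\<close>

lemma multibalanced_nest_left:
  assumes "length as = n"
  shows "multibalanced s s B C n (\<lambda>(b, xs). b * nest xs z as)"
proof (rule multibalancedI, goal_cases)
  case (1 b b' xs)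
  show ?case by (simp add: distrib_right)
next
  case (2 r b xs)
  show ?case by (simp add: scale_mult_left)
next
  case (3 b xs x x' ys)
  from 3 assms have "length as = length (xs @ x # ys)" by simp
  then obtain as1 a as2 where "as = as1 @ a # as2" "length ys = length as1" "length as2 = length xs"
    by (rule split_reversed)
  with 3 show ?case by (simp add: nest_middle p_add_left nest_add distrib_left)
next
  case (4 b c x ys)
  from 4 assms have "length as = length ([] @ x # ys)" by simp
  then obtain as1 a as2 where "as = as1 @ a # as2" "length ys = length as1" "length as2 = 0"
    by (rule split_reversed) simp
  with 4 show ?case by (simp add: nest_Cons p_lact mult.assoc)
next
  case (5 b c xs x y ys)
  from 5 assms have "length as = length (xs @ x # y # ys)" by simp
  then obtain as1 a as2 where as: "as = as1 @ a # as2" "length (y # ys) = length as1"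
      "length as2 = length xs"
    by (rule split_reversed)
  then have "as1 \<noteq> []" by auto
  then obtain as0 a' where as1: "as1 = as0 @ [a']" by (cases as1 rule: rev_cases) auto
  from 5 as as1 show ?case
    using nest_middle[of "y # ys" as1 xs "ract C x c"] nest_middle[of "lact C c y # ys" as1 xs x]
    by (simp add: nest_middle nest_Cons p_ract p_lact mult.assoc)
qed

text \<open>On the \<open>A\<close>-side a scalar crosses the tensor sign because \<open>p x (a c) = p x a c\<close>.\<close>

lemma multibalanced_nest_right:
  assumes xs: "xs \<in> lists (mcar C)" and n: "length xs = n"
  shows "multibalanced s s B AA n (\<lambda>(z, as). nest xs z as)"
proof (rule multibalancedI, goal_cases)
  case (1 b b' as)
  with xs n show ?case by (simp add: nest_add)
next
  case (2 r b as)
  with xs n show ?case by (simp add: nest_scale)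
next
  case (3 b as a a' bs)
  define ys x zs where "ys = take (length bs) xs" and "x = xs ! length bs"
      and "zs = drop (Suc (length bs)) xs"
  have eq: "xs = ys @ x # zs" unfolding ys_def x_def zs_def
    using 3 n by (intro id_take_nth_drop) simp
  have "length zs = length as" "length ys = length bs" using 3 n by (simp_all add: zs_def ys_def)
  with eq xs show ?case by (simp add: nest_middle p_add_right nest_add distrib_left)
next
  case (4 b c a as)
  then obtain ys x where "xs = ys @ [x]" using n by (cases xs rule: rev_cases) auto
  then show ?case by (simp add: mult_bimod_def mult.assoc)
next
  case (5 b c as a a' bs)
  define k where "k = length bs"
  define ys x y zs where "ys = take k xs" and "x = xs ! k" and "y = xs ! Suc k"
      and "zs = drop (Suc (Suc k)) xs"
  have "xs = ys @ x # drop (Suc k) xs" unfolding ys_def x_def k_def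
    using 5 n by (intro id_take_nth_drop) simp
  also have "drop (Suc k) xs = y # zs" unfolding y_def zs_def k_def
    using 5 n by (intro Cons_nth_drop_Suc[symmetric]) simp
  finally have eq: "xs = ys @ x # y # zs" .
  have "length zs = length as" "length ys = length bs" using 5 n
    by (simp_all add: zs_def ys_def k_def)
  with eq xs 5 show ?case
    using nest_middle[of "y # zs" "as @ [a * c]" ys x b a' bs]
      nest_middle[of "y # zs" "as @ [a]" ys x b "c * a'" bs]
    by (simp add: nest_Cons mult_bimod_def p_mult_right mult.assoc[symmetric])
qed

text \<open>\<open>pair\<close> extends the iterated pairing to a tensor of \<open>C\<close>, \<open>copair\<close> extends it to a tensor of
  \<open>A\<close>; the respective other argument remains a list.\<close>

definition pair :: "(('a \<times> 'c list \<Rightarrow> 'k) \<Rightarrow> 'k) \<Rightarrow> 'a \<Rightarrow> 'a list \<Rightarrow> 'a" where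
  "pair t z as = vext (\<lambda>(b, xs). b * nest xs z as) t"

definition copair :: "(('a \<times> 'a list \<Rightarrow> 'k) \<Rightarrow> 'k) \<Rightarrow> 'c list \<Rightarrow> 'a" where
  "copair t xs = vext (\<lambda>(z, as). nest xs z as) t"

lemma pair_linear:
  "pair (t + u) z as = pair t z as + pair u z as"
  "pair (pscale r t) z as = s r (pair t z as)"
  "pair 0 z as = 0"
  by (simp_all only: pair_def vext_add vext_pscale vext_0)

lemma copair_linear:
  "copair (t + u) xs = copair t xs + copair u xs"
  "copair (pscale r t) xs = s r (copair t xs)"
  "copair 0 xs = 0"
  by (simp_all only: copair_def vext_add vext_pscale vext_0)

lemma pair_gen: "length xs = length as \<Longrightarrow> pair (cgen (b, xs)) z as = b * nest xs z as"
  unfolding pair_def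
  by (subst vext_gen[OF multibalanced_nest_left]) simp_all

lemma copair_gen:
  "xs \<in> lists (mcar C) \<Longrightarrow> length xs = length as \<Longrightarrow> copair (agen (z, as)) xs = nest xs z as"
  unfolding copair_def
  by (subst vext_gen[OF multibalanced_nest_right]) simp_all

lemma multibalanced_pair:
  assumes "t \<in> cpow n"
  shows "multibalanced s s B AA n (\<lambda>(z, as). pair t z as)"
  using assms
proof (induction rule: tpow_induct)
  case zero
  show ?case unfolding pair_linear split_def by (rule multibalanced_zero) simp
next
  case (gen b xs)
  have "multibalanced s s B AA n (\<lambda>g. b * (case g of (z, as) \<Rightarrow> nest xs z as))"
    using multibalanced_nest_right[OF gen(2,3)]
    by (rule multibalanced_comp) (simp_all add: distrib_left scale_mult_right)
  then show ?case
    by (rule multibalanced_cong[OF _ bimodule_mult]) (simp add: pair_gen gen)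
next
  case (add t u)
  then show ?case
    using multibalanced_add[OF add.IH]
    by (simp add: pair_linear scale_right_distrib split_def del: plus_fun_apply)
qed

lemma pair_mem: "t \<in> cpow n \<Longrightarrow> z \<in> B \<Longrightarrow> length as = n \<Longrightarrow> pair t z as \<in> B"
  by (induction rule: tpow_induct) (simp_all add: pair_linear pair_gen B_mem nest_mem)

text \<open>The last factor, with \<open>w\<close> acting on it, is expanded in the dual basis; the coefficients move
  to the next factor on the left, where the procedure is repeated until they are collected in the
  scalar in front. The list \<open>ys\<close> holds the factors that are already expanded.\<close>

lemma gen_expansion:
  assumes "b \<in> B" "w \<in> B" "xs \<in> lists (mcar C)" "ys \<in> lists (mcar C)"
  shows "cgen (gen_cat C (b, xs) (w, ys)) =
     nested_sum D (length xs) (\<lambda>q. cgen (b * nest xs w (map fst q), rev (map snd q) @ ys))"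
  using assms
proof (induction xs arbitrary: w ys rule: rev_induct)
  case (snoc x xs)
  then have x: "x \<in> mcar C" and xs: "xs \<in> lists (mcar C)" by auto
  have mem: "(case q of (d, c) \<Rightarrow> lact C (p (ract C x w) d) c) \<in> mcar C" if "q \<in> set D" for q
    using that dual_mem[OF that] p_mem x C_mem snoc.prems by (auto simp: case_prod_beta)
  have "cgen (gen_cat C (b, xs @ [x]) (w, ys)) =
      cgen (b, xs @ (\<Sum>(d, c)\<leftarrow>D. lact C (p (ract C x w) d) c) # ys)"
    using snoc.prems x by (simp add: dual_expansion C_mem)
  also have "\<dots> = (\<Sum>q\<leftarrow>D. cgen (b, xs @ (case q of (d, c) \<Rightarrow> lact C (p (ract C x w) d) c) # ys))"
    using snoc.prems(1) xs snoc.prems(4) mem by (rule gen_sum_entry[OF bimodule])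
  also have "\<dots> = (\<Sum>q\<leftarrow>D. nested_sum D (length xs) (\<lambda>qs. cgen (b * nest (xs @ [x]) w (map fst (q # qs)),
      rev (map snd (q # qs)) @ ys)))"
  proof (intro arg_cong[where f = sum_list] map_cong refl)
    fix q assume q: "q \<in> set D"
    obtain d c where dc: "q = (d, c)" by (cases q)
    have c: "c \<in> mcar C" using dual_mem[OF q] dc by simp
    have "cgen (b, xs @ (case q of (d, c) \<Rightarrow> lact C (p (ract C x w) d) c) # ys)
        = cgen (gen_cat C (b, xs) (p x (w * d), c # ys))"
      using gen_cat_lact[of b B "p x (w * d)" xs C c ys s] snoc.prems x xs c
      by (simp add: dc p_ract p_mem)
    also have "\<dots> = nested_sum D (length xs) (\<lambda>qs. cgen (b * nest xs (p x (w * d)) (map fst qs),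
        rev (map snd qs) @ c # ys))"
      using snoc.IH[of "p x (w * d)" "c # ys"] snoc.prems x xs c by (simp add: p_mem)
    finally show "cgen (b, xs @ (case q of (d, c) \<Rightarrow> lact C (p (ract C x w) d) c) # ys) =
        nested_sum D (length xs) (\<lambda>qs. cgen (b * nest (xs @ [x]) w (map fst (q # qs)),
          rev (map snd (q # qs)) @ ys))"
      by (simp add: dc)
  qed
  finally show ?case by simp
qed simp

text \<open>The mirror image of \<open>gen_expansion\<close>: factors are expanded from the left and the coefficients
  move to the right. The list \<open>ps\<close> holds the factors that are already expanded.\<close>

lemma cogen_expansion:
  assumes "w \<in> B"
  shows "agen (gen_cat AA (1, ps) (w, as)) =
     nested_sum D (length as) (\<lambda>q.
         agen (gen_cat AA (1, ps @ map fst q) (nest (rev (map snd q)) w as, [])))"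
  using assms
proof (induction as arbitrary: ps w)
  case (Cons a as)
  have "agen (gen_cat AA (1, ps) (w, a # as)) = agen (1, ps @ (\<Sum>(d, c)\<leftarrow>D. d * p c (w * a)) # as)"
    using gen_cat_lact[of 1 B w ps AA a as s] Cons.prems
    by (simp add: B_mem dual_basis mult_bimod_def)
  also have "\<dots> = (\<Sum>q\<leftarrow>D. agen (1, ps @ (case q of (d, c) \<Rightarrow> d * p c (w * a)) # as))"
    by (rule gen_sum_entry[OF bimodule_mult]) (simp_all add: B_mem mult_bimod_def)
  also have "\<dots> = (\<Sum>q\<leftarrow>D. nested_sum D (length as) (\<lambda>qs. agen (gen_cat AA (1, ps @ map fst (q # qs))
      (nest (rev (map snd (q # qs))) w (a # as), []))))"
  proof (intro arg_cong[where f = sum_list] map_cong refl)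
    fix q assume q: "q \<in> set D"
    obtain d c where dc: "q = (d, c)" by (cases q)
    have c: "c \<in> mcar C" using dual_mem[OF q] dc by simp
    have "agen (1, ps @ (case q of (d, c) \<Rightarrow> d * p c (w * a)) # as)
        = agen (gen_cat AA (1, ps @ [d]) (p c (w * a), as))"
      by (simp only: gen_cat_snoc) (simp add: dc mult_bimod_def)
    also have "\<dots> = nested_sum D (length as) (\<lambda>qs. agen (gen_cat AA (1, (ps @ [d]) @ map fst qs)
        (nest (rev (map snd qs)) (p c (w * a)) as, [])))"
      by (rule Cons.IH) (rule p_mem[OF c])
    finally show "agen (1, ps @ (case q of (d, c) \<Rightarrow> d * p c (w * a)) # as) =
        nested_sum D (length as) (\<lambda>qs. agen (gen_cat AA (1, ps @ map fst (q # qs))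
          (nest (rev (map snd (q # qs))) w (a # as), [])))"
      by (simp add: dc)
  qed
  finally show ?case by simp
qed simp

lemma cogen_ract_add:
  assumes "w \<in> B" "w' \<in> B"
  shows "agen (gen_cat AA (1, ps) (w + w', [])) =
     agen (gen_cat AA (1, ps) (w, [])) + agen (gen_cat AA (1, ps) (w', []))"
proof (cases ps rule: rev_cases)
  case Nil
  then show ?thesis using multibalancedD(1)[OF multibalanced_gen[of s B AA 0] assms, of "[]"] by simp
next
  case (snoc qs q)
  then show ?thesis
    using multibalancedD(3)[OF multibalanced_gen[of s B AA "length ps"] B_mem(1), of qs "q * w"
        "q * w'" "[]"]
    by (simp add: mult_bimod_def distrib_left)
qed

lemma dual_lists: "set q \<subseteq> set D \<Longrightarrow> rev (map snd q) \<in> lists (mcar C)"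
  using dual_mem by (fastforce simp: in_lists_conv_set)

lemma cpow_expansion:
  assumes "t \<in> cpow n"
  shows "nested_sum D n (\<lambda>q. cgen (pair t 1 (map fst q), rev (map snd q))) = t"
  using assms
proof (induction rule: tpow_induct)
  case zero
  have "cgen (0, rev (map snd q)) = 0" if "set q \<subseteq> set D" for q
    using multibalancedD(1)[OF multibalanced_gen B_mem(5) B_mem(5) dual_lists[OF that] refl, of s]
    by simp
  then have "nested_sum D n (\<lambda>q. cgen (pair 0 1 (map fst q), rev (map snd q))) =
      nested_sum D n (\<lambda>q. 0)"
    unfolding pair_linear by (rule nested_sum_cong)
  then show ?case by (simp only: nested_sum_zero)
next
  case (gen b xs)
  have "cgen (b, xs) = cgen (gen_cat C (b, xs) (1, []))"
    using gen gen_cat_one[OF bimodule gen(2), of b "[]"] by simp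
  also have "\<dots> = nested_sum D n (\<lambda>q. cgen (b * nest xs 1 (map fst q), rev (map snd q)))"
    using gen_expansion[of b 1 xs "[]"] gen by (simp add: B_mem)
  also have "\<dots> = nested_sum D n (\<lambda>q. cgen (pair (cgen (b, xs)) 1 (map fst q), rev (map snd q)))"
    using gen by (intro nested_sum_cong) (simp add: pair_gen)
  finally show ?case by simp
next
  case (add t u)
  have "cgen (pair (t + u) 1 (map fst q), rev (map snd q)) =
      cgen (pair t 1 (map fst q), rev (map snd q)) + cgen (pair u 1 (map fst q), rev (map snd q))"
    if "set q \<subseteq> set D" "length q = n" for q
    unfolding pair_linear
    by (rule multibalancedD(1)[OF multibalanced_gen[of s B C n]])
      (use that add.hyps pair_mem B_mem dual_lists in simp_all)
  then have "nested_sum D n (\<lambda>q. cgen (pair (t + u) 1 (map fst q), rev (map snd q))) =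
      nested_sum D n (\<lambda>q. cgen (pair t 1 (map fst q), rev (map snd q)) +
          cgen (pair u 1 (map fst q), rev (map snd q)))"
    by (rule nested_sum_cong)
  with add.IH show ?case by (simp only: nested_sum_add)
qed

text \<open>By \<open>cpow_expansion\<close> a tensor can be recovered from its pairings with lists of dual basis
  elements.\<close>

lemma pair_separates:
  assumes "t \<in> cpow n" "u \<in> cpow n" "\<And>as. length as = n \<Longrightarrow> pair t 1 as = pair u 1 as"
  shows "t = u"
proof -
  have "nested_sum D n (\<lambda>q. cgen (pair t 1 (map fst q), rev (map snd q))) =
      nested_sum D n (\<lambda>q. cgen (pair u 1 (map fst q), rev (map snd q)))"
    by (rule nested_sum_cong) (simp add: assms(3))
  then show ?thesis by (simp only: cpow_expansion assms)
qed

lemma copair_mem: "t \<in> apow n \<Longrightarrow> xs \<in> lists (mcar C) \<Longrightarrow> length xs = n \<Longrightarrow> copair t xs \<in> B"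
  by (induction rule: tpow_induct) (simp_all add: copair_linear copair_gen B_mem nest_mem)

lemma apow_expansion:
  assumes "t \<in> apow n"
  shows "nested_sum D n (\<lambda>q. agen (gen_cat AA (1, map fst q) (copair t (rev (map snd q)), []))) = t"
  using assms
proof (induction rule: tpow_induct)
  case zero
  have "agen (gen_cat AA (1, ps) (0, [])) = 0" for ps
    using cogen_ract_add[OF B_mem(5) B_mem(5), of ps] by simp
  then show ?case by (simp only: copair_linear nested_sum_zero)
next
  case (gen z as)
  have "agen (z, as) = agen (gen_cat AA (1, []) (z, as))" by simp
  also have "\<dots> = nested_sum D n
      (\<lambda>q. agen (gen_cat AA (1, map fst q) (nest (rev (map snd q)) z as, [])))"
    using cogen_expansion[OF gen(1), of "[]" as] gen by simp
  also have "\<dots> = nested_sum D n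
      (\<lambda>q. agen (gen_cat AA (1, map fst q) (copair (agen (z, as)) (rev (map snd q)), [])))"
    using gen dual_lists by (intro nested_sum_cong) (simp add: copair_gen)
  finally show ?case by simp
next
  case (add t u)
  have "agen (gen_cat AA (1, map fst q) (copair (t + u) (rev (map snd q)), [])) =
      agen (gen_cat AA (1, map fst q) (copair t (rev (map snd q)), [])) +
      agen (gen_cat AA (1, map fst q) (copair u (rev (map snd q)), []))"
    if "set q \<subseteq> set D" "length q = n" for q
    unfolding copair_linear
    by (rule cogen_ract_add) (use that add.hyps copair_mem dual_lists in simp_all)
  then have "nested_sum D n (\<lambda>q.
      agen (gen_cat AA (1, map fst q) (copair (t + u) (rev (map snd q)), []))) =
      nested_sum D n (\<lambda>q. agen (gen_cat AA (1, map fst q) (copair t (rev (map snd q)), [])) +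
        agen (gen_cat AA (1, map fst q) (copair u (rev (map snd q)), [])))"
    by (rule nested_sum_cong)
  with add.IH show ?case by (simp only: nested_sum_add)
qed

lemma copair_separates:
  assumes "t \<in> apow n" "u \<in> apow n"
    "\<And>xs. xs \<in> lists (mcar C) \<Longrightarrow> length xs = n \<Longrightarrow> copair t xs = copair u xs"
  shows "t = u"
proof -
  have "nested_sum D n (\<lambda>q. agen (gen_cat AA (1, map fst q) (copair t (rev (map snd q)), []))) =
      nested_sum D n (\<lambda>q. agen (gen_cat AA (1, map fst q) (copair u (rev (map snd q)), [])))"
    by (rule nested_sum_cong) (simp add: assms(3) dual_lists)
  then show ?thesis by (simp only: apow_expansion assms)
qed

end

section \<open>Transposition of cochains\<close>

lemma tpow_hom_ext:
  assumes "\<And>t u. t \<in> mcar (tpow s B M n) \<Longrightarrow> u \<in> mcar (tpow s B M n) \<Longrightarrow> h (t + u) = h t + h u"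
    and "\<And>t u. t \<in> mcar (tpow s B M n) \<Longrightarrow> u \<in> mcar (tpow s B M n) \<Longrightarrow> h' (t + u) = h' t + h' u"
    and "\<And>t. t \<notin> mcar (tpow s B M n) \<Longrightarrow> h t = h' t"
    and "\<And>b xs. b \<in> B \<Longrightarrow> xs \<in> lists (mcar M) \<Longrightarrow> length xs = n \<Longrightarrow>
      h (tpow_gen s B M (b, xs)) = h' (tpow_gen s B M (b, xs))"
  shows "h = (h' :: _ \<Rightarrow> 'v::ab_group_add)"
proof
  fix t show "h t = h' t"
  proof (cases "t \<in> mcar (tpow s B M n)")
    case True
    then show ?thesis
    proof (induction rule: tpow_induct)
      case zero
      show ?case
        using assms(1)[OF tpow_0_mem tpow_0_mem] assms(2)[OF tpow_0_mem tpow_0_mem]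
        by (metis add.right_neutral add_left_cancel)
    next
      case (gen b xs)
      then show ?case by (rule assms(4))
    next
      case (add t u)
      then show ?case by (simp only: assms(1,2))
    qed
  qed (rule assms(3))
qed

lemma bimod_hom_0: "f \<in> bimod_hom B M N \<Longrightarrow> 0 \<in> mcar M \<Longrightarrow> f 0 = 0"
  using bimod_homD(3)[of f B M N 0 0] by simp

lemma bimod_hom_sum:
  assumes f: "f \<in> bimod_hom B M N" and M: "bimodule s B M"
    and "\<And>q. q \<in> set Q \<Longrightarrow> x q \<in> mcar M"
  shows "f (\<Sum>q\<leftarrow>Q. x q) = (\<Sum>q\<leftarrow>Q. f (x q)) \<and> (\<Sum>q\<leftarrow>Q. x q) \<in> mcar M"
  using assms(3)
proof (induction Q)
  case Nil
  show ?case using bimod_hom_0[OF f] bimoduleD(1)[OF M]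
    unfolding list.map sum_list.Nil by blast
next
  case (Cons q Q)
  then show ?case
    using bimod_homD(3)[OF f, of "x q"] bimoduleD(2)[OF M, of "x q"]
    by (simp del: plus_fun_apply)
qed

context dual_pairing
begin

text \<open>The general criterion \<open>multibalanced_separated\<close>, first for tensors of \<open>C\<close>, which are
  separated by \<open>pair\<close>, and then for tensors of \<open>A\<close>, which are separated by \<open>copair\<close>.\<close>

lemma multibalanced_paired:
  assumes "\<And>b xs. b \<in> B \<Longrightarrow> xs \<in> lists (mcar C) \<Longrightarrow> length xs = n \<Longrightarrow> T (b, xs) \<in> cpow m"
    and "\<And>as. length as = m \<Longrightarrow> multibalanced s s B C n (\<lambda>g. pair (T g) 1 as)"
  shows "multibalanced pscale s B C n T"
proof (rule multibalanced_separated[where P = "cpow m" and J = "{as. length as = m}"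
      and L = "\<lambda>as t. pair t 1 as", OF bimodule])
  show "t + u \<in> cpow m" if "t \<in> cpow m" "u \<in> cpow m" for t u using that by (rule tpow_add_mem)
  show "pscale r t \<in> cpow m" if "t \<in> cpow m" for r t using that by (rule tpow_pscale_mem)
  show "pair (pscale r t) 1 as = s r (pair t 1 as)" for r t as by (rule pair_linear)
qed (use assms pair_separates pair_linear(1) in auto)

lemma multibalanced_copaired:
  assumes "\<And>z as. z \<in> B \<Longrightarrow> length as = n \<Longrightarrow> T (z, as) \<in> apow m"
    and "\<And>xs. xs \<in> lists (mcar C) \<Longrightarrow> length xs = m \<Longrightarrow> multibalanced s s B AA n (\<lambda>g. copair (T g) xs)"
  shows "multibalanced pscale s B AA n T"
proof (rule multibalanced_separated[where P = "apow m" and J = "{xs \<in> lists (mcar C). length xs = m}"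
      and L = "\<lambda>xs t. copair t xs", OF bimodule_mult])
  show "t + u \<in> apow m" if "t \<in> apow m" "u \<in> apow m" for t u using that by (rule tpow_add_mem)
  show "pscale r t \<in> apow m" if "t \<in> apow m" for r t using that by (rule tpow_pscale_mem)
  show "copair (pscale r t) xs = s r (copair t xs)" for r t xs by (rule copair_linear)
qed (use assms copair_separates copair_linear(1) in auto)

lemma gen_ract_mem:
  "b \<in> B \<Longrightarrow> c \<in> B \<Longrightarrow> xs \<in> lists (mcar C) \<Longrightarrow> length xs = n \<Longrightarrow> cgen (gen_ract C (b, xs) c) \<in> cpow n"
  using gen_cat_mem[OF bimodule, of b c xs "[]" n] by (simp add: gen_cat_empty B_mem)

lemma cogen_ract_mem:
  "b \<in> B \<Longrightarrow> c \<in> B \<Longrightarrow> length xs = n \<Longrightarrow> agen (gen_ract AA (b, xs) c) \<in> apow n"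
  using gen_cat_mem[OF bimodule_mult, of b c xs "[]" n] by (simp add: gen_cat_empty B_mem)

lemma pair_gen_cat:
  assumes "xs \<in> lists (mcar C)" "w \<in> B" "length ys = length as" "length xs = length bs"
  shows "pair (cgen (gen_cat C (b, xs) (w, ys))) z (as @ bs) = b * nest xs (w * nest ys z as) bs"
proof (cases xs rule: rev_cases)
  case Nil
  with assms show ?thesis by (simp add: pair_gen mult.assoc)
next
  case (snoc xs' x)
  with assms obtain a bs' where bs: "bs = a # bs'" by (cases bs) auto
  from assms snoc bs show ?thesis
    using nest_middle[of ys as xs' "ract C x w" z a bs']
    by (simp add: pair_gen p_ract mult.assoc)
qed

lemma pair_gen_ract:
  assumes "xs \<in> lists (mcar C)" "w \<in> B" "length xs = length as"
  shows "pair (cgen (gen_ract C (b, xs) w)) z as = b * nest xs (w * z) as"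
  using pair_gen_cat[OF assms(1,2) _ assms(3), of "[]" "[]"] by (simp add: gen_cat_empty)

lemma copair_gen_ract:
  assumes "xs \<in> lists (mcar C)" "w \<in> B" "length xs = length as"
  shows "copair (agen (gen_ract AA (z, as) w)) xs = nest xs z as * w"
proof (cases as rule: rev_cases)
  case Nil
  with assms show ?thesis using copair_gen[of "[]" "[]"] by simp
next
  case (snoc as' a)
  with assms obtain x xs' where xs: "xs = x # xs'" by (cases xs) auto
  from assms snoc xs show ?thesis
    by (simp add: copair_gen nest_Cons p_mult_right mult.assoc[symmetric])
qed

lemma multibalanced_lact:
  assumes "c \<in> B"
  shows "multibalanced pscale s B C n (\<lambda>(b, xs). cgen (c * b, xs))"
proof (rule multibalanced_paired)
  fix as :: "'a list" assume n: "length as = n"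
  have "multibalanced s s B C n (\<lambda>g. c * (case g of (b, xs) \<Rightarrow> b * nest xs 1 as))"
    using multibalanced_nest_left[OF n]
    by (rule multibalanced_comp) (simp_all add: distrib_left scale_mult_right)
  then show "multibalanced s s B C n (\<lambda>g. pair (case g of (b, xs) \<Rightarrow> cgen (c * b, xs)) 1 as)"
    by (rule multibalanced_cong[OF _ bimodule]) (simp add: pair_gen n mult.assoc)
qed (simp add: assms B_mem tpow_gen_mem)

lemma multibalanced_ract:
  assumes "c \<in> B"
  shows "multibalanced pscale s B C n (\<lambda>g. cgen (gen_ract C g c))"
proof (rule multibalanced_paired)
  fix as :: "'a list" assume n: "length as = n"
  show "multibalanced s s B C n (\<lambda>g. pair (cgen (gen_ract C g c)) 1 as)"
    using multibalanced_nest_left[OF n]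
    by (rule multibalanced_cong[OF _ bimodule]) (simp add: pair_gen_ract n assms)
qed (rule gen_ract_mem[OF _ assms])

lemma multibalanced_colact:
  assumes "c \<in> B"
  shows "multibalanced pscale s B AA n (\<lambda>(z, as). agen (c * z, as))"
proof (rule multibalanced_copaired)
  fix xs assume xs: "xs \<in> lists (mcar C)" and n: "length xs = n"
  from multibalanced_pair[OF gen_ract_mem[OF B_mem(1) assms xs n]]
  show "multibalanced s s B AA n (\<lambda>g. copair (case g of (z, as) \<Rightarrow> agen (c * z, as)) xs)"
    by (rule multibalanced_cong[OF _ bimodule_mult])
      (simp add: copair_gen pair_gen_ract assms xs n)
qed (simp add: assms B_mem tpow_gen_mem)

lemma multibalanced_coract:
  assumes "c \<in> B"
  shows "multibalanced pscale s B AA n (\<lambda>g. agen (gen_ract AA g c))"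
proof (rule multibalanced_copaired)
  fix xs assume xs: "xs \<in> lists (mcar C)" and n: "length xs = n"
  have "multibalanced s s B AA n (\<lambda>g. (case g of (z, as) \<Rightarrow> nest xs z as) * c)"
    using multibalanced_nest_right[OF xs n]
    by (rule multibalanced_comp) (simp_all add: distrib_right scale_mult_left)
  then show "multibalanced s s B AA n (\<lambda>g. copair (agen (gen_ract AA g c)) xs)"
    by (rule multibalanced_cong[OF _ bimodule_mult]) (simp add: copair_gen_ract assms xs n)
qed (rule cogen_ract_mem[OF _ assms])

lemma lact_add: "lact (tpow s B M n) c (t + u) = lact (tpow s B M n) c t + lact (tpow s B M n) c u"
  by (simp add: tpow_def lin_ext_add del: plus_fun_apply)

lemma ract_add: "ract (tpow s B M n) (t + u) c = ract (tpow s B M n) t c + ract (tpow s B M n) u c"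
  by (simp add: tpow_def lin_ext_add del: plus_fun_apply)

lemma lact_0: "lact (tpow s B M n) c 0 = 0"
  by (simp add: tpow_def lin_ext_0 del: zero_fun_apply)

lemma ract_0: "ract (tpow s B M n) 0 c = 0"
  by (simp add: tpow_def lin_ext_0 del: zero_fun_apply)

lemma lact_pscale: "lact (tpow s B M n) c (pscale r t) = pscale r (lact (tpow s B M n) c t)"
  by (simp add: tpow_def lin_ext_pscale)

lemma ract_pscale: "ract (tpow s B M n) (pscale r t) c = pscale r (ract (tpow s B M n) t c)"
  by (simp add: tpow_def lin_ext_pscale)

lemma lact_gen: "c \<in> B \<Longrightarrow> length xs = n \<Longrightarrow> lact (tpow s B C n) c (cgen (b, xs)) = cgen (c * b, xs)"
  using lin_ext_gen[OF multibalanced_lact] by (simp add: tpow_def)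

lemma ract_gen: "c \<in> B \<Longrightarrow> length xs = n \<Longrightarrow>
    ract (tpow s B C n) (cgen (b, xs)) c = cgen (gen_ract C (b, xs) c)"
  using lin_ext_gen[OF multibalanced_ract] by (simp add: tpow_def)

lemma colact_gen: "c \<in> B \<Longrightarrow> length as = n \<Longrightarrow> lact (tpow s B AA n) c (agen (z, as)) = agen (c * z, as)"
  using lin_ext_gen[OF multibalanced_colact] by (simp add: tpow_def)

lemma coract_gen: "c \<in> B \<Longrightarrow> length as = n \<Longrightarrow>
    ract (tpow s B AA n) (agen (z, as)) c = agen (gen_ract AA (z, as) c)"
  using lin_ext_gen[OF multibalanced_coract] by (simp add: tpow_def)

lemma lact_pair:
  assumes "t \<in> cpow n" "c \<in> B"
  shows "lact (tpow s B C n) c t \<in> cpow n \<and>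
     (\<forall>z as. length as = n \<longrightarrow> pair (lact (tpow s B C n) c t) z as = c * pair t z as)"
  using assms(1)
proof (induction rule: tpow_induct)
  case zero
  show ?case by (simp only: lact_0 pair_linear mult_zero_right tpow_0_mem simp_thms)
next
  case (gen b xs)
  with assms(2) show ?case by (simp add: lact_gen tpow_gen_mem B_mem pair_gen mult.assoc)
next
  case (add t u)
  then show ?case by (simp add: lact_add pair_linear tpow_add_mem distrib_left del: plus_fun_apply)
qed

lemma ract_pair:
  assumes "t \<in> cpow n" "c \<in> B"
  shows "ract (tpow s B C n) t c \<in> cpow n \<and>
     (\<forall>z as. length as = n \<longrightarrow> pair (ract (tpow s B C n) t c) z as = pair t (c * z) as)"
  using assms(1)
proof (induction rule: tpow_induct)
  case zero
  show ?case by (simp only: ract_0 pair_linear tpow_0_mem simp_thms)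
next
  case (gen b xs)
  with assms(2) show ?case by (simp add: ract_gen gen_ract_mem pair_gen_ract pair_gen)
next
  case (add t u)
  then show ?case by (simp add: ract_add pair_linear tpow_add_mem del: plus_fun_apply)
qed

lemma pair_ract_right:
  assumes "t \<in> cpow n" "length as = n" "c \<in> B"
  shows "pair t (fst (gen_ract AA (z, as) c)) (snd (gen_ract AA (z, as) c)) = pair t z as * c"
  using assms(1)
proof (induction rule: tpow_induct)
  case zero
  show ?case by (simp only: pair_linear mult_zero_left)
next
  case (gen b xs)
  then have "nest xs (fst (gen_ract AA (z, as) c)) (snd (gen_ract AA (z, as) c)) = nest xs z as * c"
    using copair_gen_ract[of xs c as z] assms copair_gen[of xs "snd (gen_ract AA (z, as) c)"]
    by (cases as rule: rev_cases) simp_all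
  moreover have "length (snd (gen_ract AA (z, as) c)) = n"
    using assms(2) by (cases as rule: rev_cases) simp_all
  ultimately show ?case
    using gen assms by (simp add: pair_gen mult.assoc)
next
  case (add t u)
  then show ?case by (simp add: pair_linear distrib_right del: plus_fun_apply)
qed

abbreviation "CC n \<equiv> bimod_hom B C (tpow s B C n)"

lemma separates_A: "(\<And>x. x \<in> mcar C \<Longrightarrow> p x a = p x a') \<Longrightarrow> a = a'"
proof -
  assume eq: "\<And>x. x \<in> mcar C \<Longrightarrow> p x a = p x a'"
  have "(\<Sum>(d, c)\<leftarrow>D. d * p c a) = (\<Sum>(d, c)\<leftarrow>D. d * p c a')"
    using eq dual_mem by (intro arg_cong[where f = sum_list] map_cong) auto
  then show ?thesis by (simp only: dual_basis)
qed

lemma cochain_ext: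
  assumes "f \<in> CC n" "f' \<in> CC n"
    and "\<And>x as. x \<in> mcar C \<Longrightarrow> length as = n \<Longrightarrow> pair (f x) 1 as = pair (f' x) 1 as"
  shows "f = f'"
proof
  fix x show "f x = f' x"
    using assms bimod_homD(1,2)[OF assms(1)] bimod_homD(1,2)[OF assms(2)]
    by (cases "x \<in> mcar C") (auto intro!: pair_separates)
qed

lemma hochschild_ext:
  assumes "h \<in> HH n" "h' \<in> HH n"
    and "\<And>x z as. x \<in> mcar C \<Longrightarrow> z \<in> B \<Longrightarrow> length as = n \<Longrightarrow> p x (h (agen (z, as))) =
        p x (h' (agen (z, as)))"
  shows "h = h'"
proof (rule tpow_hom_ext[where s = s and B = B and M = AA and n = n])
  show "h (agen (b, xs)) = h' (agen (b, xs))" if "b \<in> B" "length xs = n" for b xs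
    by (rule separates_A) (use that assms(3) in blast)
  show "h t = h' t" if "t \<notin> apow n" for t
    using bimod_homD(2)[OF assms(1) that] bimod_homD(2)[OF assms(2) that] by simp
qed (simp_all only: bimod_homD(3)[OF assms(1)] bimod_homD(3)[OF assms(2)])

text \<open>The transpose \<open>h\<close> of \<open>f\<close> is characterised by \<open>p x (h t) = \<langle>f x, t\<rangle>\<close>. The dual basis turns
  this into a formula: \<open>h t\<close> is the sum of all \<open>d p c (h t) = d \<langle>f c, t\<rangle>\<close>.\<close>

definition hochschild_of :: "nat \<Rightarrow> ('c \<Rightarrow> ('a \<times> 'c list \<Rightarrow> 'k) \<Rightarrow> 'k) \<Rightarrow> (('a \<times> 'a list \<Rightarrow> 'k) \<Rightarrow> 'k) \<Rightarrow>
    'a" where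
  "hochschild_of n f t = (if t \<in> apow n then vext (\<lambda>(z, as). \<Sum>(d, c)\<leftarrow>D. d * pair (f c) z as) t else
      0)"

lemma hochschild_of_add: "t \<in> apow n \<Longrightarrow> u \<in> apow n \<Longrightarrow> hochschild_of n f (t + u) =
    hochschild_of n f t + hochschild_of n f u"
  by (simp add: hochschild_of_def vext_add tpow_add_mem del: plus_fun_apply)

lemma hochschild_of_gen:
  assumes f: "f \<in> CC n" and z: "z \<in> B" and as: "length as = n"
  shows "hochschild_of n f (agen (z, as)) = (\<Sum>(d, c)\<leftarrow>D. d * pair (f c) z as)"
proof -
  have one: "multibalanced s s B AA n (\<lambda>g. d * (case g of (z, as) \<Rightarrow> pair (f c) z as))"
    if "c \<in> mcar C" for c d
    using multibalanced_pair[OF bimod_homD(1)[OF f that]]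
    by (rule multibalanced_comp) (simp_all add: distrib_left scale_mult_right)
  have "multibalanced s s B AA n (\<lambda>g. \<Sum>q\<leftarrow>Q. fst q * (case g of (z, as) \<Rightarrow> pair (f (snd q)) z as))"
    if "set Q \<subseteq> set D" for Q
    using that
  proof (induction Q)
    case Nil
    show ?case by (simp add: multibalanced_zero)
  next
    case (Cons q Q)
    then show ?case using multibalanced_add[OF one[of "snd q" "fst q"] Cons.IH] dual_mem
      by (simp add: scale_right_distrib)
  qed
  from this[OF order_refl] have bal:
      "multibalanced s s B AA n (\<lambda>(z, as). \<Sum>(d, c)\<leftarrow>D. d * pair (f c) z as)"
    by (simp only: split_def)
  show ?thesis
    using vext_gen[OF bal as] tpow_gen_mem[OF z, of as AA n s] as by (simp add: hochschild_of_def)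
qed

lemma pair_lmult:
  assumes f: "f \<in> CC n" and x: "x \<in> mcar C" and as: "length as = n"
  shows "(\<Sum>(d, c)\<leftarrow>D. p x d * pair (f c) z as) = pair (f x) z as"
proof -
  have mem: "(case q of (d, c) \<Rightarrow> lact C (p x d) c) \<in> mcar C" if "q \<in> set D" for q
    using dual_mem[OF that] p_mem[OF x] C_mem by (auto simp: case_prod_beta)
  have "f x = f (\<Sum>(d, c)\<leftarrow>D. lact C (p x d) c)"
    by (simp only: dual_expansion[OF x])
  also have "\<dots> = (\<Sum>q\<leftarrow>D. f (case q of (d, c) \<Rightarrow> lact C (p x d) c))"
    using bimod_hom_sum[OF f bimodule, where x = "\<lambda>(d, c). lact C (p x d) c"] mem by blast
  finally have "pair (f x) z as = pair (\<Sum>q\<leftarrow>D. f (case q of (d, c) \<Rightarrow> lact C (p x d) c)) z as"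
    by simp
  also have "\<dots> = (\<Sum>q\<leftarrow>D. pair (f (case q of (d, c) \<Rightarrow> lact C (p x d) c)) z as)"
    by (induction D) (simp_all add: pair_linear del: plus_fun_apply zero_fun_apply)
  also have "\<dots> = (\<Sum>(d, c)\<leftarrow>D. p x d * pair (f c) z as)"
  proof (intro arg_cong[where f = sum_list] map_cong refl)
    fix q assume q: "q \<in> set D"
    show "pair (f (case q of (d, c) \<Rightarrow> lact C (p x d) c)) z as =
        (case q of (d, c) \<Rightarrow> p x d * pair (f c) z as)"
      using dual_mem[OF q] p_mem[OF x] as lact_pair[OF bimod_homD(1)[OF f]]
      by (auto simp: case_prod_beta bimod_homD(4)[OF f])
  qed
  finally show ?thesis by simp
qed

lemma pair_hochschild_of:
  assumes f: "f \<in> CC n" and x: "x \<in> mcar C" and z: "z \<in> B" and as: "length as = n"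
  shows "p x (hochschild_of n f (agen (z, as))) = pair (f x) z as"
proof -
  have "p x (hochschild_of n f (agen (z, as))) = (\<Sum>q\<leftarrow>D. p x (case q of (d, c) \<Rightarrow> d * pair (f c) z as))"
    unfolding hochschild_of_gen[OF f z as] by (rule p_sum_right[OF x])
  also have "\<dots> = (\<Sum>(d, c)\<leftarrow>D. p x d * pair (f c) z as)"
  proof (intro arg_cong[where f = sum_list] map_cong refl)
    fix q assume q: "q \<in> set D"
    show "p x (case q of (d, c) \<Rightarrow> d * pair (f c) z as) = (case q of (d, c) \<Rightarrow> p x d * pair (f c) z as)"
      using dual_mem[OF q] x pair_mem[OF bimod_homD(1)[OF f] z as]
      by (auto simp: case_prod_beta p_mult_right)
  qed
  also have "\<dots> = pair (f x) z as" by (rule pair_lmult[OF f x as])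
  finally show ?thesis .
qed

lemma hochschild_of_hom:
  assumes f: "f \<in> CC n"
  shows "hochschild_of n f \<in> HH n"
proof (rule bimod_homI)
  have 0: "hochschild_of n f 0 = 0" using tpow_0_mem[of s B AA n]
    by (simp add: hochschild_of_def vext_0 del: zero_fun_apply)
  fix a t assume a: "a \<in> B" and t: "t \<in> apow n"
  have "lact (tpow s B AA n) a t \<in> apow n \<and> hochschild_of n f (lact (tpow s B AA n) a t) =
      a * hochschild_of n f t"
    using t
  proof (induction rule: tpow_induct)
    case zero
    show ?case by (simp only: lact_0 0 tpow_0_mem mult_zero_right simp_thms)
  next
    case (gen z as)
    have "p x (hochschild_of n f (agen (a * z, as))) = p x (a * hochschild_of n f (agen (z, as)))"
      if x: "x \<in> mcar C" for x
      using pair_hochschild_of[OF f x _ gen(3)] pair_hochschild_of[OF f C_mem(5)[OF a x] gen(1,3)]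
        ract_pair[OF bimod_homD(1)[OF f x] a] gen a x
      by (simp add: B_mem bimod_homD(5)[OF f] p_ract)
    then have "hochschild_of n f (agen (a * z, as)) = a * hochschild_of n f (agen (z, as))"
      by (rule separates_A)
    then show ?case
      using gen a by (simp add: colact_gen tpow_gen_mem B_mem)
  next
    case (add t u)
    then show ?case by (simp add: lact_add hochschild_of_add tpow_add_mem distrib_left del:
        plus_fun_apply)
  qed
  then show "hochschild_of n f (lact (tpow s B AA n) a t) = lact AA a (hochschild_of n f t)" by simp
  have "ract (tpow s B AA n) t a \<in> apow n \<and> hochschild_of n f (ract (tpow s B AA n) t a) =
      hochschild_of n f t * a"
    using t
  proof (induction rule: tpow_induct)
    case zero
    show ?case by (simp only: ract_0 0 tpow_0_mem mult_zero_left simp_thms)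
  next
    case (gen z as)
    obtain z' as' where g: "gen_ract AA (z, as) a = (z', as')" by (cases "gen_ract AA (z, as) a")
    then have "z' \<in> B" "length as' = n"
      using gen a by (cases as rule: rev_cases; auto simp: B_mem)+
    then have "p x (hochschild_of n f (agen (z', as'))) = p x (hochschild_of n f (agen (z, as)) * a)"
      if x: "x \<in> mcar C" for x
      using pair_hochschild_of[OF f x] gen pair_ract_right[OF bimod_homD(1)[OF f x] gen(3) a, of z]
          g a x
      by (simp add: p_mult_right)
    then have "hochschild_of n f (agen (z', as')) = hochschild_of n f (agen (z, as)) * a"
      by (rule separates_A)
    then show ?case
      using gen a cogen_ract_mem[OF gen(1) a gen(3)] by (simp add: coract_gen g)
  next
    case (add t u)
    then show ?case by (simp add: ract_add hochschild_of_add tpow_add_mem distrib_right del: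
        plus_fun_apply)
  qed
  then show "hochschild_of n f (ract (tpow s B AA n) t a) = ract AA (hochschild_of n f t) a" by simp
next
  show "hochschild_of n f (t + u) = hochschild_of n f t + hochschild_of n f u"
    if "t \<in> apow n" "u \<in> apow n" for t u
    using that by (rule hochschild_of_add)
qed (simp_all add: hochschild_of_def)

text \<open>The inverse of transposition: the tensor whose pairings are \<open>p x (h t)\<close>, recovered from its
  pairings with dual basis elements as in \<open>cpow_expansion\<close>.\<close>

definition cartier_of :: "nat \<Rightarrow> ((('a \<times> 'a list \<Rightarrow> 'k) \<Rightarrow> 'k) \<Rightarrow> 'a) \<Rightarrow> 'c \<Rightarrow> ('a \<times> 'c list \<Rightarrow> 'k) \<Rightarrow> 'k"
    where
  "cartier_of n h x = (if x \<in> mcar C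
     then nested_sum D n (\<lambda>q. cgen (p x (h (agen (1, map fst q))), rev (map snd q))) else 0)"

lemma cartier_of_mem: "x \<in> mcar C \<Longrightarrow> cartier_of n h x \<in> cpow n"
  unfolding cartier_of_def if_P
  by (rule nested_sum_mem)
    (simp_all add: tpow_0_mem tpow_add_mem tpow_gen_mem p_mem dual_lists del:
        plus_fun_apply zero_fun_apply)

text \<open>Pairing the dual basis expansion with a list moves the scalars \<open>nest \<dots>\<close> into the argument of
  \<open>h\<close>, by right linearity; there \<open>cogen_expansion\<close> reassembles the original tensor.\<close>

lemma pair_cartier_of:
  assumes h: "h \<in> HH n" and x: "x \<in> mcar C" and z: "z \<in> B" and as: "length as = n"
  shows "pair (cartier_of n h x) z as = p x (h (agen (z, as)))"
proof -
  have "pair (cartier_of n h x) z as =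
      pair (nested_sum D n (\<lambda>q. cgen (p x (h (agen (1, map fst q))), rev (map snd q)))) z as"
    using x by (simp only: cartier_of_def if_True)
  also have "\<dots> = nested_sum D n
      (\<lambda>q. pair (cgen (p x (h (agen (1, map fst q))), rev (map snd q))) z as)"
    by (rule nested_sum_hom[where h = "\<lambda>t. pair t z as" and P = UNIV])
        (simp_all only: pair_linear UNIV_I)
  also have "\<dots> = nested_sum D n
      (\<lambda>q. p x (h (agen (gen_cat AA (1, map fst q) (nest (rev (map snd q)) z as, [])))))"
  proof (rule nested_sum_cong)
    fix q assume q: "set q \<subseteq> set D" "length q = n"
    define w where "w = nest (rev (map snd q)) z as"
    have w: "w \<in> B" unfolding w_def using nest_mem z dual_lists[OF q(1)] by blast
    have "agen (1, map fst q) \<in> apow n" using q by (simp add: tpow_gen_mem B_mem)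
    then have "p x (h (agen (1, map fst q))) * w =
        p x (h (ract (tpow s B AA n) (agen (1, map fst q)) w))"
      using bimod_homD(5)[OF h w] p_mult_right[OF x w] by simp
    also have "\<dots> = p x (h (agen (gen_cat AA (1, map fst q) (w, []))))"
      using w q by (simp add: coract_gen gen_cat_empty)
    finally show "pair (cgen (p x (h (agen (1, map fst q))), rev (map snd q))) z as =
        p x (h (agen (gen_cat AA (1, map fst q) (nest (rev (map snd q)) z as, []))))"
      using q as by (simp add: pair_gen w_def)
  qed
  also have "\<dots> = p x (h (nested_sum D n
      (\<lambda>q. agen (gen_cat AA (1, map fst q) (nest (rev (map snd q)) z as, [])))))"
  proof (rule nested_sum_hom[where h = "\<lambda>t. p x (h t)" and P = "apow n", symmetric])
    show "p x (h 0) = 0"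
      using bimod_hom_0[OF h tpow_0_mem] p_add_right[OF x, of 0 0] by simp
    show "p x (h (t + u)) = p x (h t) + p x (h u)" if "t \<in> apow n" "u \<in> apow n" for t u
      using bimod_homD(3)[OF h that] p_add_right[OF x] by simp
    show "agen (gen_cat AA (1, map fst q) (nest (rev (map snd q)) z as, [])) \<in> apow n"
      if "set q \<subseteq> set D" "length q = n" for q
      using that nest_mem z dual_lists[OF that(1)]
      by (intro gen_cat_mem[OF bimodule_mult]) (simp_all add: B_mem)
  qed (simp_all add: tpow_0_mem tpow_add_mem del: plus_fun_apply zero_fun_apply)
  also have "\<dots> = p x (h (agen (z, as)))"
    using cogen_expansion[OF z, of "[]" as] as by simp
  finally show ?thesis .
qed

lemma cartier_of_hom:
  assumes h: "h \<in> HH n"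
  shows "cartier_of n h \<in> CC n"
proof (rule bimod_homI)
  show "cartier_of n h (x + y) = cartier_of n h x + cartier_of n h y"
    if "x \<in> mcar C" "y \<in> mcar C" for x y
    by (rule pair_separates[of _ n])
      (simp_all add: pair_cartier_of[OF h] that C_mem B_mem p_add_left pair_linear cartier_of_mem
          tpow_add_mem
        del: plus_fun_apply)
  fix b x assume b: "b \<in> B" and x: "x \<in> mcar C"
  show "cartier_of n h (lact C b x) = lact (tpow s B C n) b (cartier_of n h x)"
    by (rule pair_separates[of _ n])
      (simp_all add: pair_cartier_of[OF h] b x C_mem B_mem p_lact cartier_of_mem lact_pair)
  have "pair (cartier_of n h (ract C x b)) 1 as =
      pair (ract (tpow s B C n) (cartier_of n h x) b) 1 as"
    if as: "length as = n" for as
  proof -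
    have "pair (cartier_of n h (ract C x b)) 1 as = p x (b * h (agen (1, as)))"
      by (simp add: pair_cartier_of[OF h] b x C_mem B_mem p_ract as)
    also have "\<dots> = p x (h (agen (b * 1, as)))"
      using bimod_homD(4)[OF h b, of "agen (1, as)"] as b
      by (simp add: colact_gen tpow_gen_mem B_mem)
    also have "\<dots> = pair (ract (tpow s B C n) (cartier_of n h x) b) 1 as"
      using ract_pair[OF cartier_of_mem[OF x] b] pair_cartier_of[OF h x] as b by (simp add: B_mem)
    finally show ?thesis .
  qed
  then show "cartier_of n h (ract C x b) = ract (tpow s B C n) (cartier_of n h x) b"
    using b x by (intro pair_separates[of _ n]) (simp_all add: C_mem cartier_of_mem ract_pair)
next
  show "cartier_of n h x \<in> cpow n" if "x \<in> mcar C" for x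
    using that by (rule cartier_of_mem)
qed (simp add: cartier_of_def)

lemma hochschild_of_bij: "bij_betw (hochschild_of n) (CC n) (HH n)"
proof (rule bij_betw_byWitness[where f' = "cartier_of n"])
  show "\<forall>f\<in>CC n. cartier_of n (hochschild_of n f) = f"
    by (auto intro!: cochain_ext simp:
        cartier_of_hom hochschild_of_hom pair_cartier_of pair_hochschild_of B_mem)
  show "\<forall>h\<in>HH n. hochschild_of n (cartier_of n h) = h"
    by (auto intro!: hochschild_ext simp:
        cartier_of_hom hochschild_of_hom pair_cartier_of pair_hochschild_of)
qed (auto simp: cartier_of_hom hochschild_of_hom)

section \<open>Compatibility with partial compositions\<close>

lemma hochschild_of_cartier_of: "h \<in> HH n \<Longrightarrow> hochschild_of n (cartier_of n h) = h"
  by (rule hochschild_ext[of _ n])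
      (simp_all add: cartier_of_hom hochschild_of_hom pair_cartier_of pair_hochschild_of)

lemma split_list3:
  assumes "length as = k + n + l"
  obtains as2 as1 as0 where "as = as2 @ as1 @ as0" "length as2 = k" "length as1 = n" "length as0 = l"
proof
  show "as = take k as @ take n (drop k as) @ drop (k + n) as"
    by (metis append_take_drop_id drop_drop add.commute)
qed (use assms in simp_all)

text \<open>Concatenation is extended in two stages, first in the second tensor, then in the first one.\<close>

lemma tcat_inner:
  assumes b: "b \<in> B" and xs: "xs \<in> lists (mcar C)" "length xs = i"
  shows "multibalanced pscale s B C j (\<lambda>h. cgen (gen_cat C (b, xs) h))"
proof (rule multibalanced_paired[where m = "i + j"])
  show "cgen (gen_cat C (b, xs) (w, ys)) \<in> cpow (i + j)"
    if "w \<in> B" "ys \<in> lists (mcar C)" "length ys = j" for w ys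
    using that b xs by (intro gen_cat_mem[OF bimodule]) (simp_all add: B_mem)
  fix as :: "'a list" assume "length as = i + j"
  then have as: "length (take j as) = j" "length (drop j as) = i" by simp_all
  have "multibalanced s s B C j
      (\<lambda>g. b * nest xs (case g of (w, ys) \<Rightarrow> w * nest ys 1 (take j as)) (drop j as))"
    using multibalanced_nest_left[OF as(1)]
    by (rule multibalanced_comp)
      (use xs as in \<open>simp_all add: nest_add nest_scale distrib_left scale_mult_right\<close>)
  then show "multibalanced s s B C j (\<lambda>g. pair (cgen (gen_cat C (b, xs) g)) 1 as)"
  proof (rule multibalanced_cong[OF _ bimodule])
    fix w ys assume "w \<in> B" "ys \<in> lists (mcar C)" "length ys = j"
    then show "pair (cgen (gen_cat C (b, xs) (w, ys))) 1 as =
        b * nest xs (case (w, ys) of (w, ys) \<Rightarrow> w * nest ys 1 (take j as)) (drop j as)"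
      using pair_gen_cat[of xs w ys "take j as" "drop j as" b 1] xs as by simp
  qed
qed

lemma tcat_inner_pair:
  assumes u: "u \<in> cpow j" and b: "b \<in> B" and xs: "xs \<in> lists (mcar C)" "length xs = i"
  shows "lin_ext (\<lambda>h. cgen (gen_cat C (b, xs) h)) u \<in> cpow (i + j) \<and>
     (\<forall>z as bs. length as = j \<longrightarrow> length bs = i \<longrightarrow>
        pair (lin_ext (\<lambda>h. cgen (gen_cat C (b, xs) h)) u) z (as @ bs) = b * nest xs (pair u z as) bs)"
  using u
proof (induction rule: tpow_induct)
  case zero
  have "nest xs 0 bs = 0" if "length bs = i" for bs
    using nest_scale[OF xs(1), of bs 0 0] xs that by simp
  then show ?case
    by (simp add: lin_ext_0 pair_linear tpow_0_mem del: zero_fun_apply)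
next
  case (gen w ys)
  then show ?case
    using b xs lin_ext_gen[OF tcat_inner[OF b xs] gen(3)]
        gen_cat_mem[OF bimodule b gen(1) B_mem(3)[OF b gen(1)] xs(1) gen(2)]
    by (simp add: pair_gen_cat pair_gen)
next
  case (add t u)
  then show ?case
    using xs by (simp add: lin_ext_add pair_linear tpow_add_mem nest_add distrib_left del:
        plus_fun_apply)
qed

text \<open>The right-hand tensor is evaluated first, on the first arguments; its value is the starting
  value for the left-hand tensor.\<close>

lemma tcat_pair:
  assumes t: "t \<in> cpow i" and u: "u \<in> cpow j"
  shows "tcat s B C t u \<in> cpow (i + j) \<and>
     (\<forall>z as bs. length as = j \<longrightarrow> length bs = i \<longrightarrow>
        pair (tcat s B C t u) z (as @ bs) = pair t (pair u z as) bs)"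
proof -
  define G where "G g = lin_ext (\<lambda>h. cgen (gen_cat C g h)) u" for g
  have G: "G (b, xs) \<in> cpow (i + j)"
      "length as = j \<Longrightarrow> length bs = i \<Longrightarrow> pair (G (b, xs)) z (as @ bs) = b * nest xs (pair u z as) bs"
    if "b \<in> B" "xs \<in> lists (mcar C)" "length xs = i" for b xs z as bs
    using tcat_inner_pair[OF u that] by (simp_all add: G_def)
  have bal: "multibalanced pscale s B C i G"
  proof (rule multibalanced_paired[where m = "i + j"])
    show "G (b, xs) \<in> cpow (i + j)" if "b \<in> B" "xs \<in> lists (mcar C)" "length xs = i" for b xs
      using that by (rule G(1))
    fix as :: "'a list" assume "length as = i + j"
    then have as: "length (take j as) = j" "length (drop j as) = i" by simp_all
    show "multibalanced s s B C i (\<lambda>g. pair (G g) 1 as)"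
      using multibalanced_nest_left[OF as(2), of "pair u 1 (take j as)"]
    proof (rule multibalanced_cong[OF _ bimodule])
      fix b xs assume "b \<in> B" "xs \<in> lists (mcar C)" "length xs = i"
      from G(2)[OF this as, of 1]
      show "pair (G (b, xs)) 1 as =
          (case (b, xs) of (b, xs) \<Rightarrow> b * nest xs (pair u 1 (take j as)) (drop j as))"
        by simp
    qed
  qed
  have tcat: "tcat s B C t u = lin_ext G t" for t
    by (simp add: tcat_def G_def[abs_def])
  show ?thesis
    unfolding tcat using t
  proof (induction rule: tpow_induct)
    case zero
    show ?case by (simp add: lin_ext_0 pair_linear tpow_0_mem del: zero_fun_apply)
  next
    case (gen b xs)
    then show ?case by (simp add: lin_ext_gen[OF bal] G pair_gen)
  next
    case (add t u)
    then show ?case by (simp add: lin_ext_add pair_linear tpow_add_mem del: plus_fun_apply)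
  qed
qed

lemma hochschild_lact_one:
  assumes "h \<in> HH n" "z \<in> B" "length as = n"
  shows "h (agen (z, as)) = z * h (agen (1, as))"
  using bimod_homD(4)[OF assms(1,2), of "agen (1, as)"] assms(2,3)
  by (simp add: colact_gen tpow_gen_mem B_mem)

text \<open>In the nest, the factors to the right of position \<open>i\<close> consume the list \<open>as\<close> and produce a
  scalar \<open>w\<close>. Then the tensor \<open>g x\<close> replacing the factor \<open>x\<close> consumes \<open>bs\<close> and produces
  \<open>p x (w h)\<close>, where \<open>h\<close> is the value of the transpose of \<open>g\<close> at \<open>bs\<close>. This is the step of the
  nest in which \<open>x\<close> meets the single argument \<open>h\<close>.\<close>

lemma apply_at_pair:
  assumes g: "g \<in> CC n" and t: "t \<in> cpow m" and i: "i < m"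
  shows "apply_at s B C i g t \<in> cpow (m + n - 1) \<and>
     (\<forall>z as bs cs. z \<in> B \<longrightarrow> length as = m - 1 - i \<longrightarrow> length bs = n \<longrightarrow> length cs = i \<longrightarrow>
        pair (apply_at s B C i g t) z (as @ bs @ cs) =
          pair t z (as @ hochschild_of n g (agen (1, bs)) # cs))"
proof -
  define T where "T = (\<lambda>(b, xs). tcat s B C (tcat s B C (cgen (b, take i xs)) (g (xs ! i)))
      (cgen (1, drop (Suc i) xs)))"
  have T: "T (b, xs) \<in> cpow (m + n - 1) \<and>
      (\<forall>z as bs cs. z \<in> B \<longrightarrow> length as = m - 1 - i \<longrightarrow> length bs = n \<longrightarrow> length cs = i \<longrightarrow>
        pair (T (b, xs)) z (as @ bs @ cs) =
            b * nest xs z (as @ hochschild_of n g (agen (1, bs)) # cs))"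
    if b: "b \<in> B" and xs: "xs \<in> lists (mcar C)" "length xs = m" for b xs
  proof -
    have xi: "xs ! i \<in> mcar C" using xs i by (auto simp: in_lists_conv_set)
    have take: "take i xs \<in> lists (mcar C)" and drop: "drop (Suc i) xs \<in> lists (mcar C)"
      using xs(1) by (auto simp: in_lists_conv_set dest: in_set_takeD in_set_dropD)
    have 0: "cgen (b, take i xs) \<in> cpow i" and 2: "cgen (1, drop (Suc i) xs) \<in> cpow (m - 1 - i)"
      using take drop b xs i by (auto intro!: tpow_gen_mem simp: B_mem)
    note 1 = bimod_homD(1)[OF g xi]
    note 01 = tcat_pair[OF 0 1]
    note 012 = tcat_pair[OF conjunct1[OF 01] 2]
    have eq: "i + n + (m - 1 - i) = m + n - 1" using i by simp
    show ?thesis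
    proof (intro conjI allI impI)
      show "T (b, xs) \<in> cpow (m + n - 1)"
        using conjunct1[OF 012] by (simp only: T_def prod.case eq)
      fix z :: 'a and as bs cs :: "'a list"
      assume z: "z \<in> B" and len: "length as = m - 1 - i" "length bs = n" "length cs = i"
      define w where "w = nest (drop (Suc i) xs) z as"
      have w: "w \<in> B" unfolding w_def by (rule nest_mem[OF z drop])
      have "pair (T (b, xs)) z (as @ bs @ cs) = pair (cgen (b, take i xs))
          (pair (g (xs ! i)) (pair (cgen (1, drop (Suc i) xs)) z as) bs) cs"
        using 01 012 len by (simp add: T_def)
      also have "pair (cgen (1, drop (Suc i) xs)) z as = w"
        using len xs i by (simp add: pair_gen w_def)
      also have "pair (g (xs ! i)) w bs = p (xs ! i) (w * hochschild_of n g (agen (1, bs)))"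
        using pair_hochschild_of[OF g xi w len(2)]
            hochschild_lact_one[OF hochschild_of_hom[OF g] w len(2)] by simp
      also have "pair (cgen (b, take i xs)) \<dots> cs = b * nest (take i xs @ xs ! i # drop (Suc i) xs) z
          (as @ hochschild_of n g (agen (1, bs)) # cs)"
        using len xs i by (simp add: pair_gen nest_middle w_def)
      also have "take i xs @ xs ! i # drop (Suc i) xs = xs"
        using xs i by (simp add: id_take_nth_drop[symmetric])
      finally show "pair (T (b, xs)) z (as @ bs @ cs) =
          b * nest xs z (as @ hochschild_of n g (agen (1, bs)) # cs)" .
    qed
  qed
  have bal: "multibalanced pscale s B C m T"
  proof (rule multibalanced_paired)
    show "T (b, xs) \<in> cpow (m + n - 1)" if "b \<in> B" "xs \<in> lists (mcar C)" "length xs = m" for b xs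
      using T[OF that] by blast
    fix as :: "'a list" assume "length as = m + n - 1"
    then have "length as = (m - 1 - i) + n + i" using i by simp
    then obtain as2 as1 as0 where as: "as = as2 @ as1 @ as0"
        and len: "length as2 = m - 1 - i" "length as1 = n" "length as0 = i"
      by (rule split_list3)
    have "length (as2 @ hochschild_of n g (agen (1, as1)) # as0) = m" using len i by simp
    from multibalanced_nest_left[OF this, of 1]
    show "multibalanced s s B C m (\<lambda>g. pair (T g) 1 as)"
      by (rule multibalanced_cong[OF _ bimodule]) (use T len in \<open>simp add: as B_mem\<close>)
  qed
  have ap: "apply_at s B C i g = lin_ext T"
    by (simp add: apply_at_def T_def)
  show ?thesis
    unfolding ap using t
  proof (induction rule: tpow_induct)
    case zero
    show ?case by (simp add: lin_ext_0 pair_linear tpow_0_mem del: zero_fun_apply)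
  next
    case (gen b xs)
    with i T[OF gen] show ?case by (simp add: lin_ext_gen[OF bal] pair_gen)
  next
    case (add t u)
    then show ?case by (simp add: lin_ext_add pair_linear tpow_add_mem del: plus_fun_apply)
  qed
qed

text \<open>Pairing the right-hand side with a list from \<open>C\<close> gives, by \<open>apply_at_pair\<close>, the pairing of
  one fixed tensor of \<open>C\<close> with \<open>as\<close>; hence it satisfies the tensor relations in \<open>as\<close>.\<close>

lemma coapply_gen:
  assumes k: "k \<in> HH n" and i: "i < m"
  shows "multibalanced pscale s B AA (m + n - 1)
     (\<lambda>(z, as). agen (z, take i as @ k (agen (1, take n (drop i as))) # drop (i + n) as))"
    (is "multibalanced pscale s B AA _ ?T")
proof (rule multibalanced_copaired)
  show "?T (z, as) \<in> apow m" if "z \<in> B" "length as = m + n - 1" for z as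
    using that i by (auto intro!: tpow_gen_mem)
  fix xs assume xs: "xs \<in> lists (mcar C)" "length xs = m"
  have i': "m - 1 - i < m" using i by simp
  have t: "cgen (1, xs) \<in> cpow m" using xs by (simp add: tpow_gen_mem B_mem)
  note ap = apply_at_pair[OF cartier_of_hom[OF k] t i']
  from multibalanced_pair[OF conjunct1[OF ap]]
  show "multibalanced s s B AA (m + n - 1) (\<lambda>g. copair (?T g) xs)"
  proof (rule multibalanced_cong[OF _ bimodule_mult])
    fix z and as :: "'a list" assume z: "z \<in> B" and "length as = m + n - 1"
    then have "length as = i + n + (m - 1 - i)" using i by simp
    then obtain as2 as1 as0 where as: "as = as2 @ as1 @ as0"
        and len: "length as2 = i" "length as1 = n" "length as0 = m - 1 - i"
      by (rule split_list3)
    note hochschild_of_cartier_of[OF k]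
    then show "copair (?T (z, as)) xs = (case (z, as) of (z, as) \<Rightarrow>
        pair (apply_at s B C (m - 1 - i) (cartier_of n k) (cgen (1, xs))) z as)"
      using ap z len i xs by (simp add: as copair_gen pair_gen)
  qed
qed

lemma coapply_at_gen:
  assumes k: "k \<in> HH n" and i: "i < m"
    and len: "length as = i" "length bs = n" "length cs = m - 1 - i"
  shows "coapply_at s B AA i n k (agen (z, as @ bs @ cs)) = agen (z, as @ k (agen (1, bs)) # cs)"
  using lin_ext_gen[OF coapply_gen[OF k i], of "as @ bs @ cs"] len i
  by (simp add: coapply_at_def)

lemma coapply_at_mem:
  assumes k: "k \<in> HH n" and i: "i < m" and t: "t \<in> apow (m + n - 1)"
  shows "coapply_at s B AA i n k t \<in> apow m"
  using t
proof (induction rule: tpow_induct)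
  case zero
  show ?case by (simp add: coapply_at_def lin_ext_0 tpow_0_mem del: zero_fun_apply)
next
  case (gen z as)
  then have "length as = i + n + (m - 1 - i)" using i by simp
  then obtain as2 as1 as0 where as: "as = as2 @ as1 @ as0"
      and len: "length as2 = i" "length as1 = n" "length as0 = m - 1 - i"
    by (rule split_list3)
  show ?case
    unfolding as coapply_at_gen[OF k i len]
    using gen len i by (intro tpow_gen_mem) auto
next
  case (add t u)
  then show ?case by (simp add: coapply_at_def lin_ext_add tpow_add_mem del: plus_fun_apply)
qed

definition cartier_comp :: "nat \<Rightarrow> nat \<Rightarrow> ('c \<Rightarrow> ('a \<times> 'c list \<Rightarrow> 'k) \<Rightarrow> 'k) \<Rightarrow>
    ('c \<Rightarrow> ('a \<times> 'c list \<Rightarrow> 'k) \<Rightarrow> 'k) \<Rightarrow> 'c \<Rightarrow> ('a \<times> 'c list \<Rightarrow> 'k) \<Rightarrow> 'k" where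
  "cartier_comp m i f g c = apply_at s B C (m - i - 1) g (f c)"

lemma cartier_comp_pair:
  assumes f: "f \<in> CC m" and g: "g \<in> CC n" and i: "i < m" and x: "x \<in> mcar C" and z: "z \<in> B"
    and len: "length as = i" "length bs = n" "length cs = m - 1 - i"
  shows "pair (cartier_comp m i f g x) z (as @ bs @ cs) =
      pair (f x) z (as @ hochschild_of n g (agen (1, bs)) # cs)"
  using apply_at_pair[OF g bimod_homD(1)[OF f x], of "m - i - 1"] i z len
    by (simp add: cartier_comp_def)

lemma cartier_comp_mem_cpow:
  assumes f: "f \<in> CC m" and g: "g \<in> CC n" and i: "i < m" and x: "x \<in> mcar C"
  shows "cartier_comp m i f g x \<in> cpow (m + n - 1)"
  using apply_at_pair[OF g bimod_homD(1)[OF f x], of "m - i - 1"] i by (simp add: cartier_comp_def)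

text \<open>Bimodule linearity is verified on pairings, where it is inherited from \<open>f\<close>.\<close>

lemma cartier_comp_hom:
  assumes f: "f \<in> CC m" and g: "g \<in> CC n" and i: "i < m"
  shows "cartier_comp m i f g \<in> CC (m + n - 1)"
proof (rule bimod_homI)
  note mem = cartier_comp_mem_cpow[OF f g i]
  note cpair = cartier_comp_pair[OF f g i]
  show "cartier_comp m i f g x \<in> cpow (m + n - 1)" if "x \<in> mcar C" for x using that by (rule mem)
  show "cartier_comp m i f g x = 0" if "x \<notin> mcar C" for x
    using bimod_homD(2)[OF f that]
      by (simp add: cartier_comp_def apply_at_def lin_ext_0 del: zero_fun_apply)
  show "cartier_comp m i f g (x + y) = cartier_comp m i f g x + cartier_comp m i f g y"
    if "x \<in> mcar C" "y \<in> mcar C" for x y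
    using bimod_homD(3)[OF f that]
      by (simp add: cartier_comp_def apply_at_def lin_ext_add del: plus_fun_apply)
  fix b x assume b: "b \<in> B" and x: "x \<in> mcar C"
  have split: "\<exists>as2 as1 as0. as = as2 @ as1 @ as0 \<and> length as2 = i \<and> length as1 = n \<and> length as0 =
      m - 1 - i"
    if "length as = m + n - 1" for as :: "'a list"
  proof -
    have "length as = i + n + (m - 1 - i)" using that i by simp
    then show ?thesis by (rule split_list3) blast
  qed
  show "cartier_comp m i f g (lact C b x) = lact (tpow s B C (m + n - 1)) b (cartier_comp m i f g x)"
  proof (rule pair_separates)
    fix as :: "'a list" assume "length as = m + n - 1"
    then obtain as2 as1 as0 where as: "as = as2 @ as1 @ as0"
        and len: "length as2 = i" "length as1 = n" "length as0 = m - 1 - i"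
      using split by blast
    have len': "length (as2 @ hochschild_of n g (agen (1, as1)) # as0) = m" using len i by simp
    have "pair (cartier_comp m i f g (lact C b x)) 1 as = b * pair (cartier_comp m i f g x) 1 as"
      using lact_pair[OF bimod_homD(1)[OF f x] b] len'
      by (simp only: as cpair[OF C_mem(4)[OF b x] B_mem(1) len] cpair[OF x B_mem(1) len]
          bimod_homD(4)[OF f b x])
    also have "\<dots> = pair (lact (tpow s B C (m + n - 1)) b (cartier_comp m i f g x)) 1 as"
      using lact_pair[OF mem[OF x] b] \<open>length as = m + n - 1\<close> by simp
    finally show "pair (cartier_comp m i f g (lact C b x)) 1 as =
        pair (lact (tpow s B C (m + n - 1)) b (cartier_comp m i f g x)) 1 as" .
  qed (use mem[OF C_mem(4)[OF b x]] lact_pair[OF mem[OF x] b] in blast)+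
  show "cartier_comp m i f g (ract C x b) = ract (tpow s B C (m + n - 1)) (cartier_comp m i f g x) b"
  proof (rule pair_separates)
    fix as :: "'a list" assume "length as = m + n - 1"
    then obtain as2 as1 as0 where as: "as = as2 @ as1 @ as0"
        and len: "length as2 = i" "length as1 = n" "length as0 = m - 1 - i"
      using split by blast
    have len': "length (as2 @ hochschild_of n g (agen (1, as1)) # as0) = m" using len i by simp
    have "pair (cartier_comp m i f g (ract C x b)) 1 as = pair (cartier_comp m i f g x) (b * 1) as"
      using ract_pair[OF bimod_homD(1)[OF f x] b] len'
      by (simp only: as cpair[OF C_mem(5)[OF b x] B_mem(1) len]
          cpair[OF x B_mem(3)[OF b B_mem(1)] len] bimod_homD(5)[OF f b x])
    also have "\<dots> = pair (ract (tpow s B C (m + n - 1)) (cartier_comp m i f g x) b) 1 as"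
      using ract_pair[OF mem[OF x] b] \<open>length as = m + n - 1\<close> by simp
    finally show "pair (cartier_comp m i f g (ract C x b)) 1 as =
        pair (ract (tpow s B C (m + n - 1)) (cartier_comp m i f g x) b) 1 as" .
  qed (use mem[OF C_mem(5)[OF b x]] ract_pair[OF mem[OF x] b] in blast)+
qed

lemma CC_scale: "f \<in> CC n \<Longrightarrow> (\<lambda>c. pscale r (f c)) \<in> CC n"
proof (rule bimod_homI)
  assume f: "f \<in> CC n"
  show "pscale r (f x) \<in> cpow n" if "x \<in> mcar C" for x
    using bimod_homD(1)[OF f that] by (rule tpow_pscale_mem)
  show "pscale r (f x) = 0" if "x \<notin> mcar C" for x
    using bimod_homD(2)[OF f that] by (simp add: fun_eq_iff)
  show "pscale r (f (x + y)) = pscale r (f x) + pscale r (f y)" if "x \<in> mcar C" "y \<in> mcar C" for x y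
    using bimod_homD(3)[OF f that] by (simp add: fun_eq_iff distrib_left)
qed (simp_all add: bimod_homD lact_pscale ract_pscale)

lemma CC_subgroup: "add_subgroup (CC n)"
  unfolding add_subgroup_def
proof (intro conjI ballI)
  have z: "(0 :: 'c \<Rightarrow> ('a \<times> 'c list \<Rightarrow> 'k) \<Rightarrow> 'k) x = 0" for x
    by (rule zero_fun_apply)
  show "0 \<in> CC n"
    by (rule bimod_homI) (simp_all only: z tpow_0_mem lact_0 ract_0 add_0)
next
  fix f g assume f: "f \<in> CC n" and g: "g \<in> CC n"
  show "f + g \<in> CC n"
    by (rule bimod_homI)
      (simp_all only: plus_fun_apply[of f g] bimod_homD[OF f] bimod_homD[OF g] tpow_add_mem
        lact_add ract_add add_0 add_ac simp_thms not_False_eq_True)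
next
  fix f assume f: "f \<in> CC n"
  have "- f = (\<lambda>c. pscale (- 1) (f c))" by (simp add: fun_eq_iff)
  with CC_scale[OF f] show "- f \<in> CC n" by metis
qed

lemma hochschild_of_plus:
  assumes f: "f \<in> CC n" and g: "g \<in> CC n"
  shows "hochschild_of n (f + g) = hochschild_of n f + hochschild_of n g"
proof (rule tpow_hom_ext[where s = s and B = B and M = AA and n = n])
  have fg: "f + g \<in> CC n" using CC_subgroup[of n] f g by (simp add: add_subgroup_def)
  fix z and as :: "'a list" assume z: "z \<in> B" and as: "length as = n"
  show "hochschild_of n (f + g) (agen (z, as)) =
      (hochschild_of n f + hochschild_of n g) (agen (z, as))"
  proof (rule separates_A)
    fix x assume x: "x \<in> mcar C"
    show "p x (hochschild_of n (f + g) (agen (z, as))) =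
        p x ((hochschild_of n f + hochschild_of n g) (agen (z, as)))"
      using pair_hochschild_of[OF fg x z as] pair_hochschild_of[OF f x z as]
          pair_hochschild_of[OF g x z as]
      by (simp only: plus_fun_apply[of f g] plus_fun_apply[of "hochschild_of n f"] pair_linear
          p_add_right[OF x])
  qed
qed (simp_all add: hochschild_of_add add_ac, simp add: hochschild_of_def)

lemma hochschild_of_scale:
  assumes f: "f \<in> CC n"
  shows "hochschild_of n (\<lambda>c. pscale r (f c)) = (\<lambda>t. s r (hochschild_of n f t))"
proof (rule tpow_hom_ext[where s = s and B = B and M = AA and n = n])
  fix z and as :: "'a list" assume z: "z \<in> B" and as: "length as = n"
  show "hochschild_of n (\<lambda>c. pscale r (f c)) (agen (z, as)) = s r (hochschild_of n f (agen (z, as)))"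
  proof (rule separates_A)
    fix x assume x: "x \<in> mcar C"
    show "p x (hochschild_of n (\<lambda>c. pscale r (f c)) (agen (z, as))) =
        p x (s r (hochschild_of n f (agen (z, as))))"
      using pair_hochschild_of[OF CC_scale[OF f] x z as] pair_hochschild_of[OF f x z as]
      by (simp add: pair_linear p_scale x)
  qed
qed (simp_all add: hochschild_of_add scale_right_distrib, simp add: hochschild_of_def)

lemma cartier_comp_add_right:
  assumes f: "f \<in> CC m" and g: "g \<in> CC n" and g': "g' \<in> CC n" and i: "i < m"
  shows "cartier_comp m i f (g + g') = cartier_comp m i f g + cartier_comp m i f g'"
proof (rule cochain_ext)
  have gg: "g + g' \<in> CC n" using CC_subgroup[of n] g g' by (simp add: add_subgroup_def)
  show "cartier_comp m i f (g + g') \<in> CC (m + n - 1)" by (rule cartier_comp_hom[OF f gg i])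
  show "cartier_comp m i f g + cartier_comp m i f g' \<in> CC (m + n - 1)"
    using CC_subgroup[of "m + n - 1"] cartier_comp_hom[OF f g i] cartier_comp_hom[OF f g' i]
    by (simp add: add_subgroup_def)
  fix x and as :: "'a list" assume x: "x \<in> mcar C" and "length as = m + n - 1"
  then have "length as = i + n + (m - 1 - i)" using i by simp
  then obtain as2 as1 as0 where as: "as = as2 @ as1 @ as0"
      and len: "length as2 = i" "length as1 = n" "length as0 = m - 1 - i"
    by (rule split_list3)
  have "length (as2 @ a # as0) = m" for a :: 'a using len i by simp
  from multibalancedD(3)[OF multibalanced_pair[OF bimod_homD(1)[OF f x]] B_mem(1) _ _ _ _ this]
  have "pair (f x) 1 (as2 @ (a + a') # as0) = pair (f x) 1 (as2 @ a # as0) +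
      pair (f x) 1 (as2 @ a' # as0)"
    for a a' by simp
  then show "pair (cartier_comp m i f (g + g') x) 1 as =
      pair ((cartier_comp m i f g + cartier_comp m i f g') x) 1 as"
    by (simp only: plus_fun_apply[of "cartier_comp m i f g"] pair_linear as
        cartier_comp_pair[OF f gg i x B_mem(1) len]
        cartier_comp_pair[OF f g i x B_mem(1) len] cartier_comp_pair[OF f g' i x B_mem(1) len]
        hochschild_of_plus[OF g g'] plus_fun_apply[of "hochschild_of n g"])
qed

text \<open>Both sides are additive, so it suffices to compare them on generators, and there to compare
  their values under all \<open>p x\<close>. The reversal of tensor factors matches the position \<open>m - i - 1\<close> on
  the side of \<open>C\<close> with the position \<open>i\<close> on the side of \<open>A\<close>, so that transposition preserves the
  order of composition.\<close>

lemma hochschild_of_comp: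
  assumes f: "f \<in> CC m" and g: "g \<in> CC n" and i: "i < m"
  shows "hochschild_of (m + n - 1) (cartier_comp m i f g) =
     (\<lambda>t. if t \<in> apow (m + n - 1) then hochschild_of m f
         (coapply_at s B AA i n (hochschild_of n g) t) else 0)"
proof (rule tpow_hom_ext[where s = s and B = B and M = AA and n = "m + n - 1"])
  note cg = hochschild_of_hom[OF g]
  fix t u assume tu: "t \<in> apow (m + n - 1)" "u \<in> apow (m + n - 1)"
  show "hochschild_of (m + n - 1) (cartier_comp m i f g) (t + u) =
      hochschild_of (m + n - 1) (cartier_comp m i f g) t +
          hochschild_of (m + n - 1) (cartier_comp m i f g) u"
    using tu by (rule hochschild_of_add)
  have "coapply_at s B AA i n (hochschild_of n g) (t + u) =
      coapply_at s B AA i n (hochschild_of n g) t + coapply_at s B AA i n (hochschild_of n g) u"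
    unfolding coapply_at_def by (rule lin_ext_add)
  then show "(if t + u \<in> apow (m + n - 1) then hochschild_of m f
      (coapply_at s B AA i n (hochschild_of n g) (t + u)) else 0) =
      (if t \<in> apow (m + n - 1) then hochschild_of m f (coapply_at s B AA i n (hochschild_of n g) t)
          else 0) +
      (if u \<in> apow (m + n - 1) then hochschild_of m f (coapply_at s B AA i n (hochschild_of n g) u)
          else 0)"
    using tu hochschild_of_add[OF coapply_at_mem[OF cg i tu(1)] coapply_at_mem[OF cg i tu(2)]]
    by (simp only: tpow_add_mem if_True)
next
  note cg = hochschild_of_hom[OF g]
  fix z and as :: "'a list" assume z: "z \<in> B" and n: "length as = m + n - 1"
  then have "length as = i + n + (m - 1 - i)" using i by simp
  then obtain as2 as1 as0 where as: "as = as2 @ as1 @ as0"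
      and len: "length as2 = i" "length as1 = n" "length as0 = m - 1 - i"
    by (rule split_list3)
  have len': "length (as2 @ hochschild_of n g (agen (1, as1)) # as0) = m" using len i by simp
  have "p x (hochschild_of (m + n - 1) (cartier_comp m i f g) (agen (z, as))) =
      p x (hochschild_of m f (coapply_at s B AA i n (hochschild_of n g) (agen (z, as))))"
        if x: "x \<in> mcar C" for x
    using pair_hochschild_of[OF cartier_comp_hom[OF f g i] x z n] cartier_comp_pair[OF f g i x z len]
      pair_hochschild_of[OF f x z len'] coapply_at_gen[OF cg i len, of z]
    by (simp add: as)
  then have "hochschild_of (m + n - 1) (cartier_comp m i f g) (agen (z, as)) =
      hochschild_of m f (coapply_at s B AA i n (hochschild_of n g) (agen (z, as)))"
    by (rule separates_A)
  then show "hochschild_of (m + n - 1) (cartier_comp m i f g) (agen (z, as)) =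
      (if agen (z, as) \<in> apow (m + n - 1)
       then hochschild_of m f (coapply_at s B AA i n (hochschild_of n g) (agen (z, as))) else 0)"
    using z n by (simp add: tpow_gen_mem)
qed (simp add: hochschild_of_def)

lemma multibalanced_prod: "multibalanced s s B AA n (\<lambda>(z, as). z * prod_list as)"
  by (rule multibalancedI)
    (simp_all add: distrib_right distrib_left mult.assoc scale_mult_left)

text \<open>The description of the multiplication cochain on \<open>x \<otimes> y\<close> has a unique solution: the product
  map is balanced, and a bimodule map is determined by its values on generators with coefficient
  \<open>1\<close>.\<close>

lemma mult_cochain:
  shows mult_cochain_hom: "mult_cochain s B \<in> HH 2"
    and mult_cochain_gen: "z \<in> B \<Longrightarrow> mult_cochain s B (agen (z, [x, y])) = z * x * y"
proof -
  define m where "m t = (if t \<in> apow 2 then vext (\<lambda>(z, as). z * prod_list as) t else 0)" for t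
  have m_gen: "m (agen (z, as)) = z * prod_list as" if "z \<in> B" "length as = 2" for z as
    using that vext_gen[OF multibalanced_prod that(2)] by (simp add: m_def tpow_gen_mem)
  have m_add: "m (t + u) = m t + m u" if "t \<in> apow 2" "u \<in> apow 2" for t u
    using that by (simp add: m_def vext_add tpow_add_mem del: plus_fun_apply)
  have m_0: "m 0 = 0"
    by (simp add: m_def vext_0 del: zero_fun_apply)
  have m: "m \<in> HH 2"
  proof (rule bimod_homI)
    fix a t assume a: "a \<in> B" and t: "t \<in> apow 2"
    have "lact (tpow s B AA 2) a t \<in> apow 2 \<and> m (lact (tpow s B AA 2) a t) = a * m t"
      using t
    proof (induction rule: tpow_induct)
      case zero
      show ?case by (simp only: lact_0 m_0 tpow_0_mem mult_zero_right simp_thms)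
    next
      case (gen z as)
      then show ?case using a by (simp add: colact_gen m_gen tpow_gen_mem B_mem mult.assoc)
    next
      case (add t u)
      then show ?case by (simp add: lact_add m_add tpow_add_mem distrib_left del: plus_fun_apply)
    qed
    then show "m (lact (tpow s B AA 2) a t) = lact AA a (m t)" by simp
    have "ract (tpow s B AA 2) t a \<in> apow 2 \<and> m (ract (tpow s B AA 2) t a) = m t * a"
      using t
    proof (induction rule: tpow_induct)
      case zero
      show ?case by (simp only: ract_0 m_0 tpow_0_mem mult_zero_left simp_thms)
    next
      case (gen z as)
      then obtain x y where "as = [x, y]" by (cases as; cases "tl as") auto
      with gen a show ?case
        using cogen_ract_mem[OF gen(1) a gen(3)] by (simp add: coract_gen m_gen mult.assoc)
    next
      case (add t u)
      then show ?case by (simp add: ract_add m_add tpow_add_mem distrib_right del: plus_fun_apply)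
    qed
    then show "m (ract (tpow s B AA 2) t a) = ract AA (m t) a" by simp
  next
    show "m (t + u) = m t + m u" if "t \<in> apow 2" "u \<in> apow 2" for t u using that by (rule m_add)
  qed (simp_all add: m_def)
  have "mult_cochain s B = m"
    unfolding mult_cochain_def
  proof (rule the_equality)
    show "m \<in> HH 2 \<and> (\<forall>x y. m (agen (1, [x, y])) = x * y)"
      using m by (simp add: m_gen B_mem)
    fix m' assume m': "m' \<in> HH 2 \<and> (\<forall>x y. m' (agen (1, [x, y])) = x * y)"
    show "m' = m"
    proof (rule hochschild_ext)
      fix x z and as :: "'a list" assume z: "z \<in> B" and as: "length as = 2"
      then obtain a a' where as': "as = [a, a']" by (cases as; cases "tl as") auto
      have "m' (agen (z, as)) = m (agen (z, as))"
        using hochschild_lact_one[OF conjunct1[OF m'] z as] m' z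
        by (simp add: as' m_gen mult.assoc)
      then show "p x (m' (agen (z, as))) = p x (m (agen (z, as)))" by simp
    qed (use m m' in blast)+
  qed
  with m m_gen show "mult_cochain s B \<in> HH 2"
    and "z \<in> B \<Longrightarrow> mult_cochain s B (agen (z, [x, y])) = z * x * y"
    by (simp_all add: mult.assoc)
qed

end

text \<open>The comultiplication is assumed to be dual to the multiplication of \<open>A\<close>, which by
  \<open>hochschild_of_comult\<close> means that transposition exchanges the two.\<close>

locale dual_coring_pairing = dual_pairing s E B C p D
  for s :: "'k::field \<Rightarrow> 'a::{ring,monoid_mult} \<Rightarrow> 'a" and E B
    and C :: "('k, 'a, 'c::ab_group_add) coring" and p D +
  assumes comult_hom: "comult C \<in> bimod_hom B C (tpow s B C 2)"
    and comult_pair: "x \<in> mcar C \<Longrightarrow> pair (comult C x) 1 [a, a'] = p x (a * a')"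
begin

lemma hochschild_of_comult: "hochschild_of 2 (comult C) = mult_cochain s B"
proof -
  have "comult C = cartier_of 2 (mult_cochain s B)"
  proof (rule cochain_ext[OF comult_hom cartier_of_hom[OF mult_cochain_hom]])
    fix x and as :: "'a list" assume x: "x \<in> mcar C" and as: "length as = 2"
    then obtain a a' where as': "as = [a, a']" by (cases as; cases "tl as") auto
    show "pair (comult C x) 1 as = pair (cartier_of 2 (mult_cochain s B) x) 1 as"
      using pair_cartier_of[OF mult_cochain_hom x B_mem(1) as] x
      by (simp add: as' comult_pair mult_cochain_gen B_mem)
  qed
  then show ?thesis by (simp add: hochschild_of_cartier_of mult_cochain_hom)
qed

sublocale operad_with_mult_iso "cartier_operad s B C" "comult C" "hochschild_operad s B"
    hochschild_of "mult_cochain s B"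
proof
  let ?O = "cartier_operad s B C"
  have car: "ocar ?O n = CC n" for n by (simp add: cartier_operad_def)
  have comp: "ocomp ?O m n i f g = cartier_comp m i f g" for m n i f g
    by (simp add: cartier_operad_def cartier_comp_def[abs_def])
  have scale: "oscale ?O r f = (\<lambda>c. pscale r (f c))" for r f
    by (simp add: cartier_operad_def)
  show "add_subgroup (ocar ?O n)" for n
    unfolding car by (rule CC_subgroup)
  show "oscale ?O r f \<in> ocar ?O n" if "f \<in> ocar ?O n" for f n r
    using that unfolding car scale by (rule CC_scale)
  show "ocomp ?O m n i f g \<in> ocar ?O (m + n - 1)"
    if "f \<in> ocar ?O m" "g \<in> ocar ?O n" "i < m" for f m g n i
    using that unfolding car comp by (rule cartier_comp_hom)
  show "ocomp ?O m n i (f + f') g = ocomp ?O m n i f g + ocomp ?O m n i f' g" for f f' m g n i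
    unfolding comp by (rule ext) (simp only: cartier_comp_def apply_at_def lin_ext_add plus_fun_apply)
  show "ocomp ?O m n i f (g + g') = ocomp ?O m n i f g + ocomp ?O m n i f g'"
    if "f \<in> ocar ?O m" "g \<in> ocar ?O n" "g' \<in> ocar ?O n" "i < m" for f m g g' n i
    using that unfolding car comp by (rule cartier_comp_add_right)
  show "comult C \<in> ocar ?O 2" unfolding car by (rule comult_hom)
  show "oscale ?O r (- f) = - oscale ?O r f" for r f
    unfolding scale by (simp add: fun_eq_iff)
  show "oscale ?O (- 1) f = - f" for f
    unfolding scale by (simp add: fun_eq_iff)
  show "bij_betw (hochschild_of n) (ocar ?O n) (ocar (hochschild_operad s B) n)" for n
    using hochschild_of_bij unfolding car by (simp add: hochschild_operad_def)
  show "hochschild_of n (f + g) = hochschild_of n f + hochschild_of n g"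
    if "f \<in> ocar ?O n" "g \<in> ocar ?O n" for f g n
    using that unfolding car by (rule hochschild_of_plus)
  show "hochschild_of n (oscale ?O r f) = oscale (hochschild_operad s B) r (hochschild_of n f)"
    if "f \<in> ocar ?O n" for f n r
    using that unfolding car scale by (simp add: hochschild_of_scale hochschild_operad_def)
  show "hochschild_of (m + n - 1) (ocomp ?O m n i f g) =
      ocomp (hochschild_operad s B) m n i (hochschild_of m f) (hochschild_of n g)"
    if "f \<in> ocar ?O m" "g \<in> ocar ?O n" "i < m" for f m g n i
    using hochschild_of_comp[of f m g n i] that unfolding car comp
      by (simp add: hochschild_operad_def)
  show "hochschild_of 2 (comult C) = mult_cochain s B" by (rule hochschild_of_comult)
qed

end

section \<open>Flat modules have dual bases\<close>

lemma vector_space_pscale: "vector_space (pscale :: 'k::field \<Rightarrow> ('x \<Rightarrow> 'k) \<Rightarrow> 'x \<Rightarrow> 'k)"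
  by unfold_locales (simp_all add: fun_eq_iff algebra_simps)

lemma left_moduleD:
  assumes "left_module R M"
  shows "add_subgroup (mcar M)" "a \<in> R \<Longrightarrow> x \<in> mcar M \<Longrightarrow> lact M a x \<in> mcar M"
    "a \<in> R \<Longrightarrow> x \<in> mcar M \<Longrightarrow> y \<in> mcar M \<Longrightarrow> lact M a (x + y) = lact M a x + lact M a y"
    "a \<in> R \<Longrightarrow> b \<in> R \<Longrightarrow> x \<in> mcar M \<Longrightarrow> lact M (a + b) x = lact M a x + lact M b x"
    "a \<in> R \<Longrightarrow> b \<in> R \<Longrightarrow> x \<in> mcar M \<Longrightarrow> lact M (a * b) x = lact M a (lact M b x)"
    "x \<in> mcar M \<Longrightarrow> lact M 1 x = x"
  using assms by (simp_all add: left_module_def)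

text \<open>The indicator functions of the points of \<open>T\<close> span a space that contains the module, so a
  basis of the module is finite.\<close>

lemma fd_moduleI:
  fixes M :: "('a::{ring,monoid_mult}, nat \<Rightarrow> 'k::field, 'z) lmod_scheme"
  assumes M: "left_module R M" and T: "finite T" "\<And>x t. x \<in> mcar M \<Longrightarrow> t \<notin> T \<Longrightarrow> x t = 0"
    and sc: "\<And>r x. x \<in> mcar M \<Longrightarrow> lact M (s r 1) x = pscale r x"
    and R: "\<And>r. s r 1 \<in> R"
  shows "fd_module s R M"
proof -
  interpret V: vector_space "pscale :: 'k \<Rightarrow> (nat \<Rightarrow> 'k) \<Rightarrow> nat \<Rightarrow> 'k"
    by (rule vector_space_pscale)
  define u :: "nat \<Rightarrow> nat \<Rightarrow> 'k" where "u t = (\<lambda>t'. if t' = t then 1 else 0)" for t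
  have eq: "x = (\<Sum>t\<in>T. pscale (x t) (u t))" if "x \<in> mcar M" for x
  proof
    fix t
    have "(\<Sum>t'\<in>T. pscale (x t') (u t')) t = (\<Sum>t'\<in>T. x t' * u t' t)"
      using T(1) by (induction T) auto
    also have "\<dots> = x t"
      using T that by (cases "t \<in> T") (auto simp: u_def if_distrib cong: if_cong)
    finally show "x t = (\<Sum>t'\<in>T. pscale (x t') (u t')) t" ..
  qed
  have "x \<in> V.span (u ` T)" if "x \<in> mcar M" for x
    by (rule ssubst[where P = "\<lambda>y. y \<in> _", OF eq[OF that]])
      (intro V.span_sum V.span_scale V.span_base imageI)
  then have "mcar M \<subseteq> V.span (u ` T)" by blast
  moreover obtain S where S: "S \<subseteq> mcar M" "V.independent S" "mcar M \<subseteq> V.span S"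
    by (rule V.basis_exists)
  ultimately have fin: "finite S"
    using V.independent_span_bound[OF finite_imageI[OF T(1)] S(2)] by (metis order_trans)
  have "\<exists>c. x = (\<Sum>v\<in>S. lact M (s (c v) 1) v)" if x: "x \<in> mcar M" for x
  proof -
    obtain c where "x = (\<Sum>v\<in>S. pscale (c v) v)"
      using subsetD[OF S(3) x] unfolding V.span_finite[OF fin] by (rule rangeE)
    also have "\<dots> = (\<Sum>v\<in>S. lact M (s (c v) 1) v)"
      using S(1) sc by (intro sum.cong) auto
    finally show ?thesis by blast
  qed
  then show ?thesis
    unfolding fd_module_def using M S(1) fin by blast
qed

definition ind_exact :: "('k::field \<Rightarrow> 'a::{ring,monoid_mult} \<Rightarrow> 'a) \<Rightarrow> 'a set \<Rightarrow> bool" where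
  "ind_exact s B \<longleftrightarrow>
     (\<forall>(X :: ('a, nat \<Rightarrow> 'k) lmod) f (Y :: ('a, nat \<Rightarrow> 'k) lmod) g (Z :: ('a, nat \<Rightarrow> 'k) lmod).
        fd_module s B X \<and> fd_module s B Y \<and> fd_module s B Z \<and> short_exact B X f Y g Z \<longrightarrow>
        short_exact UNIV (ind s B X) (ind_map s B X Y f) (ind s B Y) (ind_map s B Y Z g) (ind s B Z))"

text \<open>Exactness speaks about short exact sequences of modules inside \<open>nat \<Rightarrow> 'k\<close>, so a cokernel of
  \<open>f\<close> has to be realised there.\<close>

lemma ind_map_injective:
  fixes X Y :: "('a::{ring,monoid_mult}, nat \<Rightarrow> 'k::field) lmod"
  assumes exact: "ind_exact s B"
    and X: "left_module B X" "fd_module s B X" and Y: "left_module B Y" and T: "finite T"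
        "\<And>x t. x \<in> mcar Y \<Longrightarrow> t \<notin> T \<Longrightarrow> x t = 0"
    and sc: "\<And>r x. x \<in> mcar Y \<Longrightarrow> lact Y (s r 1) x = pscale r x"
    and R: "\<And>r. s r 1 \<in> B" "1 \<in> B" "\<And>x y. x \<in> B \<Longrightarrow> y \<in> B \<Longrightarrow> x + y \<in> B" "\<And>x y. x \<in> B \<Longrightarrow> y \<in> B \<Longrightarrow> x * y \<in> B"
    and f: "f \<in> lmod_hom B X Y" "inj_on f (mcar X)"
  shows "inj_on (ind_map s B X Y f) (mcar (ind s B X))"
proof -
  interpret V: vector_space "pscale :: 'k \<Rightarrow> (nat \<Rightarrow> 'k) \<Rightarrow> nat \<Rightarrow> 'k"
    by (rule vector_space_pscale)
  interpret VV: vector_space_pair "pscale :: 'k \<Rightarrow> (nat \<Rightarrow> 'k) \<Rightarrow> nat \<Rightarrow> 'k"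
      "pscale :: 'k \<Rightarrow> (nat \<Rightarrow> 'k) \<Rightarrow> nat \<Rightarrow> 'k"
    by unfold_locales
  note Xm = left_moduleD[OF X(1)] and Ym = left_moduleD[OF Y]
  have Xg: "0 \<in> mcar X" "\<And>x y. x \<in> mcar X \<Longrightarrow> y \<in> mcar X \<Longrightarrow> x + y \<in> mcar X"
    and Yg: "0 \<in> mcar Y" "\<And>x y. x \<in> mcar Y \<Longrightarrow> y \<in> mcar Y \<Longrightarrow> x + y \<in> mcar Y"
        "\<And>x. x \<in> mcar Y \<Longrightarrow> - x \<in> mcar Y"
    using Xm(1) Ym(1) by (auto simp: add_subgroup_def)
  define U where "U = f ` mcar X"
  have UY: "U \<subseteq> mcar Y" unfolding U_def using lmod_homD(1)[OF f(1)] by blast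
  have Ul: "lact Y b u \<in> U" if "b \<in> B" "u \<in> U" for b u
    using that Xm(2) unfolding U_def by (auto simp: lmod_homD(4)[OF f(1), symmetric])
  have U: "V.subspace U"
  proof (rule V.subspaceI)
    have "f 0 = 0" using lmod_homD(3)[OF f(1) Xg(1) Xg(1)] by simp
    then show "0 \<in> U" using Xg(1) unfolding U_def by (metis image_eqI)
    show "x + y \<in> U" if "x \<in> U" "y \<in> U" for x y
      using that Xg(2) unfolding U_def
        by (auto simp: lmod_homD(3)[OF f(1), symmetric] simp del: plus_fun_apply)
    show "pscale r x \<in> U" if "x \<in> U" for r x
      using Ul[OF R(1) that, of r] sc that UY by auto
  qed
  obtain g where g: "g ` UNIV \<subseteq> U" "Vector_Spaces.linear pscale pscale g" "\<forall>v\<in>U. g (id v) = v"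
    using VV.linear_exists_left_inverse_on[OF V.linear_id U] by auto
  interpret g: Vector_Spaces.linear "pscale :: 'k \<Rightarrow> (nat \<Rightarrow> 'k) \<Rightarrow> nat \<Rightarrow> 'k"
      "pscale :: 'k \<Rightarrow> (nat \<Rightarrow> 'k) \<Rightarrow> nat \<Rightarrow> 'k" g
    by (rule g(2))
  \<comment> \<open>\<open>q\<close> is a linear projection with kernel \<open>U\<close>, the image of \<open>f\<close>. It maps \<open>Y\<close> to a complement of
    \<open>U\<close> in \<open>Y\<close>, on which \<open>B\<close> acts by acting in \<open>Y\<close> and projecting back.\<close>
  define q where "q y = y - g y" for y
  have q_add: "q (x + y) = q x + q y" for x y
    by (simp add: q_def g.add algebra_simps del: plus_fun_apply)
  have q_zero: "q y = 0 \<longleftrightarrow> y \<in> U" for y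
    using g(1,3) by (auto simp: q_def simp del: minus_apply)
  have q_mem: "q y \<in> mcar Y" if "y \<in> mcar Y" for y
  proof -
    have "g y \<in> mcar Y" using g(1) UY by blast
    then show ?thesis using Yg(2)[OF that Yg(3)] by (simp add: q_def)
  qed
  have q_diff: "y - q y \<in> U" for y
    using g(1) by (auto simp: q_def)
  have q_q: "q (q y) = q y" for y
    using q_add[of "q y" "y - q y"] q_zero[of "y - q y"] q_diff[of y] by simp
  have q_lact: "q (lact Y b (q y)) = q (lact Y b y)" if "b \<in> B" "y \<in> mcar Y" for b y
  proof -
    have "lact Y b y = lact Y b (q y) + lact Y b (y - q y)"
      using Ym(3)[OF that(1) q_mem[OF that(2)], of "y - q y"] q_diff[of y] UY by auto
    then show ?thesis
      using q_add[of "lact Y b (q y)" "lact Y b (y - q y)"] q_zero[of "lact Y b (y - q y)"]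
          Ul[OF that(1) q_diff] by simp
  qed
  define Z :: "('a, nat \<Rightarrow> 'k) lmod" where "Z = \<lparr>mcar = q ` mcar Y, lact = \<lambda>b z. q (lact Y b z)\<rparr>"
  have Zlact: "lact Z b (q y) = q (lact Y b y)" if "b \<in> B" "y \<in> mcar Y" for b y
    using q_lact[OF that] by (simp add: Z_def)
  have Zcar: "mcar Z = q ` mcar Y" by (simp add: Z_def)
  have Z: "left_module B Z"
    unfolding left_module_def Zcar
  proof (intro conjI ballI)
    show "add_subgroup (q ` mcar Y)"
      unfolding add_subgroup_def
    proof (intro conjI ballI)
      show "0 \<in> q ` mcar Y" using Yg(1) V.subspace_0[OF U] q_zero by (metis image_eqI)
      show "x + y \<in> q ` mcar Y" if "x \<in> q ` mcar Y" "y \<in> q ` mcar Y" for x y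
        using that Yg(2) by (auto simp: q_add[symmetric] simp del: plus_fun_apply)
      have q_neg: "q (- y) = - q y" for y
        using q_add[of y "- y"] q_zero[of 0] V.subspace_0[OF U]
        by (simp add: eq_neg_iff_add_eq_0 add.commute del: plus_fun_apply)
      show "- x \<in> q ` mcar Y" if "x \<in> q ` mcar Y" for x
        using that Yg(3) by (auto simp: q_neg[symmetric] simp del: uminus_apply)
    qed
  qed (use Zlact Ym Yg R in \<open>auto simp: q_add[symmetric] simp del: plus_fun_apply\<close>)
  have fdY: "fd_module s B Y" by (rule fd_moduleI[OF Y T(1)]) (use T sc R in auto)
  have fdZ: "fd_module s B Z"
  proof (rule fd_moduleI[OF Z T(1)])
    show "s r 1 \<in> B" for r by (rule R(1))
    show "x t = 0" if "x \<in> mcar Z" "t \<notin> T" for x t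
      using that T(2) q_mem unfolding Zcar by blast
    show "lact Z (s r 1) x = pscale r x" if x: "x \<in> mcar Z" for r x
    proof -
      obtain y where y: "y \<in> mcar Y" "x = q y" using x unfolding Zcar by blast
      have "lact Z (s r 1) (q y) = q (pscale r y)"
        unfolding Zlact[OF R(1) y(1)] sc[OF y(1)] ..
      also have "\<dots> = pscale r (q y)"
        unfolding q_def g.scale by (simp add: fun_eq_iff right_diff_distrib)
      finally show ?thesis unfolding y(2) .
    qed
  qed
  define h where "h y = (if y \<in> mcar Y then q y else 0)" for y
  have "h \<in> lmod_hom B Y Z"
    unfolding lmod_hom_def using Yg(2) Ym(2)
      by (auto simp: h_def Zcar Zlact q_add simp del: plus_fun_apply)
  moreover have "f ` mcar X = hker Y h"
    using q_zero UY unfolding U_def[symmetric] by (auto simp: hker_def h_def)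
  moreover have "h ` mcar Y = mcar Z"
    by (auto simp: h_def Zcar)
  ultimately have "short_exact B X f Y h Z"
    using f by (simp add: short_exact_def)
  with exact X(2) fdY fdZ have "short_exact UNIV (ind s B X) (ind_map s B X Y f) (ind s B Y)
      (ind_map s B Y Z h) (ind s B Z)"
    unfolding ind_exact_def by blast
  then show ?thesis by (simp add: short_exact_def)
qed

text \<open>A basis \<open>E\<close> of \<open>A\<close> that contains a basis of \<open>B\<close>.\<close>

locale adapted_basis = fd_algebra_with_subalgebra s E B
  for s :: "'k::field \<Rightarrow> 'a::{ring,monoid_mult} \<Rightarrow> 'a" and E B +
  assumes B_span: "B \<subseteq> span (E \<inter> B)"
begin

abbreviation coord :: "'a \<Rightarrow> 'a \<Rightarrow> 'k" where
  "coord e a \<equiv> representation E a e"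

lemma coord_add: "coord e (a + b) = coord e a + coord e b"
  by (simp add: representation_add independent_Basis span_Basis)

lemma coord_scale: "coord e (s r a) = r * coord e a"
  by (simp add: representation_scale independent_Basis span_Basis)

lemma coord_basis: "e' \<in> E \<Longrightarrow> coord e e' = (if e = e' then 1 else 0)"
  by (simp add: representation_basis independent_Basis)

lemma coord_expansion: "(\<Sum>e\<in>E. s (coord e a) e) = a"
  using sum_representation_eq[OF independent_Basis _ finite_Basis order_refl, of a]
    by (simp add: span_Basis)

lemma coord_eqI: "(\<And>e. e \<in> E \<Longrightarrow> coord e a = coord e b) \<Longrightarrow> a = b"
  by (subst (1 2) coord_expansion[symmetric]) simp

text \<open>The span of \<open>J \<subseteq> E\<close>, described by the vanishing of coordinates.\<close>

definition coord_span :: "'a set \<Rightarrow> 'a set" where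
  "coord_span J = {a. \<forall>e\<in>E - J. coord e a = 0}"

lemma coord_span_E: "coord_span E = UNIV"
  by (simp add: coord_span_def)

lemma coord_span_expansion:
  assumes "a \<in> coord_span J" "J \<subseteq> E"
  shows "(\<Sum>e\<in>J. s (coord e a) e) = a"
proof -
  have "(\<Sum>e\<in>J. s (coord e a) e) = (\<Sum>e\<in>E. s (coord e a) e)"
    using assms finite_Basis by (intro sum.mono_neutral_left) (auto simp: coord_span_def)
  then show ?thesis by (simp only: coord_expansion)
qed

lemma coord_span_B: "coord_span (E \<inter> B) = B"
proof
  show "coord_span (E \<inter> B) \<subseteq> B"
  proof
    fix a assume a: "a \<in> coord_span (E \<inter> B)"
    have "(\<Sum>e\<in>S. s (coord e a) e) \<in> B" if "S \<subseteq> B" for S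
      using that by (induction S rule: infinite_finite_induct) (auto intro: B_mem)
    from this[of "E \<inter> B"] show "a \<in> B" using coord_span_expansion[OF a] by simp
  qed
  show "B \<subseteq> coord_span (E \<inter> B)"
  proof
    fix b assume "b \<in> B"
    then have "b \<in> span (E \<inter> B)" using B_span by blast
    from representation_extend[OF independent_Basis this] show "b \<in> coord_span (E \<inter> B)"
      using representation_ne_zero[of "E \<inter> B" b] by (auto simp: coord_span_def)
  qed
qed

definition num :: "'a \<Rightarrow> nat" where
  "num = (SOME h. inj_on h E)"

lemma num_inj: "inj_on num E"
proof -
  obtain h :: "'a \<Rightarrow> nat" where "inj_on h E"
    using finite_imp_inj_to_nat_seg[OF finite_Basis] by blast
  then show ?thesis unfolding num_def by (rule someI[of "\<lambda>h. inj_on h E"])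
qed

definition idx :: "nat \<Rightarrow> 'a \<Rightarrow> nat" where
  "idx i e = prod_encode (i, num e)"

lemma idx_eq: "e \<in> E \<Longrightarrow> e' \<in> E \<Longrightarrow> idx i e = idx i' e' \<longleftrightarrow> i = i' \<and> e = e'"
  using num_inj by (auto simp: idx_def inj_on_def)

text \<open>A function \<open>v\<close> on \<open>nat\<close> encodes a family of functionals on the span of \<open>J\<close>: the value of the
  \<open>i\<close>-th one at the basis element \<open>e\<close> is stored at \<open>idx i e\<close>.\<close>

definition psi :: "'a set \<Rightarrow> (nat \<Rightarrow> 'k) \<Rightarrow> nat \<Rightarrow> 'a \<Rightarrow> 'k" where
  "psi J v i a = (\<Sum>e\<in>J. v (idx i e) * coord e a)"

lemma psi_add: "psi J v i (a + b) = psi J v i a + psi J v i b"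
  by (simp add: psi_def coord_add distrib_left sum.distrib)

lemma psi_scale: "psi J v i (s r a) = r * psi J v i a"
  by (simp add: psi_def coord_scale sum_distrib_left mult.left_commute)

lemma psi_sum: "psi J v i (\<Sum>x\<in>S. f x) = (\<Sum>x\<in>S. psi J v i (f x))"
proof -
  have "psi J v i 0 = 0" using psi_scale[of J v i 0 0] by simp
  then show ?thesis by (induction S rule: infinite_finite_induct) (simp_all add: psi_add)
qed

lemma psi_add_left: "psi J (v + w) i a = psi J v i a + psi J w i a"
  by (simp add: psi_def distrib_right sum.distrib)

lemma psi_basis: "J \<subseteq> E \<Longrightarrow> e \<in> J \<Longrightarrow> psi J v i e = v (idx i e)"
  using finite_subset[OF _ finite_Basis, of J]
  by (auto simp: psi_def coord_basis subset_iff if_distrib cong: if_cong)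

definition table :: "nat set \<Rightarrow> 'a set \<Rightarrow> (nat \<Rightarrow> 'a \<Rightarrow> 'k) \<Rightarrow> nat \<Rightarrow> 'k" where
  "table I J h t = (if \<exists>i\<in>I. \<exists>e\<in>J. t = idx i e
     then h (fst (prod_decode t)) (inv_into E num (snd (prod_decode t))) else 0)"

lemma table_idx: "J \<subseteq> E \<Longrightarrow> i \<in> I \<Longrightarrow> e \<in> J \<Longrightarrow> table I J h (idx i e) = h i e"
  using num_inj by (auto simp: table_def idx_def subset_iff)

text \<open>The dual of a direct sum of copies of the span of \<open>J\<close>, one for each \<open>i \<in> I\<close>. It is a left
  module because the span of \<open>J\<close> is a right module.\<close>

definition dual_module :: "nat set \<Rightarrow> 'a set \<Rightarrow> ('a, nat \<Rightarrow> 'k) lmod" where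
  "dual_module I J = \<lparr>mcar = {v. \<forall>t. v t \<noteq> 0 \<longrightarrow> (\<exists>i\<in>I. \<exists>e\<in>J. t = idx i e)},
     lact = \<lambda>c v. table I J (\<lambda>i e. psi J v i (e * c))\<rparr>"

lemma table_mem: "table I J h \<in> mcar (dual_module I J)"
  by (auto simp: dual_module_def table_def)

lemma dual_module_eqI:
  assumes "v \<in> mcar (dual_module I J)" "w \<in> mcar (dual_module I J)"
      "\<And>i e. i \<in> I \<Longrightarrow> e \<in> J \<Longrightarrow> v (idx i e) = w (idx i e)"
  shows "v = w"
proof
  fix t show "v t = w t"
  proof (cases "\<exists>i\<in>I. \<exists>e\<in>J. t = idx i e")
    case True
    with assms(3) show ?thesis by blast
  next
    case False
    have "v t = 0" "w t = 0"
      using assms(1,2) False unfolding dual_module_def by auto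
    then show ?thesis by simp
  qed
qed

lemma dual_module_lact_mem: "lact (dual_module I J) c v \<in> mcar (dual_module I J)"
  using table_mem by (simp add: dual_module_def)

definition right_closed :: "'a set \<Rightarrow> bool" where
  "right_closed J \<longleftrightarrow> J \<subseteq> E \<and> (\<forall>a\<in>coord_span J. \<forall>c\<in>B. a * c \<in> coord_span J)"

lemma right_closed: "right_closed E" "right_closed (E \<inter> B)"
  by (auto simp: right_closed_def coord_span_E coord_span_B B_mem)

lemma basis_in_coord_span: "J \<subseteq> E \<Longrightarrow> e \<in> J \<Longrightarrow> e \<in> coord_span J"
  by (auto simp: coord_span_def coord_basis subset_iff)

lemma psi_lact:
  assumes J: "J \<subseteq> E" and a: "a \<in> coord_span J" and i: "i \<in> I"
  shows "psi J (lact (dual_module I J) c v) i a = psi J v i (a * c)"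
proof -
  have "psi J (lact (dual_module I J) c v) i a = (\<Sum>e\<in>J. psi J v i (e * c) * coord e a)"
    unfolding psi_def[of J "lact (dual_module I J) c v"]
    using table_idx[OF J i] by (intro sum.cong) (auto simp: dual_module_def)
  also have "\<dots> = (\<Sum>e\<in>J. psi J v i (s (coord e a) e * c))"
    by (simp add: scale_mult_left[symmetric] psi_scale mult.commute)
  also have "\<dots> = psi J v i ((\<Sum>e\<in>J. s (coord e a) e) * c)"
    by (simp only: psi_sum sum_distrib_right)
  finally show ?thesis by (simp only: coord_span_expansion[OF a J])
qed

lemma lact_idx: "J \<subseteq> E \<Longrightarrow> i \<in> I \<Longrightarrow> e \<in> J \<Longrightarrow> lact (dual_module I J) c v (idx i e) = psi J v i (e * c)"
  by (simp add: dual_module_def table_idx)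

lemma dual_module_subgroup: "add_subgroup (mcar (dual_module I J))"
  unfolding add_subgroup_def dual_module_def
  by (auto simp: add_nonneg_eq_0_iff) (metis add.right_neutral)

lemma dual_module_add_mem: "v \<in> mcar (dual_module I J) \<Longrightarrow> w \<in> mcar (dual_module I J) \<Longrightarrow> v +
    w \<in> mcar (dual_module I J)"
  using dual_module_subgroup by (simp add: add_subgroup_def)

lemma dual_module_left_module:
  assumes J: "right_closed J"
  shows "left_module B (dual_module I J)"
proof -
  have JE: "J \<subseteq> E" and cl: "\<And>e c. e \<in> J \<Longrightarrow> c \<in> B \<Longrightarrow> e * c \<in> coord_span J"
    using J basis_in_coord_span by (auto simp: right_closed_def)
  note simps = lact_idx[OF JE] psi_add_left psi_add psi_lact[OF JE cl] distrib_left mult.assoc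
  show ?thesis
    unfolding left_module_def
  proof (intro conjI ballI)
    show "add_subgroup (mcar (dual_module I J))" by (rule dual_module_subgroup)
    show "lact (dual_module I J) a x \<in> mcar (dual_module I J)" for a x by (rule dual_module_lact_mem)
    show "lact (dual_module I J) a (x + y) = lact (dual_module I J) a x +
        lact (dual_module I J) a y" for a x y
      by (rule dual_module_eqI[OF dual_module_lact_mem
          dual_module_add_mem[OF dual_module_lact_mem dual_module_lact_mem]]) (simp add: simps)
    show "lact (dual_module I J) (a + b) x = lact (dual_module I J) a x +
        lact (dual_module I J) b x" for a b x
      by (rule dual_module_eqI[OF dual_module_lact_mem
          dual_module_add_mem[OF dual_module_lact_mem dual_module_lact_mem]]) (simp add: simps)
    show "lact (dual_module I J) (a * b) x = lact (dual_module I J) a (lact (dual_module I J) b x)"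
      if "a \<in> B" for a b x
      by (rule dual_module_eqI[OF dual_module_lact_mem dual_module_lact_mem]) (simp add: simps that)
    show "lact (dual_module I J) 1 x = x" if "x \<in> mcar (dual_module I J)" for x
      by (rule dual_module_eqI[OF dual_module_lact_mem that])
          (simp add: lact_idx[OF JE] psi_basis[OF JE])
  qed
qed

lemma dual_module_scale:
  assumes J: "J \<subseteq> E" and v: "v \<in> mcar (dual_module I J)"
  shows "lact (dual_module I J) (s r 1) v = pscale r v"
proof (rule dual_module_eqI[OF dual_module_lact_mem])
  show "pscale r v \<in> mcar (dual_module I J)" using v by (auto simp: dual_module_def)
qed (simp add: lact_idx[OF J] scale_one_mult psi_scale psi_basis[OF J])

lemma dual_module_support:
  assumes "finite I" "J \<subseteq> E"
  shows "finite ((\<lambda>(i, e). idx i e) ` (I \<times> J))"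
    and "v \<in> mcar (dual_module I J) \<Longrightarrow> t \<notin> (\<lambda>(i, e). idx i e) ` (I \<times> J) \<Longrightarrow> v t = 0"
  using assms finite_subset[OF assms(2) finite_Basis] by (auto simp: dual_module_def)

lemma dual_module_fd:
  assumes "finite I" "right_closed J"
  shows "fd_module s B (dual_module I J)"
proof (rule fd_moduleI[OF dual_module_left_module[OF assms(2)]])
  have J: "J \<subseteq> E" using assms(2) by (simp add: right_closed_def)
  show "finite ((\<lambda>(i, e). idx i e) ` (I \<times> J))" by (rule dual_module_support[OF assms(1) J])
  show "v t = 0" if "v \<in> mcar (dual_module I J)" "t \<notin> (\<lambda>(i, e). idx i e) ` (I \<times> J)" for v t
    using dual_module_support(2)[OF assms(1) J that] .
  show "lact (dual_module I J) (s r 1) v = pscale r v" if "v \<in> mcar (dual_module I J)" for r v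
    by (rule dual_module_scale[OF J that])
qed (simp add: B_mem)

text \<open>The dual of \<open>A\<close>, and the dual of the free right \<open>B\<close>-module \<open>F\<close> with basis \<open>E\<close>.\<close>

abbreviation "dualA \<equiv> dual_module {0} E"
abbreviation "dualF \<equiv> dual_module (num ` E) (E \<inter> B)"

text \<open>Composition of functionals on \<open>A\<close> with the surjection \<open>F \<rightarrow> A\<close> that maps the basis element of
  \<open>F\<close> with index \<open>d\<close> to \<open>d\<close>.\<close>

definition pullback :: "(nat \<Rightarrow> 'k) \<Rightarrow> nat \<Rightarrow> 'k" where
  "pullback v = (if v \<in> mcar dualA
     then table (num ` E) (E \<inter> B) (\<lambda>i e. psi E v 0 (inv_into E num i * e)) else 0)"

lemma pullback_idx:
  assumes "v \<in> mcar dualA" "d \<in> E" "e \<in> E \<inter> B"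
  shows "pullback v (idx (num d) e) = psi E v 0 (d * e)"
  using assms num_inj by (simp add: pullback_def table_idx)

lemma psi_pullback:
  assumes v: "v \<in> mcar dualA" and d: "d \<in> E" and b: "b \<in> B"
  shows "psi (E \<inter> B) (pullback v) (num d) b = psi E v 0 (d * b)"
proof -
  have "psi (E \<inter> B) (pullback v) (num d) b = (\<Sum>e\<in>E \<inter> B. psi E v 0 (d * e) * coord e b)"
    unfolding psi_def[of "E \<inter> B"] using pullback_idx[OF v d] by (intro sum.cong) auto
  also have "\<dots> = (\<Sum>e\<in>E \<inter> B. psi E v 0 (d * s (coord e b) e))"
    by (simp add: scale_mult_right[symmetric] psi_scale mult.commute)
  also have "\<dots> = psi E v 0 (d * (\<Sum>e\<in>E \<inter> B. s (coord e b) e))"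
    by (simp only: psi_sum sum_distrib_left)
  finally show ?thesis using coord_span_expansion[of b "E \<inter> B"] b by (simp add: coord_span_B)
qed

lemma pullback_mem: "v \<in> mcar dualA \<Longrightarrow> pullback v \<in> mcar dualF"
  by (simp add: pullback_def table_mem)

lemma pullback_hom: "pullback \<in> lmod_hom B dualA dualF"
  unfolding lmod_hom_def
proof (intro CollectI conjI allI impI ballI)
  fix v assume v: "v \<in> mcar dualA"
  show "pullback v \<in> mcar dualF" using v by (rule pullback_mem)
  show "pullback (v + w) = pullback v + pullback w" if w: "w \<in> mcar dualA" for w
    by (rule dual_module_eqI[OF pullback_mem[OF dual_module_add_mem[OF v w]]
        dual_module_add_mem[OF pullback_mem[OF v] pullback_mem[OF w]]])
      (auto simp: pullback_idx v w dual_module_add_mem psi_add_left)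
  show "pullback (lact dualA c v) = lact dualF c (pullback v)" if c: "c \<in> B" for c
  proof (rule dual_module_eqI[OF pullback_mem[OF dual_module_lact_mem] dual_module_lact_mem])
    fix i e assume "i \<in> num ` E" and e: "e \<in> E \<inter> B"
    then obtain d where d: "d \<in> E" "i = num d" by blast
    have "pullback (lact dualA c v) (idx i e) = psi E v 0 (d * (e * c))"
      using d e psi_lact[of E "d * e" 0 "{0}" c v]
        by (simp add: pullback_idx dual_module_lact_mem coord_span_E mult.assoc)
    also have "\<dots> = psi (E \<inter> B) (pullback v) i (e * c)"
      using psi_pullback[OF v d(1), of "e * c"] c e d(2) by (simp add: B_mem)
    also have "\<dots> = lact dualF c (pullback v) (idx i e)"
      using d e by (subst lact_idx) auto
    finally show "pullback (lact dualA c v) (idx i e) = lact dualF c (pullback v) (idx i e)" .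
  qed
qed (simp add: pullback_def)

lemma pullback_inj: "inj_on pullback (mcar dualA)"
proof (rule inj_onI)
  fix v w assume v: "v \<in> mcar dualA" and w: "w \<in> mcar dualA" and eq: "pullback v = pullback w"
  show "v = w"
  proof (rule dual_module_eqI[OF v w])
    fix i e assume i: "i \<in> {0 :: nat}" and e: "e \<in> E"
    have "psi E v 0 (e * 1) = psi E w 0 (e * 1)"
      using psi_pullback[OF v e B_mem(1)] psi_pullback[OF w e B_mem(1)] eq by simp
    then show "v (idx i e) = w (idx i e)" using e i by (simp add: psi_basis)
  qed
qed

lemma psi_delta:
  assumes "J \<subseteq> E" "e \<in> J"
  shows "psi J (\<lambda>t. if t = idx i e then 1 else 0) i' a = (if i' = i then coord e a else 0)"
proof -
  have "psi J (\<lambda>t. if t = idx i e then 1 else 0) i' a =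
      (\<Sum>e'\<in>J. if e' = e then (if i' = i then coord e a else 0) else 0)"
    unfolding psi_def
  proof (intro sum.cong refl)
    fix e' assume "e' \<in> J"
    then have "idx i' e' = idx i e \<longleftrightarrow> i' = i \<and> e' = e" using assms idx_eq[of e' e] by blast
    then show "(if idx i' e' = idx i e then 1 else 0) * coord e' a =
        (if e' = e then (if i' = i then coord e a else 0) else 0)"
      by simp
  qed
  also have "\<dots> = (if i' = i then coord e a else 0)"
    using assms finite_subset[OF assms(1) finite_Basis] by simp
  finally show ?thesis .
qed

lemma delta_mem: "i \<in> I \<Longrightarrow> e \<in> J \<Longrightarrow> (\<lambda>t. if t = idx i e then 1 else 0) \<in> mcar (dual_module I J)"
  by (auto simp: dual_module_def split: if_splits)

lemma ind_carrier: "mcar (ind s B X) = ev_span (tensor_forms s B AA X) (UNIV \<times> mcar X)"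
  by (simp add: ind_def tensor_lmod_def)

lemma tensor_gen_rules:
  assumes "w \<in> mcar Y"
  shows "tensor_gen s B AA Y (a + a', w) = tensor_gen s B AA Y (a, w) + tensor_gen s B AA Y (a', w)"
    and "w' \<in> mcar Y \<Longrightarrow> tensor_gen s B AA Y (a, w + w') = tensor_gen s B AA Y (a, w) +
        tensor_gen s B AA Y (a, w')"
    and "tensor_gen s B AA Y (s r a, w) = pscale r (tensor_gen s B AA Y (a, w))"
    and "c \<in> B \<Longrightarrow> tensor_gen s B AA Y (a * c, w) = tensor_gen s B AA Y (a, lact Y c w)"
  using assms by (auto simp: fun_eq_iff ev_def tensor_forms_def scale_one_mult)

lemma tensor_forms_iff:
  "\<beta> \<in> tensor_forms s B AA X \<longleftrightarrow>
     (\<forall>a a'. \<forall>y\<in>mcar X. \<beta> (a + a', y) = \<beta> (a, y) + \<beta> (a', y)) \<and>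
     (\<forall>a. \<forall>y\<in>mcar X. \<forall>y'\<in>mcar X. \<beta> (a, y + y') = \<beta> (a, y) + \<beta> (a, y')) \<and>
     (\<forall>r a. \<forall>y\<in>mcar X. \<beta> (s r a, y) = r * \<beta> (a, y)) \<and>
     (\<forall>c\<in>B. \<forall>a. \<forall>y\<in>mcar X. \<beta> (a * c, y) = \<beta> (a, lact X c y))"
  by (simp add: tensor_forms_def scale_one_mult)

lemma ind_subspace:
  "module.subspace pscale (mcar (ind s B X))"
proof -
  interpret V: vector_space "pscale :: 'k \<Rightarrow> (('a \<times> 'b \<Rightarrow> 'k) \<Rightarrow> 'k) \<Rightarrow> ('a \<times> 'b \<Rightarrow> 'k) \<Rightarrow> 'k"
    by (rule vector_space_pscale)
  let ?\<Omega> = "tensor_forms s B AA X" and ?X = "UNIV \<times> mcar X"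
  show ?thesis
    unfolding ind_carrier
  proof (rule V.subspaceI)
    show "0 \<in> ev_span ?\<Omega> ?X" unfolding ev_span_def by (auto intro!: exI[of _ "[]"])
    show "x + y \<in> ev_span ?\<Omega> ?X" if "x \<in> ev_span ?\<Omega> ?X" "y \<in> ev_span ?\<Omega> ?X" for x y
    proof -
      obtain xs ys where "set xs \<subseteq> ?X" "x = (\<Sum>x\<leftarrow>xs. ev ?\<Omega> x)" "set ys \<subseteq> ?X" "y = (\<Sum>x\<leftarrow>ys. ev ?\<Omega> x)"
        using \<open>x \<in> _\<close> \<open>y \<in> _\<close> unfolding ev_span_def by blast
      then have "set (xs @ ys) \<subseteq> ?X" "x + y = (\<Sum>x\<leftarrow>xs @ ys. ev ?\<Omega> x)" by simp_all
      then show ?thesis unfolding ev_span_def by blast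
    qed
    show "pscale r x \<in> ev_span ?\<Omega> ?X" if "x \<in> ev_span ?\<Omega> ?X" for r x
    proof -
      obtain xs where xs: "set xs \<subseteq> ?X" "x = (\<Sum>x\<leftarrow>xs. ev ?\<Omega> x)"
        using \<open>x \<in> _\<close> unfolding ev_span_def by blast
      have "pscale r (\<Sum>x\<leftarrow>xs. ev ?\<Omega> x) = (\<Sum>x\<leftarrow>map (\<lambda>(a, x). (s r a, x)) xs. ev ?\<Omega> x)"
        using xs(1)
      proof (induction xs)
        case Nil
        show ?case by (simp add: fun_eq_iff)
      next
        case (Cons q xs)
        obtain a y where q: "q = (a, y)" by (cases q)
        with Cons.prems have y: "y \<in> mcar X" by simp
        have "pscale r (\<Sum>x\<leftarrow>q # xs. ev ?\<Omega> x) = pscale r (ev ?\<Omega> (a, y)) + pscale r (\<Sum>x\<leftarrow>xs. ev ?\<Omega> x)"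
          by (simp add: q fun_eq_iff distrib_left)
        then show ?case
          unfolding tensor_gen_rules(3)[OF y, symmetric] using Cons
            by (simp add: q del: plus_fun_apply)
      qed
      moreover have "set (map (\<lambda>(a, x). (s r a, x)) xs) \<subseteq> ?X" using xs(1) by auto
      ultimately show ?thesis using xs(2) unfolding ev_span_def by blast
    qed
  qed
qed

text \<open>The pairing of \<open>A\<close> with its dual is a functional on \<open>A \<otimes>\<^sub>B dualA\<close>. By exactness this space
  embeds into \<open>A \<otimes>\<^sub>B dualF\<close>, so the functional extends to a balanced form \<open>\<beta>\<close> on \<open>A \<times> dualF\<close>. Since
  \<open>F\<close> is finite-dimensional, \<open>\<beta>\<close> amounts to a right \<open>B\<close>-linear map \<open>\<sigma>\<close> from \<open>A\<close> to \<open>F\<close>, and that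
  \<open>\<beta>\<close> extends the pairing says that \<open>\<sigma>\<close> splits the surjection \<open>F \<rightarrow> A\<close>. The components of \<open>\<sigma>\<close> are
  the functionals of a dual basis.\<close>

lemma dual_basis_exists:
  assumes exact: "ind_exact s B"
  shows "\<exists>D. (\<forall>q\<in>set D. snd q \<in> mcar (dual_bimod B)) \<and> (\<forall>a. (\<Sum>(d, f)\<leftarrow>D. d * f a) = a)"
proof -
  let ?\<Omega>X = "tensor_forms s B AA dualA" and ?\<Omega>Y = "tensor_forms s B AA dualF"
  interpret VX: vector_space "pscale :: 'k \<Rightarrow> (('a \<times> (nat \<Rightarrow> 'k) \<Rightarrow> 'k) \<Rightarrow> 'k) \<Rightarrow>
      ('a \<times> (nat \<Rightarrow> 'k) \<Rightarrow> 'k) \<Rightarrow> 'k"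
    by (rule vector_space_pscale)
  interpret VV: vector_space_pair
    "pscale :: 'k \<Rightarrow> (('a \<times> (nat \<Rightarrow> 'k) \<Rightarrow> 'k) \<Rightarrow> 'k) \<Rightarrow> ('a \<times> (nat \<Rightarrow> 'k) \<Rightarrow> 'k) \<Rightarrow> 'k"
    "pscale :: 'k \<Rightarrow> (('a \<times> (nat \<Rightarrow> 'k) \<Rightarrow> 'k) \<Rightarrow> 'k) \<Rightarrow> ('a \<times> (nat \<Rightarrow> 'k) \<Rightarrow> 'k) \<Rightarrow> 'k"
    by unfold_locales
  define \<Lambda> where "\<Lambda> = lin_ext (\<lambda>(a, v). ev ?\<Omega>Y (a, pullback v))"
  have lin: "Vector_Spaces.linear pscale pscale \<Lambda>"
    by unfold_locales (simp_all only: \<Lambda>_def lin_ext_add lin_ext_pscale)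
  have inj: "inj_on \<Lambda> (mcar (ind s B dualA))"
  proof -
    have fin: "finite (num ` E)" using finite_Basis by simp
    have JE: "E \<inter> B \<subseteq> E" by blast
    have "inj_on (ind_map s B dualA dualF pullback) (mcar (ind s B dualA))"
    proof (rule ind_map_injective[OF exact])
      show "finite ((\<lambda>(i, e). idx i e) ` (num ` E \<times> (E \<inter> B)))"
        by (rule dual_module_support[OF fin JE])
      show "v t = 0" if "v \<in> mcar dualF" "t \<notin> (\<lambda>(i, e). idx i e) ` (num ` E \<times> (E \<inter> B))" for v t
        using dual_module_support(2)[OF fin JE that] .
    qed (simp_all add: dual_module_left_module dual_module_fd right_closed dual_module_scale B_mem
        pullback_hom pullback_inj)
    moreover have "ind_map s B dualA dualF pullback t = \<Lambda> t" if "t \<in> mcar (ind s B dualA)" for t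
      using that by (simp add: ind_map_def \<Lambda>_def)
    ultimately show ?thesis by (simp cong: inj_on_cong)
  qed
  obtain g where g: "Vector_Spaces.linear pscale pscale g" "\<forall>t\<in>mcar (ind s B dualA). g (\<Lambda> t) = t"
    using VV.linear_exists_left_inverse_on[OF lin ind_subspace inj] by blast
  interpret g: Vector_Spaces.linear
    "pscale :: 'k \<Rightarrow> (('a \<times> (nat \<Rightarrow> 'k) \<Rightarrow> 'k) \<Rightarrow> 'k) \<Rightarrow> ('a \<times> (nat \<Rightarrow> 'k) \<Rightarrow> 'k) \<Rightarrow> 'k"
    "pscale :: 'k \<Rightarrow> (('a \<times> (nat \<Rightarrow> 'k) \<Rightarrow> 'k) \<Rightarrow> 'k) \<Rightarrow> ('a \<times> (nat \<Rightarrow> 'k) \<Rightarrow> 'k) \<Rightarrow> 'k" g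
    by (rule g(1))
  define \<omega> where "\<omega> = (\<lambda>(a, v). psi E v 0 a)"
  have \<omega>: "\<omega> \<in> ?\<Omega>X"
    by (simp add: \<omega>_def tensor_forms_def psi_add psi_add_left psi_scale scale_one_mult psi_lact
        coord_span_E)
  define \<beta> where "\<beta> a w = g (ev ?\<Omega>Y (a, w)) \<omega>" for a w
  have \<beta>: "\<beta> (a + a') w = \<beta> a w + \<beta> a' w" "w' \<in> mcar dualF \<Longrightarrow> \<beta> a (w + w') = \<beta> a w + \<beta> a w'"
      "\<beta> (s r a) w = r * \<beta> a w" "c \<in> B \<Longrightarrow> \<beta> (a * c) w = \<beta> a (lact dualF c w)"
    if "w \<in> mcar dualF" for a a' w w' c r
    using that by (simp_all add: \<beta>_def tensor_gen_rules g.add g.scale)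
  have \<beta>_scale: "\<beta> a (pscale r w) = r * \<beta> a w" if "w \<in> mcar dualF" for a r w
    using \<beta>(4)[OF that, of "s r 1" a] \<beta>(3)[OF that] dual_module_scale[OF _ that, of r]
    by (simp add: B_mem scale_one_mult)
  have \<beta>_pullback: "\<beta> a (pullback v) = psi E v 0 a" if v: "v \<in> mcar dualA" for a v
  proof -
    have form: "(\<lambda>x. (case x of (a, v) \<Rightarrow> ev ?\<Omega>Y (a, pullback v)) \<eta>) \<in> ?\<Omega>X" for \<eta>
      unfolding tensor_forms_iff
      by (simp add: lmod_homD(3,4)[OF pullback_hom] tensor_gen_rules[OF pullback_mem] pullback_mem)
    have "\<Lambda> (ev ?\<Omega>X (a, v)) = ev ?\<Omega>Y (a, pullback v)"
      using form by (simp add: \<Lambda>_def lin_ext_def ev_def[of ?\<Omega>X] fun_eq_iff)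
    moreover have "ev ?\<Omega>X (a, v) \<in> mcar (ind s B dualA)"
      unfolding ind_carrier ev_span_def using v by (auto intro!: exI[of _ "[(a, v)]"])
    ultimately have "g (ev ?\<Omega>Y (a, pullback v)) = ev ?\<Omega>X (a, v)" using g(2) by metis
    then show ?thesis using \<omega> by (simp add: \<beta>_def ev_def \<omega>_def)
  qed
  \<comment> \<open>\<open>u d e\<close> is the functional that reads off the coordinate \<open>e\<close> of the component with index \<open>d\<close>;
    these functionals form a basis of \<open>dualF\<close>.\<close>
  define u where "u d e = (\<lambda>t. if t = idx (num d) e then 1 else 0 :: 'k)" for d e
  have u: "u d e \<in> mcar dualF" if "d \<in> E" "e \<in> E \<inter> B" for d e
    unfolding u_def by (rule delta_mem) (use that in auto)
  define \<sigma> where "\<sigma> d a = (\<Sum>e\<in>E \<inter> B. s (\<beta> a (u d e)) e)" for d a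
  have \<sigma>_B: "\<sigma> d a \<in> B" for d a
  proof -
    have "(\<Sum>e\<in>S. s (\<beta> a (u d e)) e) \<in> B" if "S \<subseteq> B" for S
      using that by (induction S rule: infinite_finite_induct) (auto intro: B_mem)
    then show ?thesis by (simp add: \<sigma>_def)
  qed
  have psi_\<sigma>: "psi J w i (\<sigma> d a) = (\<Sum>e\<in>E \<inter> B. \<beta> a (u d e) * psi J w i e)" for J w i d a
    by (simp add: \<sigma>_def psi_sum psi_scale)
  have \<beta>_sum: "\<beta> a (\<Sum>x\<in>S. f x) = (\<Sum>x\<in>S. \<beta> a (f x)) \<and> (\<Sum>x\<in>S. f x) \<in> mcar dualF"
    if "finite S" "\<And>x. x \<in> S \<Longrightarrow> f x \<in> mcar dualF" for a f and S :: "('a \<times> 'a) set"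
    using that
  proof (induction S)
    case empty
    have 0: "0 \<in> mcar dualF" using dual_module_subgroup by (simp add: add_subgroup_def)
    have "pscale 0 (0 :: nat \<Rightarrow> 'k) = 0" by (simp add: fun_eq_iff)
    then have "\<beta> a 0 = 0" using \<beta>_scale[OF 0, of a 0] by (simp only: mult_zero_left)
    then show ?case using 0 by (simp del: zero_fun_apply)
  next
    case (insert x S)
    then show ?case
      using \<beta>(2)[of "f x" "sum f S" a] dual_module_add_mem[of "f x" _ _ "sum f S"]
        by (simp del: plus_fun_apply)
  qed
  \<comment> \<open>\<open>\<beta> a w\<close> is the value of the functional \<open>w\<close> at \<open>\<sigma> a\<close>.\<close>
  have \<beta>_eq: "(\<Sum>d\<in>E. psi (E \<inter> B) w (num d) (\<sigma> d a)) = \<beta> a w" if w: "w \<in> mcar dualF" for a w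
  proof -
    let ?f = "\<lambda>(d, e). pscale (w (idx (num d) e)) (u d e)"
    have f: "?f x \<in> mcar dualF" if "x \<in> E \<times> (E \<inter> B)" for x
      using that u by (auto simp: dual_module_def u_def split: if_splits)
    have fin: "finite (E \<times> (E \<inter> B))" using finite_Basis by simp
    have "w = (\<Sum>x\<in>E \<times> (E \<inter> B). ?f x)"
    proof (rule dual_module_eqI[OF w])
      show "(\<Sum>x\<in>E \<times> (E \<inter> B). ?f x) \<in> mcar dualF"
        using fin f by (rule conjunct2[OF \<beta>_sum])
      fix i e assume "i \<in> num ` E" and e: "e \<in> E \<inter> B"
      then obtain d where d: "d \<in> E" "i = num d" by blast
      have "(\<Sum>x\<in>S. ?f x) t = (\<Sum>x\<in>S. ?f x t)" if "finite S" for S t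
        using that by induction auto
      then have "(\<Sum>x\<in>E \<times> (E \<inter> B). ?f x) (idx i e) = (\<Sum>x\<in>E \<times> (E \<inter> B). ?f x (idx i e))"
        using fin by blast
      also have "\<dots> = (\<Sum>x\<in>E \<times> (E \<inter> B). if x = (d, e) then w (idx i e) else 0)"
      proof (intro sum.cong refl)
        fix x assume x: "x \<in> E \<times> (E \<inter> B)"
        then obtain d' e' where x': "x = (d', e')" "d' \<in> E" "e' \<in> E" by auto
        have "num d = num d' \<longleftrightarrow> d' = d" using num_inj d x' by (auto simp: inj_on_def)
        then show "?f x (idx i e) = (if x = (d, e) then w (idx i e) else 0)"
          using d x' e idx_eq[of e e' i "num d'"] by (auto simp: u_def)
      qed
      also have "\<dots> = w (idx i e)" using d e fin by simp
      finally show "w (idx i e) = (\<Sum>x\<in>E \<times> (E \<inter> B). ?f x) (idx i e)" ..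
    qed
    then have "\<beta> a w = \<beta> a (\<Sum>x\<in>E \<times> (E \<inter> B). ?f x)" by (rule arg_cong)
    also have "\<dots> = (\<Sum>x\<in>E \<times> (E \<inter> B). \<beta> a (?f x))"
      using fin f by (rule conjunct1[OF \<beta>_sum])
    also have "\<dots> = (\<Sum>(d, e)\<in>E \<times> (E \<inter> B). w (idx (num d) e) * \<beta> a (u d e))"
      by (intro sum.cong refl) (auto simp: \<beta>_scale u)
    also have "\<dots> = (\<Sum>d\<in>E. psi (E \<inter> B) w (num d) (\<sigma> d a))"
      unfolding psi_\<sigma> sum.cartesian_product[symmetric]
      by (intro sum.cong refl) (simp add: psi_basis mult.commute)
    finally show ?thesis ..
  qed
  have \<beta>_u: "\<beta> a (u d e) = coord e (\<sigma> d a)" if "d \<in> E" "e \<in> E \<inter> B" for a d e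
  proof -
    have "\<beta> a (u d e) = (\<Sum>d'\<in>E. psi (E \<inter> B) (u d e) (num d') (\<sigma> d' a))"
      by (simp only: \<beta>_eq[OF u[OF that]])
    also have "\<dots> = (\<Sum>d'\<in>E. if d' = d then coord e (\<sigma> d a) else 0)"
      using that num_inj unfolding u_def by (intro sum.cong) (auto simp: psi_delta inj_on_def)
    finally show ?thesis using that finite_Basis by simp
  qed
  have \<sigma>_eqI: "b = b'" if "b \<in> B" "b' \<in> B" "\<And>e. e \<in> E \<inter> B \<Longrightarrow> coord e b = coord e b'" for b b'
  proof (rule coord_eqI)
    fix e assume "e \<in> E"
    moreover have "b \<in> coord_span (E \<inter> B)" "b' \<in> coord_span (E \<inter> B)" using that
      by (simp_all add: coord_span_B)
    ultimately show "coord e b = coord e b'"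
      using that(3)[of e] by (cases "e \<in> E \<inter> B") (auto simp: coord_span_def)
  qed
  have \<sigma>_mult: "\<sigma> d (a * c) = \<sigma> d a * c" if d: "d \<in> E" and c: "c \<in> B" for d a c
  proof (rule \<sigma>_eqI[OF \<sigma>_B B_mem(3)[OF \<sigma>_B c]])
    fix e assume e: "e \<in> E \<inter> B"
    have "coord e (\<sigma> d (a * c)) = \<beta> a (lact dualF c (u d e))"
      using \<beta>_u[OF d e] \<beta>(4)[OF u[OF d e] c] by simp
    also have "\<dots> = (\<Sum>d'\<in>E. psi (E \<inter> B) (lact dualF c (u d e)) (num d') (\<sigma> d' a))"
      by (simp only: \<beta>_eq[OF dual_module_lact_mem])
    also have "\<dots> = (\<Sum>d'\<in>E. if d' = d then coord e (\<sigma> d a * c) else 0)"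
    proof (intro sum.cong refl)
      fix d' assume d': "d' \<in> E"
      have "psi (E \<inter> B) (lact dualF c (u d e)) (num d') (\<sigma> d' a) =
          psi (E \<inter> B) (u d e) (num d') (\<sigma> d' a * c)"
        using d' \<sigma>_B by (intro psi_lact) (auto simp: coord_span_B)
      also have "\<dots> = (if d' = d then coord e (\<sigma> d a * c) else 0)"
        using d d' e num_inj unfolding u_def by (auto simp: psi_delta inj_on_def)
      finally show "psi (E \<inter> B) (lact dualF c (u d e)) (num d') (\<sigma> d' a) =
          (if d' = d then coord e (\<sigma> d a * c) else 0)" .
    qed
    finally show "coord e (\<sigma> d (a * c)) = coord e (\<sigma> d a * c)" using d finite_Basis by simp
  qed
  have \<sigma>_add: "\<sigma> d (a + a') = \<sigma> d a + \<sigma> d a'" if "d \<in> E" for d a a'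
    using that by (simp add: \<sigma>_def \<beta> u scale_left_distrib sum.distrib)
  have \<sigma>_expansion: "(\<Sum>d\<in>E. d * \<sigma> d a) = a" for a
  proof (rule coord_eqI)
    fix e assume e: "e \<in> E"
    let ?v = "\<lambda>t. if t = idx 0 e then 1 else 0 :: 'k"
    have v: "?v \<in> mcar dualA" by (rule delta_mem) (use e in auto)
    have coord: "psi E ?v 0 x = coord e x" for x using psi_delta[OF order_refl e, of 0 0 x] by simp
    have "coord e a = \<beta> a (pullback ?v)" by (simp only: \<beta>_pullback[OF v] coord)
    also have "\<dots> = (\<Sum>d\<in>E. psi (E \<inter> B) (pullback ?v) (num d) (\<sigma> d a))"
      by (simp only: \<beta>_eq[OF pullback_mem[OF v]])
    also have "\<dots> = (\<Sum>d\<in>E. psi E ?v 0 (d * \<sigma> d a))"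
      using psi_pullback[OF v _ \<sigma>_B] by (intro sum.cong) auto
    also have "\<dots> = psi E ?v 0 (\<Sum>d\<in>E. d * \<sigma> d a)"
      by (rule psi_sum[symmetric])
    also have "\<dots> = coord e (\<Sum>d\<in>E. d * \<sigma> d a)"
      by (rule coord)
    finally show "coord e (\<Sum>d\<in>E. d * \<sigma> d a) = coord e a" ..
  qed
  obtain es where es: "set es = E" "distinct es"
    using finite_distinct_list[OF finite_Basis] by blast
  have "\<forall>q\<in>set (map (\<lambda>d. (d, \<sigma> d)) es). snd q \<in> mcar (dual_bimod B)"
    using es \<sigma>_B \<sigma>_add \<sigma>_mult by (auto simp: dual_bimod_def)
  moreover have "(\<Sum>(d, f)\<leftarrow>map (\<lambda>d. (d, \<sigma> d)) es. d * f a) = a" for a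
    using \<sigma>_expansion[of a] es by (simp add: comp_def sum_list_distinct_conv_sum_set)
  ultimately show ?thesis by blast
qed

end

section \<open>The right dual coring\<close>

lemma adapted_basis_exists:
  assumes fd: "fd_algebra s" and B: "subalgebra s B"
  shows "\<exists>E. adapted_basis s E B"
proof -
  interpret vector_space s using fd by (simp add: fd_algebra_def)
  obtain S where S: "finite S" "span S = UNIV" using fd by (auto simp: fd_algebra_def)
  obtain G where G: "G \<subseteq> B" "independent G" "B \<subseteq> span G" by (rule basis_exists)
  define E where "E = extend_basis G"
  have E: "G \<subseteq> E" "independent E" "span E = UNIV"
    unfolding E_def using extend_basis_superset independent_extend_basis span_extend_basis G(2)
        by blast+
  have fin: "finite E" using independent_span_bound[OF S(1) E(2)] S(2) by simp
  have "span G \<subseteq> span (E \<inter> B)" using E(1) G(1) by (intro span_mono) blast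
  then have "B \<subseteq> span (E \<inter> B)" using G(3) by blast
  then have "adapted_basis s E B"
    using fd fin E B by unfold_locales (auto simp: fd_algebra_def)
  then show ?thesis ..
qed

lemma right_dual_coring_gen: "tpow_gen s B (right_dual_coring s B) = tpow_gen s B (dual_bimod B)"
  by (simp add: tpow_gen_def tpow_forms_def right_dual_coring_def fun_eq_iff)

context fd_algebra_with_subalgebra
begin

lemma bimodule_dual: "bimodule s B (dual_bimod B)"
proof -
  have scalar: "f (s r x) = s r (f x)" if "\<forall>x. \<forall>b\<in>B. f (x * b) = f x * b" for f r x
    using bspec[OF spec[OF that, of x], of "s r 1"] by (simp add: scale_one_mult B_mem)
  have "add_subgroup (mcar (dual_bimod B))"
    unfolding add_subgroup_def
    by (auto simp: dual_bimod_def B_mem algebra_simps)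
  then show ?thesis
    unfolding bimodule_def left_module_def
    by (intro conjI ballI allI ext)
      (simp_all add: dual_bimod_def B_mem distrib_left distrib_right mult.assoc[symmetric]
          scale_one_mult scalar)
qed

lemma dual_pairing_dual_bimod:
  assumes "\<And>q. q \<in> set D \<Longrightarrow> snd q \<in> mcar (dual_bimod B)" "\<And>a. (\<Sum>(d, f)\<leftarrow>D. d * f a) = a"
  shows "dual_pairing s E B (dual_bimod B) (\<lambda>f. f) D"
proof
  show "bimodule s B (dual_bimod B)" by (rule bimodule_dual)
  show "snd q \<in> mcar (dual_bimod B)" if "q \<in> set D" for q using that by (rule assms(1))
  show "(\<Sum>(d, f)\<leftarrow>D. d * f a) = a" for a by (rule assms(2))
qed (auto simp: dual_bimod_def)

text \<open>Faithfulness is injectivity of \<open>\<theta>\<close>; the dual basis is carried over along the inverse of \<open>\<theta>\<close>.\<close>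

lemma dual_pairing_iso:
  assumes D: "dual_pairing s E B (dual_bimod B) (\<lambda>f. f) D"
    and C: "bimodule s B C"
    and \<theta>: "\<theta> \<in> bimod_hom B C (right_dual_coring s B)"
        "bij_betw \<theta> (mcar C) (mcar (right_dual_coring s B))"
  shows "dual_pairing s E B C \<theta> (map (\<lambda>(d, f). (d, inv_into (mcar C) \<theta> f)) D)"
proof -
  interpret D: dual_pairing s E B "dual_bimod B" "\<lambda>f. f" D by (rule D)
  have car: "mcar (right_dual_coring s B) = mcar (dual_bimod B)"
    "lact (right_dual_coring s B) b f = (\<lambda>x. b * f x)"
        "ract (right_dual_coring s B) f b = (\<lambda>x. f (b * x))" for b f
    by (simp_all add: right_dual_coring_def dual_bimod_def)
  note hom = bimod_homD[OF \<theta>(1), unfolded car]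
  have inv: "inv_into (mcar C) \<theta> f \<in> mcar C" "\<theta> (inv_into (mcar C) \<theta> f) = f"
    if "f \<in> mcar (dual_bimod B)" for f
    using that \<theta>(2) inv_into_into[of f \<theta> "mcar C"] f_inv_into_f[of f \<theta> "mcar C"]
    unfolding bij_betw_def car by auto
  show ?thesis
  proof
    show "bimodule s B C" by fact
    show "x = y" if "x \<in> mcar C" "y \<in> mcar C" "\<And>a. \<theta> x a = \<theta> y a" for x y
      using bij_betw_imp_inj_on[OF \<theta>(2)] that by (auto simp: inj_on_def fun_eq_iff)
    show "snd q \<in> mcar C" if "q \<in> set (map (\<lambda>(d, f). (d, inv_into (mcar C) \<theta> f)) D)" for q
      using that inv D.dual_mem by fastforce
    have "(\<Sum>(d, c)\<leftarrow>map (\<lambda>(d, f). (d, inv_into (mcar C) \<theta> f)) D. d * \<theta> c a) = (\<Sum>(d, f)\<leftarrow>D. d * f a)"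
        for a
      using inv D.dual_mem by (auto simp: comp_def intro!: arg_cong[where f = sum_list])
    then show "(\<Sum>(d, c)\<leftarrow>map (\<lambda>(d, f). (d, inv_into (mcar C) \<theta> f)) D. d * \<theta> c a) = a" for a
      by (simp only: D.dual_basis)
  qed (use hom D.p_mem D.p_add_right D.p_mult_right in auto)
qed

text \<open>The definite description of the comultiplication is satisfied by exactly one tensor. The
  tensor obtained from the multiplication of \<open>A\<close> by transposition satisfies it, and any other
  solution has the same pairings.\<close>

lemma right_dual_comult:
  assumes D: "dual_pairing s E B (dual_bimod B) (\<lambda>f. f) D" and f: "f \<in> mcar (dual_bimod B)"
  shows "dual_pairing.pair s E (\<lambda>f. f) (comult (right_dual_coring s B) f) 1 [a, a'] = f (a * a')"
proof -
  interpret dual_pairing s E B "dual_bimod B" "\<lambda>f. f" D by (rule D)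
  let ?D = "mcar (dual_bimod B)"
  let ?P = "\<lambda>t. \<exists>fs. set fs \<subseteq> ?D \<times> ?D \<and> t = (\<Sum>(f1, f2)\<leftarrow>fs. cgen (1, [f1, f2])) \<and>
      (\<forall>a a'. f (a * a') = (\<Sum>(f1, f2)\<leftarrow>fs. f1 (f2 a * a')))"
  have mem: "(\<Sum>(f1, f2)\<leftarrow>fs. cgen (1, [f1, f2])) \<in> cpow 2 \<and>
      pair (\<Sum>(f1, f2)\<leftarrow>fs. cgen (1, [f1, f2])) 1 [a, a'] = (\<Sum>(f1, f2)\<leftarrow>fs. f1 (f2 a * a'))"
    if "set fs \<subseteq> ?D \<times> ?D" for fs a a'
    using that
  proof (induction fs)
    case Nil
    show ?case unfolding list.map sum_list.Nil pair_linear using tpow_0_mem by blast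
  next
    case (Cons q fs)
    obtain f1 f2 where q: "q = (f1, f2)" by (cases q)
    have "nest [f1, f2] 1 [a, a'] = f1 (f2 a * a')"
      using nest_Cons[of "[f2]" "[a]" f1 1 a'] nest_snoc[of "[]" f2 1 a "[]"] by simp
    then show ?case
      using Cons q tpow_gen_mem[of 1 B "[f1, f2]" "dual_bimod B" 2 s]
      by (simp add: pair_linear pair_gen tpow_add_mem B_mem del: plus_fun_apply)
  qed
  have decomp: "\<exists>fs. set fs \<subseteq> ?D \<times> ?D \<and> t = (\<Sum>(f1, f2)\<leftarrow>fs. cgen (1, [f1, f2]))" if "t \<in> cpow 2" for t
    using that
  proof (induction rule: tpow_induct)
    case zero
    show ?case by (rule exI[of _ "[]"]) (simp del: zero_fun_apply)
  next
    case (gen b xs)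
    then obtain x y where xs: "xs = [x, y]" by (cases xs; cases "tl xs") auto
    have "cgen (b, xs) = cgen (1, [lact (dual_bimod B) b x, y])"
      using multibalancedD(4)[OF multibalanced_gen B_mem(1) gen(1), of x "dual_bimod B" "[y]" 2 s]
          gen(2) xs
      by simp
    then show ?case
      using gen xs C_mem(4)[OF gen(1), of x]
      by (intro exI[of _ "[(lact (dual_bimod B) b x, y)]"]) simp
  next
    case (add t u)
    then obtain fs gs where "set fs \<subseteq> ?D \<times> ?D" "t = (\<Sum>(f1, f2)\<leftarrow>fs. cgen (1, [f1, f2]))"
      "set gs \<subseteq> ?D \<times> ?D" "u = (\<Sum>(f1, f2)\<leftarrow>gs. cgen (1, [f1, f2]))" by blast
    then show ?case by (intro exI[of _ "fs @ gs"]) (simp del: plus_fun_apply)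
  qed
  define t where "t = cartier_of 2 (mult_cochain s B) f"
  have t: "t \<in> cpow 2" "pair t 1 [a, a'] = f (a * a')" for a a'
    using cartier_of_mem[OF f] pair_cartier_of[OF mult_cochain_hom f B_mem(1), of "[a, a']"]
    by (simp_all add: t_def mult_cochain_gen B_mem)
  have Pt: "?P t" using decomp[OF t(1)] mem t(2) by metis
  have "comult (right_dual_coring s B) f = (THE t. ?P t)"
    using f by (simp add: right_dual_coring_def)
  also have "\<dots> = t"
  proof (rule the_equality)
    show "?P t" by (rule Pt)
    fix u assume "?P u"
    then obtain fs where fs: "set fs \<subseteq> ?D \<times> ?D" "u = (\<Sum>(f1, f2)\<leftarrow>fs. cgen (1, [f1, f2]))"
      "\<forall>a a'. f (a * a') = (\<Sum>(f1, f2)\<leftarrow>fs. f1 (f2 a * a'))" by blast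
    show "u = t"
    proof (rule pair_separates[of _ 2])
      show "u \<in> cpow 2" "t \<in> cpow 2" using mem[OF fs(1)] fs(2) t(1) by simp_all
      fix as :: "'a list" assume "length as = 2"
      then obtain a a' where "as = [a, a']" by (cases as; cases "tl as") auto
      then show "pair u 1 as = pair t 1 as" using mem[OF fs(1), of a a'] fs(2,3) t(2) by simp
    qed
  qed
  finally show ?thesis using t(2) by simp
qed

end

theorem corollary4p8:
  fixes s :: "'k::alg_closed_field \<Rightarrow> 'a::{ring,monoid_mult} \<Rightarrow> 'a"
    and I :: "'i::order set"
    and LA \<Delta> LB :: "'i \<Rightarrow> ('a, nat \<Rightarrow> 'k) lmod"
    and B :: "'a set"
    and C :: "('k, 'a, 'c::ab_group_add) coring"
  assumes "fd_algebra s"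
    and "quasi_hereditary s UNIV I LA \<Delta>"
    and "exact_borel s I \<Delta> B LB"
    and "homological s B"
    and "directed_coring s B I LB C"
    and "coring_iso s B C (right_dual_coring s B)"
  shows "gerst_iso (cartier_cohomology s B C) (gerst_opp (rel_hochschild_cohomology s B))"
proof -
  have sub: "subalgebra s B" and exact: "ind_exact s B"
    using assms(3) by (auto simp: exact_borel_def ind_exact_def)
  have coring: "is_coring s B C" using assms(5) by (simp add: directed_coring_def)
  then have bimod: "bimodule s B C" and comult: "comult C \<in> bimod_hom B C (tpow s B C 2)"
    by (simp_all add: is_coring_def)
  obtain E where "adapted_basis s E B" using adapted_basis_exists[OF assms(1) sub] by blast
  then interpret adapted_basis s E B .
  obtain D where D0: "\<forall>q\<in>set D. snd q \<in> mcar (dual_bimod B)" "\<forall>a. (\<Sum>(d, f)\<leftarrow>D. d * f a) = a"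
    using dual_basis_exists[OF exact] by blast
  then have D: "dual_pairing s E B (dual_bimod B) (\<lambda>f. f) D"
    by (intro dual_pairing_dual_bimod) blast+
  obtain \<theta> where \<theta>: "\<theta> \<in> bimod_hom B C (right_dual_coring s B)"
      "bij_betw \<theta> (mcar C) (mcar (right_dual_coring s B))"
    and \<theta>_comult: "\<And>c. c \<in> mcar C \<Longrightarrow> comult (right_dual_coring s B) (\<theta> c) =
        lin_ext (\<lambda>(b, xs). tpow_gen s B (dual_bimod B) (b, map \<theta> xs)) (comult C c)"
    using assms(6) unfolding coring_iso_def right_dual_coring_gen by blast
  interpret D: dual_pairing s E B "dual_bimod B" "\<lambda>f. f" D by (rule D)
  interpret C: dual_pairing s E B C \<theta> "map (\<lambda>(d, f). (d, inv_into (mcar C) \<theta> f)) D"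
    by (rule dual_pairing_iso[OF D bimod \<theta>])
  have \<theta>_mem: "\<theta> x \<in> mcar (dual_bimod B)" if "x \<in> mcar C" for x
    using bimod_homD(1)[OF \<theta>(1) that] by (simp add: right_dual_coring_def)
  \<comment> \<open>The two pairings agree along \<open>\<theta>\<close>, so compatibility of \<open>\<theta>\<close> with the comultiplications carries
    over the formula for the comultiplication of the right dual coring.\<close>
  have nest: "D.nest (map \<theta> xs) z as = C.nest xs z as" for xs z as
    by (simp add: D.nest_def C.nest_def rev_map zip_map1 foldl_map split_def)
  have bal: "multibalanced pscale s B C n (\<lambda>(b, xs). D.cgen (b, map \<theta> xs))" for n
  proof (rule multibalanced_separated[where P = "D.cpow n" and J = "{as. length as = n}"
        and L = "\<lambda>as t. D.pair t 1 as", OF bimod])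
    show "t + u \<in> D.cpow n" if "t \<in> D.cpow n" "u \<in> D.cpow n" for t u using that by (rule tpow_add_mem)
    show "pscale r t \<in> D.cpow n" if "t \<in> D.cpow n" for r t using that by (rule tpow_pscale_mem)
    show "D.pair (pscale r t) 1 as = s r (D.pair t 1 as)" for r t as by (rule D.pair_linear)
    show "t = u" if "t \<in> D.cpow n" "u \<in> D.cpow n"
        "\<And>as. as \<in> {as. length as = n} \<Longrightarrow> D.pair t 1 as = D.pair u 1 as" for t u
      using that by (intro D.pair_separates[of t n]) simp_all
    show "(case (b, xs) of (b, xs) \<Rightarrow> D.cgen (b, map \<theta> xs)) \<in> D.cpow n"
      if "b \<in> B" "xs \<in> lists (mcar C)" "length xs = n" for b xs
      using that \<theta>_mem by (auto intro!: tpow_gen_mem)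
    fix as assume "as \<in> {as :: 'a list. length as = n}"
    then have as: "length as = n" by simp
    show "multibalanced s s B C n (\<lambda>g. D.pair (case g of (b, xs) \<Rightarrow> D.cgen (b, map \<theta> xs)) 1 as)"
      using C.multibalanced_nest_left[OF as, of 1]
      by (rule multibalanced_cong[OF _ bimod]) (simp add: D.pair_gen nest as)
  qed (rule D.pair_linear)
  have pair: "D.pair (lin_ext (\<lambda>(b, xs). D.cgen (b, map \<theta> xs)) t) 1 as = C.pair t 1 as"
    if t: "t \<in> C.cpow n" and as: "length as = n" for t n as
    using t
  proof (induction rule: tpow_induct)
    case zero
    show ?case by (simp only: lin_ext_0 D.pair_linear C.pair_linear)
  next
    case (gen b xs)
    with as show ?case by (simp add: lin_ext_gen[OF bal] D.pair_gen C.pair_gen nest)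
  next
    case (add t u)
    then show ?case by (simp only: lin_ext_add D.pair_linear C.pair_linear)
  qed
  interpret dual_coring_pairing s E B C \<theta> "map (\<lambda>(d, f). (d, inv_into (mcar C) \<theta> f)) D"
  proof
    show "comult C \<in> bimod_hom B C (tpow s B C 2)" by (rule comult)
    show "C.pair (comult C x) 1 [a, a'] = \<theta> x (a * a')" if x: "x \<in> mcar C" for x a a'
      using right_dual_comult[OF D \<theta>_mem[OF x], of a a']
          pair[OF bimod_homD(1)[OF comult x], of "[a, a']"]
      by (simp add: \<theta>_comult[OF x])
  qed
  show ?thesis
    using cohomology_iso_opposite by (simp add: cartier_cohomology_def rel_hochschild_cohomology_def)
qed

end
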